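(* Let $M$ be a compact Riemannian manifold of class $\mathcal C^2$ and dimension $m\ge2$, possibly with boundary, and let $X$ be a centered Gaussian field on $M$, a.s. of class $\mathcal C^2(M)$, such that for all $p\in M$ and all non-zero $v\in T_pM$ the Gaussian vector $(X(p),d_pX(v))$ admits a density. Let $c:[0,1]\to\mathcal C^2(M)$ be any (deterministic) $\mathcal C^2$ curve. Then, almost surely, the curve $t\mapsto c(t)+X$ is transverse to $\mathcal W$: $$\mathbb P\{c+X\pitchfork\mathcal W\}=1.$$
   Context: For $f\in\mathcal C^2(M)$, $r\in\mathbb R$ is a regular value of $f$ if $d_pf\neq0$ for all interior $p$ with $f(p)=r$ and $d_p(f|_{\partial M})\ne0$ for all $p\in\partial M$ with $f(p)=r$; otherwise $r$ is a critical value. A critical value $r$ is a Morse critical value if: at each interior point $p$ with $f(p)=r$, $d_pf=0$, the Hessian of $f$ is non-degenerate; at each $p\in\partial M$ with $f(p)=r$, $d_p(f|_{\partial M})=0$, the Hessian of $f|_{\partial M}$ is non-degenerate; and $d_pf\ne0$ for every $p\in\partial M$ with $f(p)=r$. $\mathcal U=\{f\in\mathcal C^2(M):0\text{ is a regular value of }f\}$, $\mathcal W=\mathcal C^2(M)\setminus\mathcal U$, $\mathcal U'=\{f\in\mathcal C^2(M):0\text{ is a Morse critical value of }f\}\subset\mathcal W$. For $f\in\mathcal U'$, $T_f\mathcal W:=\{\dot\gamma(0)\mid \gamma:\mathbb R\to\mathcal C^2(M)\text{ a }\mathcal C^1\text{ curve with }\gamma(0)=f,\ \gamma(\mathbb R)\subset\mathcal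 W\}$. A $\mathcal C^1$ curve $c:I\to\mathcal C^2(M)$ on an interval $I$ is transverse to $\mathcal W$, written $c\pitchfork\mathcal W$, if for all $t\in I$: $c(t)\in\mathcal W$ implies $c(t)\in\mathcal U'$ and $\dot c(t)\notin T_{c(t)}\mathcal W$; and moreover $c(\partial I)\cap\mathcal W=\emptyset$. *)

theory Defs
  imports "HOL-Probability.Probability"
begin

section \<open>Functions of class \<open>C\<^sup>1\<close> and \<open>C\<^sup>2\<close> on relatively open subsets of a half-space\<close>

text \<open>All derivatives are taken within the set \<open>S\<close>. For \<open>S\<close> relatively open in a closed half-space
  they are unique, and they are one-sided on the boundary hyperplane.\<close>

definition dir_deriv ::
  "'b::real_normed_vector set \<Rightarrow> 'b \<Rightarrow> ('b \<Rightarrow> 'c::real_normed_vector) \<Rightarrow> 'b \<Rightarrow> 'c" where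
  "dir_deriv S v f x = frechet_derivative f (at x within S) v"

definition C1_on :: "'b::euclidean_space set \<Rightarrow> ('b \<Rightarrow> 'c::real_normed_vector) \<Rightarrow> bool" where
  "C1_on S f \<longleftrightarrow> f differentiable_on S \<and> (\<forall>v. continuous_on S (dir_deriv S v f))"

definition C2_on :: "'b::euclidean_space set \<Rightarrow> ('b \<Rightarrow> 'c::real_normed_vector) \<Rightarrow> bool" where
  "C2_on S f \<longleftrightarrow> f differentiable_on S \<and> (\<forall>v. C1_on S (dir_deriv S v f))"

section \<open>Manifolds with boundary of class \<open>C\<^sup>2\<close>\<close>

text \<open>The manifold is the whole type \<open>'a\<close>. The model space is \<open>real \<times> 'e\<close>, with half-space
  \<open>s \<ge> 0\<close>, so the dimension is \<open>m = 1 + DIM('e)\<close>, and the boundary is modelled on \<open>'e\<close>.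
  A chart is a pair of its domain and the coordinate map.\<close>

type_synonym ('a, 'e) chart = "'a set \<times> ('a \<Rightarrow> real \<times> 'e)"

definition half_space :: "(real \<times> 'e::euclidean_space) set" where
  "half_space = {x. 0 \<le> fst x}"

definition chart_image :: "('a, 'e) chart \<Rightarrow> (real \<times> 'e) set" where
  "chart_image c = snd c ` fst c"

definition chart_inv :: "('a, 'e) chart \<Rightarrow> real \<times> 'e \<Rightarrow> 'a" where
  "chart_inv c = inv_into (fst c) (snd c)"

definition is_chart :: "('a::topological_space, 'e::euclidean_space) chart \<Rightarrow> bool" where
  "is_chart c \<longleftrightarrow> open (fst c) \<and> openin (top_of_set half_space) (chart_image c)
     \<and> homeomorphism (fst c) (chart_image c) (snd c) (chart_inv c)"

definition C2_atlas :: "('a::topological_space, 'e::euclidean_space) chart set \<Rightarrow> bool" where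
  "C2_atlas A \<longleftrightarrow> (\<forall>c\<in>A. is_chart c) \<and> (\<Union>c\<in>A. fst c) = UNIV
     \<and> (\<forall>c\<in>A. \<forall>d\<in>A. C2_on (snd c ` (fst c \<inter> fst d)) (snd d \<circ> chart_inv c))"

text \<open>A preferred chart around \<open>p\<close>. It identifies \<open>T\<^sub>pM\<close> with the model space \<open>real \<times> 'e\<close>, and, for
  a boundary point, \<open>T\<^sub>p(\<partial>M)\<close> with \<open>'e\<close>, seen as the hyperplane of first coordinate 0.
  Everything defined below is independent of this choice, up to that linear identification.\<close>

definition chart_at :: "('a, 'e) chart set \<Rightarrow> 'a \<Rightarrow> ('a, 'e) chart" where
  "chart_at A p = (SOME c. c \<in> A \<and> p \<in> fst c)"

definition boundary :: "('a, 'e) chart set \<Rightarrow> 'a set" where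
  "boundary A = {p. fst (snd (chart_at A p) p) = 0}"

text \<open>A metric of class \<open>C\<^sup>1\<close>, the maximal invariant regularity on a \<open>C\<^sup>2\<close> manifold. In a chart \<open>c\<close>
  its coefficients are obtained by transporting vectors from \<open>c\<close> to the preferred chart at
  each point.\<close>

definition riemannian_metric ::
  "('a, 'e::euclidean_space) chart set \<Rightarrow> ('a \<Rightarrow> real \<times> 'e \<Rightarrow> real \<times> 'e \<Rightarrow> real) \<Rightarrow> bool" where
  "riemannian_metric A g \<longleftrightarrow>
     (\<forall>p. bilinear (g p) \<and> (\<forall>u v. g p u v = g p v u) \<and> (\<forall>u. u \<noteq> 0 \<longrightarrow> 0 < g p u u))
     \<and> (\<forall>c\<in>A. \<forall>u v. C1_on (chart_image c) (\<lambda>x.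
          let q = chart_inv c x;
              push = (\<lambda>w. dir_deriv (chart_image c) w (snd (chart_at A q) \<circ> chart_inv c) x)
          in g q (push u) (push v)))"

section \<open>The space \<open>C\<^sup>2(M)\<close>, differentials and Hessians\<close>

definition C2_fun :: "('a, 'e::euclidean_space) chart set \<Rightarrow> ('a \<Rightarrow> real) set" where
  "C2_fun A = {f. \<forall>c\<in>A. C2_on (chart_image c) (f \<circ> chart_inv c)}"

definition differential ::
  "('a, 'e::euclidean_space) chart set \<Rightarrow> ('a \<Rightarrow> real) \<Rightarrow> 'a \<Rightarrow> real \<times> 'e \<Rightarrow> real" where
  "differential A f p v =
     (let c = chart_at A p in dir_deriv (chart_image c) v (f \<circ> chart_inv c) (snd c p))"

text \<open>The Hessians are only used at critical points, where the second derivative in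
  coordinates is an intrinsic bilinear form on the tangent space.\<close>

definition hessian ::
  "('a, 'e::euclidean_space) chart set \<Rightarrow> ('a \<Rightarrow> real) \<Rightarrow> 'a \<Rightarrow> real \<times> 'e \<Rightarrow> real \<times> 'e \<Rightarrow> real" where
  "hessian A f p u v =
     (let c = chart_at A p; S = chart_image c
      in dir_deriv S u (dir_deriv S v (f \<circ> chart_inv c)) (snd c p))"

text \<open>A chart \<open>c\<close> induces the chart \<open>snd \<circ> snd c\<close> of the boundary.
  The next definitions concern \<open>f\<close> restricted to the boundary, for boundary points \<open>p\<close>.\<close>

definition bd_chart_image :: "('a, 'e) chart \<Rightarrow> 'e set" where
  "bd_chart_image c = {y. (0, y) \<in> chart_image c}"

definition bd_chart_inv :: "('a, 'e) chart \<Rightarrow> 'e \<Rightarrow> 'a" where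
  "bd_chart_inv c y = chart_inv c (0, y)"

definition bd_differential ::
  "('a, 'e::euclidean_space) chart set \<Rightarrow> ('a \<Rightarrow> real) \<Rightarrow> 'a \<Rightarrow> 'e \<Rightarrow> real" where
  "bd_differential A f p v =
     (let c = chart_at A p
      in dir_deriv (bd_chart_image c) v (f \<circ> bd_chart_inv c) (snd (snd c p)))"

definition bd_hessian ::
  "('a, 'e::euclidean_space) chart set \<Rightarrow> ('a \<Rightarrow> real) \<Rightarrow> 'a \<Rightarrow> 'e \<Rightarrow> 'e \<Rightarrow> real" where
  "bd_hessian A f p u v =
     (let c = chart_at A p; S = bd_chart_image c
      in dir_deriv S u (dir_deriv S v (f \<circ> bd_chart_inv c)) (snd (snd c p)))"

definition nondegenerate :: "('b::zero \<Rightarrow> 'b \<Rightarrow> real) \<Rightarrow> bool" where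
  "nondegenerate B \<longleftrightarrow> (\<forall>u. (\<forall>v. B u v = 0) \<longrightarrow> u = 0)"

section \<open>Regular and Morse critical values\<close>

definition regular_value ::
  "('a, 'e::euclidean_space) chart set \<Rightarrow> ('a \<Rightarrow> real) \<Rightarrow> real \<Rightarrow> bool" where
  "regular_value A f r \<longleftrightarrow>
     (\<forall>p. p \<notin> boundary A \<and> f p = r \<longrightarrow> differential A f p \<noteq> (\<lambda>v. 0))
     \<and> (\<forall>p\<in>boundary A. f p = r \<longrightarrow> bd_differential A f p \<noteq> (\<lambda>v. 0))"

definition morse_critical_value ::
  "('a, 'e::euclidean_space) chart set \<Rightarrow> ('a \<Rightarrow> real) \<Rightarrow> real \<Rightarrow> bool" where
  "morse_critical_value A f r \<longleftrightarrow> \<not> regular_value A f r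
     \<and> (\<forall>p. p \<notin> boundary A \<and> f p = r \<and> differential A f p = (\<lambda>v. 0)
          \<longrightarrow> nondegenerate (hessian A f p))
     \<and> (\<forall>p\<in>boundary A. f p = r \<and> bd_differential A f p = (\<lambda>v. 0)
          \<longrightarrow> nondegenerate (bd_hessian A f p))
     \<and> (\<forall>p\<in>boundary A. f p = r \<longrightarrow> differential A f p \<noteq> (\<lambda>v. 0))"

definition regular_set :: "('a, 'e::euclidean_space) chart set \<Rightarrow> ('a \<Rightarrow> real) set" where
  "regular_set A = {f \<in> C2_fun A. regular_value A f 0}"

definition discriminant :: "('a, 'e::euclidean_space) chart set \<Rightarrow> ('a \<Rightarrow> real) set" where
  "discriminant A = C2_fun A - regular_set A"

definition morse_set :: "('a, 'e::euclidean_space) chart set \<Rightarrow> ('a \<Rightarrow> real) set" where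
  "morse_set A = {f \<in> C2_fun A. morse_critical_value A f 0}"

section \<open>Differentiable curves in \<open>C\<^sup>2(M)\<close> and transversality\<close>

text \<open>Convergence in \<open>C\<^sup>2(M)\<close>: uniform convergence on compact sets, in every chart, of the functions
  and their derivatives of order at most 2. As \<open>M\<close> is compact, this is convergence for the usual
  Banach space topology of \<open>C\<^sup>2(M)\<close>.\<close>

definition C2_tendsto ::
  "('a, 'e::euclidean_space) chart set \<Rightarrow> ('i \<Rightarrow> 'a \<Rightarrow> real) \<Rightarrow> ('a \<Rightarrow> real) \<Rightarrow> 'i filter \<Rightarrow> bool" where
  "C2_tendsto A h f F \<longleftrightarrow>
     (\<forall>c\<in>A. \<forall>K. compact K \<and> K \<subseteq> chart_image c \<longrightarrow>
        (let S = chart_image c; \<psi> = chart_inv c in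
          uniform_limit K (\<lambda>i. h i \<circ> \<psi>) (f \<circ> \<psi>) F
          \<and> (\<forall>v. uniform_limit K (\<lambda>i. dir_deriv S v (h i \<circ> \<psi>)) (dir_deriv S v (f \<circ> \<psi>)) F)
          \<and> (\<forall>u v. uniform_limit K (\<lambda>i. dir_deriv S u (dir_deriv S v (h i \<circ> \<psi>)))
                     (dir_deriv S u (dir_deriv S v (f \<circ> \<psi>))) F)))"

definition has_curve_deriv ::
  "('a, 'e::euclidean_space) chart set \<Rightarrow> real set \<Rightarrow> (real \<Rightarrow> 'a \<Rightarrow> real)
     \<Rightarrow> (real \<Rightarrow> 'a \<Rightarrow> real) \<Rightarrow> bool" where
  "has_curve_deriv A I \<gamma> \<gamma>' \<longleftrightarrow> \<gamma> ` I \<subseteq> C2_fun A \<and> \<gamma>' ` I \<subseteq> C2_fun A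
     \<and> (\<forall>t\<in>I. C2_tendsto A (\<lambda>s p. (\<gamma> s p - \<gamma> t p) / (s - t)) (\<gamma>' t) (at t within I))"

definition has_C1_curve_deriv ::
  "('a, 'e::euclidean_space) chart set \<Rightarrow> real set \<Rightarrow> (real \<Rightarrow> 'a \<Rightarrow> real)
     \<Rightarrow> (real \<Rightarrow> 'a \<Rightarrow> real) \<Rightarrow> bool" where
  "has_C1_curve_deriv A I \<gamma> \<gamma>' \<longleftrightarrow> has_curve_deriv A I \<gamma> \<gamma>'
     \<and> (\<forall>t\<in>I. C2_tendsto A \<gamma>' (\<gamma>' t) (at t within I))"

definition C2_curve ::
  "('a, 'e::euclidean_space) chart set \<Rightarrow> real set \<Rightarrow> (real \<Rightarrow> 'a \<Rightarrow> real) \<Rightarrow> bool" where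
  "C2_curve A I \<gamma> \<longleftrightarrow>
     (\<exists>\<gamma>' \<gamma>''. has_curve_deriv A I \<gamma> \<gamma>' \<and> has_C1_curve_deriv A I \<gamma>' \<gamma>'')"

definition discriminant_tangent ::
  "('a, 'e::euclidean_space) chart set \<Rightarrow> ('a \<Rightarrow> real) \<Rightarrow> ('a \<Rightarrow> real) set" where
  "discriminant_tangent A f =
     {\<gamma>' 0 | \<gamma> \<gamma>'. has_C1_curve_deriv A UNIV \<gamma> \<gamma>' \<and> \<gamma> 0 = f \<and> range \<gamma> \<subseteq> discriminant A}"

definition transverse_to_discriminant ::
  "('a, 'e::euclidean_space) chart set \<Rightarrow> real set \<Rightarrow> (real \<Rightarrow> 'a \<Rightarrow> real) \<Rightarrow> bool" where
  "transverse_to_discriminant A I \<gamma> \<longleftrightarrow>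
     (\<exists>\<gamma>'. has_C1_curve_deriv A I \<gamma> \<gamma>'
        \<and> (\<forall>t\<in>I. \<gamma> t \<in> discriminant A \<longrightarrow>
             \<gamma> t \<in> morse_set A \<and> \<gamma>' t \<notin> discriminant_tangent A (\<gamma> t))
        \<and> \<gamma> ` (I \<inter> frontier I) \<inter> discriminant A = {})"

section \<open>Gaussian fields\<close>

text \<open>A centered Gaussian variable may be degenerate, that is, almost surely 0.\<close>

definition centered_gaussian :: "'w measure \<Rightarrow> ('w \<Rightarrow> real) \<Rightarrow> bool" where
  "centered_gaussian P Y \<longleftrightarrow> Y \<in> borel_measurable P
     \<and> ((AE \<omega> in P. Y \<omega> = 0) \<or> (\<exists>\<sigma>>0. distributed P lborel Y (normal_density 0 \<sigma>)))"

definition centered_gaussian_field :: "'w measure \<Rightarrow> ('w \<Rightarrow> 'a \<Rightarrow> real) \<Rightarrow> bool" where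
  "centered_gaussian_field P X \<longleftrightarrow>
     (\<forall>S a. finite S \<longrightarrow> centered_gaussian P (\<lambda>\<omega>. \<Sum>p\<in>S. a p * X \<omega> p))"

text \<open>The random vector is allowed to be defined only almost surely, like the differential of a
  field that is almost surely differentiable; hence the measurable modification \<open>Y\<close>.\<close>

definition admits_density :: "'w measure \<Rightarrow> ('w \<Rightarrow> 'b::euclidean_space) \<Rightarrow> bool" where
  "admits_density P Z \<longleftrightarrow>
     (\<exists>Y \<rho>. (AE \<omega> in P. Y \<omega> = Z \<omega>) \<and> distributed P lborel Y \<rho>)"

end

theory Submission
  imports Defs
begin

text \<open>In a chart, a critical zero of \<open>c t + X\<close> at \<open>x\<close> is a zero of the jet
  \<open>(f, df)\<close> of \<open>f = c t + X\<close>. Translating \<open>X\<close> by the covariances with finitely many of its jets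
  moves the jet at a given point in every direction, by nondegeneracy. For fixed \<open>X\<close>, Sard's
  theorem applied to the resulting finite-dimensional family shows that for almost every translation
  the map \<open>(t, x) \<mapsto> (f x, df x)\<close> vanishes only where \<open>d\<^sup>2f x\<close> is invertible and the velocity of
  \<open>c\<close> is nonzero. The law of \<open>X\<close> is quasi-invariant under these translations (Cameron--Martin), so by
  Fubini the same holds almost surely for \<open>X\<close> itself. At such a zero, a curve that stays in the
  discriminant has vanishing velocity, because its critical points nearby converge to the zero.\<close>

section \<open>Sard's theorem in Euclidean spaces\<close>

text \<open>Sard is used between spaces of equal dimension: time and position form
  \<open>real \<times> 'b\<close>, and so do value and gradient. There plain differentiability
  suffices, which is why C^2 regularity is enough. At a critical zero the derivative of the jet map
  is block triangular, with the velocity \<open>c' t x\<close> and the Hessian on the diagonal, so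
  one singularity statement yields both nondegeneracy claims. The obstacle is measurability: the
  exceptional event is a union over uncountably many points and directions. It becomes the vanishing
  of the infimum of a continuous function on a compact set, hence is tested on a countable dense
  subset and defines a measurable set of jets. The field is therefore a random element of an
  uncountable product, and only the null sets of its law are compared. The absence of critical zeros
  at the end times and of full critical zeros on the boundary comes from the same argument with
  degenerate data: a constant curve with zero velocity, or a slice of one dimension less, makes
  every zero singular.\<close>

typedef (overloaded) 'b basis_index = "Basis :: 'b::euclidean_space set"
  using nonempty_Basis by blast

instance basis_index :: (euclidean_space) finite
proof
  have "inj_on Rep_basis_index (UNIV :: 'a basis_index set)"
    by (simp add: Rep_basis_index_inject inj_on_def)
  moreover have "finite (range (Rep_basis_index :: 'a basis_index \<Rightarrow> 'a))"
    by (rule finite_subset[OF _ finite_Basis]) (use Rep_basis_index in auto)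
  ultimately show "finite (UNIV :: 'a basis_index set)"
    using finite_imageD by blast
qed

text \<open>\<open>baby_Sard\<close> is stated for \<open>real ^ 'n\<close> with a finite
  well-ordered index type. Any injection into the naturals provides such an order; it carries no
  geometric meaning.\<close>

instantiation basis_index :: (euclidean_space) wellorder
begin

definition basis_rank :: "'a basis_index \<Rightarrow> nat" where
  "basis_rank = (SOME r. inj r)"

definition less_eq_basis_index :: "'a basis_index \<Rightarrow> 'a basis_index \<Rightarrow> bool" where
  "i \<le> j \<longleftrightarrow> basis_rank i \<le> basis_rank j"

definition less_basis_index :: "'a basis_index \<Rightarrow> 'a basis_index \<Rightarrow> bool" where
  "i < j \<longleftrightarrow> basis_rank i < basis_rank j"

instance
proof -
  have "\<exists>r :: 'a basis_index \<Rightarrow> nat. inj r"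
    using finite_imp_inj_to_nat_seg[of "UNIV :: 'a basis_index set"] by auto
  then have inj: "inj (basis_rank :: 'a basis_index \<Rightarrow> nat)"
    unfolding basis_rank_def by (rule someI_ex)
  show "OFCLASS('a basis_index, wellorder_class)"
  proof
    fix P :: "'a basis_index \<Rightarrow> bool" and a :: "'a basis_index"
    assume *: "\<And>x. (\<And>y. y < x \<Longrightarrow> P y) \<Longrightarrow> P x"
    show "P a"
      by (induction a rule: measure_induct_rule[of basis_rank]) (auto simp: less_basis_index_def intro: *)
  qed (use inj in \<open>auto simp: less_eq_basis_index_def less_basis_index_def inj_def\<close>)
qed

end

lemma card_basis_index: "CARD('b::euclidean_space basis_index) = DIM('b)"
  by (metis type_definition.card type_definition_basis_index)

definition to_coords :: "'b::euclidean_space \<Rightarrow> real ^ 'b basis_index" where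
  "to_coords x = (\<chi> i. x \<bullet> Rep_basis_index i)"

definition of_coords :: "real ^ 'b basis_index \<Rightarrow> 'b::euclidean_space" where
  "of_coords y = (\<Sum>i\<in>UNIV. (y $ i) *\<^sub>R Rep_basis_index i)"

lemma bij_betw_Rep_basis_index:
  "bij_betw Rep_basis_index (UNIV :: 'b::euclidean_space basis_index set) Basis"
  by (metis type_definition.Rep_range type_definition_basis_index bij_betw_def
      type_definition.Rep_inject inj_on_def)

lemma of_to_coords [simp]: "of_coords (to_coords x) = (x :: 'b::euclidean_space)"
proof -
  have "of_coords (to_coords x) = (\<Sum>b\<in>Basis. (x \<bullet> b) *\<^sub>R b)"
    unfolding of_coords_def to_coords_def
    by (simp add: sum.reindex_bij_betw[OF bij_betw_Rep_basis_index, of "\<lambda>b. (x \<bullet> b) *\<^sub>R b"])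
  then show ?thesis by (simp add: euclidean_representation)
qed

lemma linear_to_coords: "linear (to_coords :: 'b::euclidean_space \<Rightarrow> _)"
  by (intro linearI) (simp_all add: to_coords_def vec_eq_iff inner_left_distrib)

lemma linear_of_coords: "linear (of_coords :: _ \<Rightarrow> 'b::euclidean_space)"
  by (intro linearI)
    (simp_all add: of_coords_def scaleR_left_distrib sum.distrib scaleR_right.sum)

text \<open>In coordinates a non-injective derivative is a rank-deficient square matrix, so
  \<open>baby_Sard\<close> applies. Here \<open>S\<close> is arbitrary and \<open>f'\<close> is any
  derivative within \<open>S\<close>, which matters for thin sets where derivatives within the set
  are not unique.\<close>

theorem Sard_singular:
  fixes f :: "'b::euclidean_space \<Rightarrow> 'b"
  assumes der: "\<And>x. x \<in> S \<Longrightarrow> (f has_derivative f' x) (at x within S)"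
    and sing: "\<And>x. x \<in> S \<Longrightarrow> \<not> inj (f' x)"
  shows "negligible (f ` S)"
proof -
  define T where "T = to_coords ` S"
  define g where "g = to_coords \<circ> f \<circ> of_coords"
  define g' where "g' y = to_coords \<circ> f' (of_coords y) \<circ> of_coords" for y
  have bl: "bounded_linear (to_coords :: 'b \<Rightarrow> _)" "bounded_linear (of_coords :: _ \<Rightarrow> 'b)"
    by (simp_all add: linear_to_coords linear_of_coords linear_conv_bounded_linear[symmetric])
  have im: "of_coords ` T = S"
    by (auto simp: T_def image_image)
  have "negligible (g ` T)"
  proof (rule baby_Sard)
    fix y assume y: "y \<in> T"
    then have x: "of_coords y \<in> S" using im by blast
    have "(f has_derivative f' (of_coords y)) (at (of_coords y) within of_coords ` T)"
      unfolding im by (rule der[OF x])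
    then have "(f \<circ> of_coords has_derivative f' (of_coords y) \<circ> of_coords) (at y within T)"
      by (intro diff_chain_within bounded_linear_imp_has_derivative bl)
    then show d: "(g has_derivative g' y) (at y within T)"
      unfolding g_def g'_def comp_assoc
      by (rule diff_chain_within[OF _ bounded_linear_imp_has_derivative[OF bl(1)]])
    have lin: "linear (g' y)"
      using d has_derivative_linear by blast
    from sing[OF x] obtain u v where uv: "u \<noteq> v" "f' (of_coords y) u = f' (of_coords y) v"
      by (auto simp: inj_def)
    then have "g' y (to_coords u) = g' y (to_coords v)" "to_coords u \<noteq> to_coords v"
      by (simp add: g'_def, metis of_to_coords)
    then have "\<not> inj (g' y)" by (auto simp: inj_def)
    then have "\<not> inj ((*v) (matrix (g' y)))"
      using lin by (simp add: matrix_works)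
    then show "rank (matrix (g' y)) < CARD('b basis_index)"
      by (simp add: less_rank_noninjective)
  qed simp
  \<comment> \<open>A differentiable map between spaces of equal dimension preserves negligible
    sets.\<close>
  then have "negligible (of_coords ` (g ` T))"
    by (intro negligible_differentiable_image_negligible[of "g ` T"]
        bounded_linear_imp_differentiable_on bl) (simp_all add: card_basis_index)
  moreover have "of_coords ` (g ` T) = f ` S"
    unfolding image_image g_def comp_def of_to_coords using im[symmetric] by (simp add: image_image)
  ultimately show ?thesis by simp
qed

section \<open>Gaussian Hilbert spaces\<close>

lemma (in prob_space) char_distr_Complex:
  assumes [measurable]: "Y \<in> borel_measurable M"
  shows "char (distr M borel Y) t = Complex (expectation (\<lambda>x. cos (t * Y x))) (expectation (\<lambda>x. sin (t * Y x)))"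
proof -
  have int: "integrable M (\<lambda>x. iexp (t * Y x))"
    by (rule integrable_const_bound[where B = 1]) (auto simp: norm_exp_i_times)
  have "char (distr M borel Y) t = (\<integral>x. iexp (t * Y x) \<partial>M)"
    unfolding char_def by (subst integral_distr) auto
  also have "\<dots> = Complex (expectation (\<lambda>x. cos (t * Y x))) (expectation (\<lambda>x. sin (t * Y x)))"
  proof (rule complex_eqI)
    show "Re (\<integral>x. iexp (t * Y x) \<partial>M)
        = Re (Complex (expectation (\<lambda>x. cos (t * Y x))) (expectation (\<lambda>x. sin (t * Y x))))"
      using integral_Re[OF int] by (simp add: Re_exp)
    show "Im (\<integral>x. iexp (t * Y x) \<partial>M)
        = Im (Complex (expectation (\<lambda>x. cos (t * Y x))) (expectation (\<lambda>x. sin (t * Y x))))"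
      using integral_Im[OF int] by (simp add: Im_exp)
  qed
  finally show ?thesis .
qed

lemma (in prob_space) integrable_bounded:
  fixes g :: "'a \<Rightarrow> real"
  assumes "g \<in> borel_measurable M" "\<And>x. \<bar>g x\<bar> \<le> C"
  shows "integrable M g"
  using assms by (intro integrable_const_bound[where B = C]) auto

text \<open>By \<open>cos\<close> at \<open>t = 0\<close> the weight \<open>g\<close> has mean zero,
  so \<open>h = 1 + g / D\<close> is a probability density. Under it \<open>Y\<close> keeps its
  characteristic function, hence its law, by Levy's theorem; comparing the two probabilities of
  \<open>Y \<in> A\<close> isolates the integral of \<open>g\<close> against the indicator.\<close>

lemma (in prob_space) orthogonal_indicator:
  fixes g :: "'a \<Rightarrow> real"
  assumes [measurable]: "g \<in> borel_measurable M" "Y \<in> borel_measurable M" "A \<in> sets borel"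
    and g: "\<And>x. \<bar>g x\<bar> \<le> C"
    and cos: "\<And>t. expectation (\<lambda>x. g x * cos (t * Y x)) = 0"
    and sin: "\<And>t. expectation (\<lambda>x. g x * sin (t * Y x)) = 0"
  shows "expectation (\<lambda>x. g x * indicator A (Y x)) = 0"
proof -
  \<comment> \<open>The summand 1 makes \<open>D\<close> positive even for \<open>C = 0\<close>; as
    \<open>D\<close> bounds \<bar>g\<bar>, the density \<open>h\<close> is nonnegative.\<close>
  define D where "D = \<bar>C\<bar> + 1"
  have D: "D > 0" by (simp add: D_def)
  define h where "h x = 1 + g x / D" for x
  have [measurable]: "h \<in> borel_measurable M" unfolding h_def by measurable
  have gD: "\<bar>g x / D\<bar> \<le> 1" for x
    using g[of x] D by (simp add: D_def)
  have h0: "0 \<le> h x" for x using gD[of x] unfolding h_def abs_le_iff by linarith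
  have intg: "integrable M (\<lambda>x. g x * f x)" if "f \<in> borel_measurable M" "\<And>x. \<bar>f x\<bar> \<le> 1" for f
  proof (rule integrable_bounded)
    show "\<bar>g x * f x\<bar> \<le> D" for x
    proof -
      have "\<bar>g x * f x\<bar> \<le> C * 1"
        unfolding abs_mult using g[of x] that(2)[of x] by (intro mult_mono) auto
      then show ?thesis by (simp add: D_def)
    qed
  qed (use that(1) in auto)
  have inth: "expectation (\<lambda>x. h x * f x) = expectation f + expectation (\<lambda>x. g x * f x) / D"
    if "f \<in> borel_measurable M" "\<And>x. \<bar>f x\<bar> \<le> 1" for f
  proof -
    have "integrable M f" using that by (rule integrable_bounded)
    moreover have "h x * f x = f x + g x * f x / D" for x
      by (simp add: h_def algebra_simps)
    ultimately show ?thesis using intg[OF that] by simp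
  qed
  define N where "N = density M (\<lambda>x. ennreal (h x))"
  have Eg: "expectation g = 0" using cos[of 0] by simp
  have "integrable M h"
  proof (rule integrable_bounded)
    show "\<bar>h x\<bar> \<le> 2" for x
      using gD[of x] h0[of x] unfolding h_def abs_le_iff by linarith
  qed simp
  then have "emeasure N (space N) = ennreal (expectation h)"
    by (simp add: N_def emeasure_density nn_integral_eq_integral h0 cong: nn_integral_cong)
  also have "expectation h = 1"
    using inth[of "\<lambda>_. 1"] Eg by (simp add: prob_space)
  finally interpret N: prob_space N by (intro prob_spaceI) simp
  have EN: "N.expectation f = expectation (\<lambda>x. h x * f x)" if "f \<in> borel_measurable M" for f :: "'a \<Rightarrow> real"
    unfolding N_def using that by (subst integral_density) (auto simp: h0)
  have [measurable]: "Y \<in> borel_measurable N" by (simp add: N_def)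
  have "char (distr N borel Y) t = char (distr M borel Y) t" for t
    by (simp add: char_distr_Complex N.char_distr_Complex EN inth cos sin)
  then have "distr N borel Y = distr M borel Y"
    by (intro Levy_uniqueness real_distribution_distr N.real_distribution_distr) auto
  moreover have "integral\<^sup>L (distr N borel Y) (indicat_real A) = N.expectation (\<lambda>x. indicator A (Y x))"
    "integral\<^sup>L (distr M borel Y) (indicat_real A) = expectation (\<lambda>x. indicator A (Y x))"
    by (rule integral_distr; simp)+
  ultimately have "N.expectation (\<lambda>x. indicator A (Y x)) = expectation (\<lambda>x. indicat_real A (Y x))"
    by simp
  then show ?thesis
    using D by (simp add: EN inth indicator_le_1)
qed

text \<open>The induction converts one variable at a time: its indicator is absorbed into the
  bounded weight \<open>g\<close>, while the remaining variables still enter through cosine and sine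
  of their linear combinations.\<close>

lemma (in prob_space) orthogonal_indicators:
  fixes g :: "'a \<Rightarrow> real"
  assumes "finite F"
    and "\<And>i. i \<in> F \<Longrightarrow> Y i \<in> borel_measurable M" "\<And>i. i \<in> F \<Longrightarrow> A i \<in> sets borel"
    and "g \<in> borel_measurable M" "\<And>x. \<bar>g x\<bar> \<le> C"
    and "\<And>s. expectation (\<lambda>x. g x * cos (\<Sum>i\<in>F. s i * Y i x)) = 0"
    and "\<And>s. expectation (\<lambda>x. g x * sin (\<Sum>i\<in>F. s i * Y i x)) = 0"
  shows "expectation (\<lambda>x. g x * (\<Prod>i\<in>F. indicator (A i) (Y i x))) = 0"
  using assms
proof (induction F arbitrary: g C rule: finite_induct)
  case empty
  then show ?case by simp
next
  case (insert j F)
  have [measurable]: "Y j \<in> borel_measurable M" "A j \<in> sets borel" "g \<in> borel_measurable M"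
    using insert.prems by auto
  have [measurable]: "(\<lambda>x. \<Sum>i\<in>F. s i * Y i x) \<in> borel_measurable M" for s
    using insert.prems by (intro borel_measurable_sum borel_measurable_times) auto
  have bd: "\<bar>g x * f x\<bar> \<le> C" if "\<And>x. \<bar>f x\<bar> \<le> 1" for f :: "'a \<Rightarrow> real" and x
  proof -
    have "\<bar>g x * f x\<bar> \<le> C * 1"
      unfolding abs_mult using insert.prems(4)[of x] that[of x] by (intro mult_mono) auto
    then show ?thesis by simp
  qed
  have int: "integrable M (\<lambda>x. g x * f x)" if "f \<in> borel_measurable M" "\<And>x. \<bar>f x\<bar> \<le> 1" for f
    using that by (intro integrable_bounded[where C = C] bd) auto
  have C: "expectation (\<lambda>x. g x * cos ((\<Sum>i\<in>F. s i * Y i x) + r * Y j x)) = 0"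
    and S: "expectation (\<lambda>x. g x * sin ((\<Sum>i\<in>F. s i * Y i x) + r * Y j x)) = 0" for s r
  proof -
    define s' where "s' = s(j := r)"
    have "(\<Sum>i\<in>insert j F. s' i * Y i x) = (\<Sum>i\<in>F. s i * Y i x) + r * Y j x" for x
    proof -
      have "(\<Sum>i\<in>F. s' i * Y i x) = (\<Sum>i\<in>F. s i * Y i x)"
        using insert.hyps by (intro sum.cong) (auto simp: s'_def)
      then show ?thesis using insert.hyps by (simp add: s'_def)
    qed
    then show "expectation (\<lambda>x. g x * cos ((\<Sum>i\<in>F. s i * Y i x) + r * Y j x)) = 0"
      "expectation (\<lambda>x. g x * sin ((\<Sum>i\<in>F. s i * Y i x) + r * Y j x)) = 0"
      using insert.prems(5)[of s'] insert.prems(6)[of s'] by simp_all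
  qed
  \<comment> \<open>The frequencies \<open>t\<close> and \<open>-t\<close> of \<open>Y j\<close>
    together give, by the addition formulas, the products in which \<open>Y j\<close> is separated
    from the other variables.\<close>
  have sep: "expectation (\<lambda>x. g x * f (\<Sum>i\<in>F. s i * Y i x) * h (t * Y j x)) = 0"
    if fh: "f = cos \<or> f = sin" "h = cos \<or> h = sin" for s t and f h :: "real \<Rightarrow> real"
  proof -
    let ?U = "\<lambda>x. \<Sum>i\<in>F. s i * Y i x" and ?V = "\<lambda>x. t * Y j x"
    have ints: "integrable M (\<lambda>x. g x * cos (?U x + ?V x))" "integrable M (\<lambda>x. g x * cos (?U x - ?V x))"
      "integrable M (\<lambda>x. g x * sin (?U x + ?V x))" "integrable M (\<lambda>x. g x * sin (?U x - ?V x))"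
      by (intro int; simp)+
    have E: "expectation (\<lambda>x. g x * cos (?U x + ?V x)) = 0" "expectation (\<lambda>x. g x * cos (?U x - ?V x)) = 0"
      "expectation (\<lambda>x. g x * sin (?U x + ?V x)) = 0" "expectation (\<lambda>x. g x * sin (?U x - ?V x)) = 0"
      using C[of s t] C[of s "-t"] S[of s t] S[of s "-t"] by simp_all
    consider "f = cos" "h = cos" | "f = cos" "h = sin" | "f = sin" "h = cos" | "f = sin" "h = sin"
      using fh by blast
    then show ?thesis
    proof cases
      case 1
      have *: "g x * f (?U x) * h (?V x) = (g x * cos (?U x + ?V x) + g x * cos (?U x - ?V x)) / 2" for x
        unfolding 1 cos_add cos_diff by (simp add: algebra_simps)
      show ?thesis
        by (simp only: * integral_divide_zero Bochner_Integration.integral_add[OF ints(1,2)] E) simp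
    next
      case 2
      have *: "g x * f (?U x) * h (?V x) = (g x * sin (?U x + ?V x) - g x * sin (?U x - ?V x)) / 2" for x
        unfolding 2 sin_add sin_diff by (simp add: algebra_simps)
      show ?thesis
        by (simp only: * integral_divide_zero Bochner_Integration.integral_diff[OF ints(3,4)] E) simp
    next
      case 3
      have *: "g x * f (?U x) * h (?V x) = (g x * sin (?U x + ?V x) + g x * sin (?U x - ?V x)) / 2" for x
        unfolding 3 sin_add sin_diff by (simp add: algebra_simps)
      show ?thesis
        by (simp only: * integral_divide_zero Bochner_Integration.integral_add[OF ints(3,4)] E) simp
    next
      case 4
      have *: "g x * f (?U x) * h (?V x) = (g x * cos (?U x - ?V x) - g x * cos (?U x + ?V x)) / 2" for x
        unfolding 4 cos_add cos_diff by (simp add: algebra_simps)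
      show ?thesis
        by (simp only: * integral_divide_zero Bochner_Integration.integral_diff[OF ints(2,1)] E) simp
    qed
  qed
  have ind: "expectation (\<lambda>x. g x * f (\<Sum>i\<in>F. s i * Y i x) * indicator (A j) (Y j x)) = 0"
    if f: "f = cos \<or> f = sin" for s and f :: "real \<Rightarrow> real"
  proof (rule orthogonal_indicator[where C = C])
    show "\<bar>g x * f (\<Sum>i\<in>F. s i * Y i x)\<bar> \<le> C" for x
      using f by (intro bd) auto
    show "(\<lambda>x. g x * f (\<Sum>i\<in>F. s i * Y i x)) \<in> borel_measurable M"
      using f by auto
    show "expectation (\<lambda>x. g x * f (\<Sum>i\<in>F. s i * Y i x) * cos (t * Y j x)) = 0"
      "expectation (\<lambda>x. g x * f (\<Sum>i\<in>F. s i * Y i x) * sin (t * Y j x)) = 0" for t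
      using sep[OF f, of cos] sep[OF f, of sin] by simp_all
  qed auto
  have "expectation (\<lambda>x. (g x * indicator (A j) (Y j x)) * (\<Prod>i\<in>F. indicator (A i) (Y i x))) = 0"
  proof (rule insert.IH[of _ C])
    show "\<bar>g x * indicator (A j) (Y j x)\<bar> \<le> C" for x
      by (intro bd) (simp add: indicator_def)
    show "expectation (\<lambda>x. g x * indicator (A j) (Y j x) * cos (\<Sum>i\<in>F. s i * Y i x)) = 0"
      "expectation (\<lambda>x. g x * indicator (A j) (Y j x) * sin (\<Sum>i\<in>F. s i * Y i x)) = 0" for s
      using ind[of cos s] ind[of sin s] by (simp_all only: mult_ac) simp_all
    show "Y i \<in> borel_measurable M" "A i \<in> sets borel" if "i \<in> F" for i
      using insert.prems(1,2) that by blast+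
    show "(\<lambda>x. g x * indicator (A j) (Y j x)) \<in> borel_measurable M"
      by simp
  qed
  then show ?case
    using insert.hyps by (simp add: mult.assoc)
qed


section \<open>Centered Gaussian laws through their characteristic functions\<close>

text \<open>The characteristic function of a centered normal law with standard deviation \<sigma>,
  split into real and imaginary part. Unlike a density it covers \<sigma> = 0 and passes to
  limits.\<close>

definition (in prob_space) gaussian_char :: "real \<Rightarrow> ('a \<Rightarrow> real) \<Rightarrow> bool" where
  "gaussian_char \<sigma> Y \<longleftrightarrow> 0 \<le> \<sigma> \<and> Y \<in> borel_measurable M
     \<and> (\<forall>t. expectation (\<lambda>x. cos (t * Y x)) = exp (- (\<sigma> * t)\<^sup>2 / 2)
          \<and> expectation (\<lambda>x. sin (t * Y x)) = 0)"

lemma (in prob_space) distr_std_normal: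
  assumes Y: "gaussian_char \<sigma> Y" and \<sigma>: "\<sigma> > 0"
  shows "distr M borel (\<lambda>x. Y x / \<sigma>) = std_normal_distribution"
proof (rule Levy_uniqueness)
  have [measurable]: "Y \<in> borel_measurable M"
    using Y by (simp add: gaussian_char_def)
  show "real_distribution (distr M borel (\<lambda>x. Y x / \<sigma>))"
    by (rule real_distribution_distr) simp
  show "real_distribution std_normal_distribution"
    by (rule real_dist_normal_dist)
  show "char (distr M borel (\<lambda>x. Y x / \<sigma>)) = char std_normal_distribution"
  proof
    fix t
    have "expectation (\<lambda>x. cos (t / \<sigma> * Y x)) = exp (- t\<^sup>2 / 2)" "expectation (\<lambda>x. sin (t / \<sigma> * Y x)) = 0"
      using Y \<sigma> unfolding gaussian_char_def by (auto dest!: spec[where x = "t / \<sigma>"])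
    then show "char (distr M borel (\<lambda>x. Y x / \<sigma>)) t = char std_normal_distribution t"
      by (simp add: char_distr_Complex char_std_normal_distribution complex_eq_iff)
  qed
qed

lemma (in prob_space) gaussian_char_0:
  assumes Y: "gaussian_char 0 Y"
  shows "AE x in M. Y x = 0"
proof -
  have [measurable]: "Y \<in> borel_measurable M"
    using Y by (simp add: gaussian_char_def)
  define zero_rv where "zero_rv = (\<lambda>x::'a. 0::real)"
  have [measurable]: "zero_rv \<in> borel_measurable M" by (simp add: zero_rv_def)
  have "char (distr M borel Y) t = char (distr M borel zero_rv) t" for t
    using Y by (simp add: char_distr_Complex gaussian_char_def) (simp add: zero_rv_def prob_space)
  then have "distr M borel Y = distr M borel zero_rv"
    by (intro Levy_uniqueness real_distribution_distr) auto
  moreover have "AE y in distr M borel zero_rv. y = 0"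
    by (simp add: AE_distr_iff) (simp add: zero_rv_def)
  ultimately have "AE y in distr M borel Y. y = 0"
    by (simp only:)
  then show ?thesis by (simp add: AE_distr_iff)
qed

lemma (in prob_space) gaussian_char_square:
  assumes Y: "gaussian_char \<sigma> Y"
  shows "integrable M (\<lambda>x. (Y x)\<^sup>2)" "expectation (\<lambda>x. (Y x)\<^sup>2) = \<sigma>\<^sup>2"
proof -
  have [measurable]: "Y \<in> borel_measurable M" and "\<sigma> \<ge> 0"
    using Y by (simp_all add: gaussian_char_def)
  have "integrable M (\<lambda>x. (Y x)\<^sup>2) \<and> expectation (\<lambda>x. (Y x)\<^sup>2) = \<sigma>\<^sup>2"
  proof (cases "\<sigma> = 0")
    case True
    then have "AE x in M. (Y x)\<^sup>2 = 0"
      using gaussian_char_0 Y by (auto elim: eventually_mono)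
    then show ?thesis
      using True integrable_cong_AE[of "\<lambda>x. (Y x)\<^sup>2" M "\<lambda>_. 0"] integral_cong_AE[of "\<lambda>x. (Y x)\<^sup>2" M "\<lambda>_. 0"]
      by simp
  next
    case False
    then have \<sigma>: "\<sigma> > 0" using \<open>\<sigma> \<ge> 0\<close> by simp
    note D = distr_std_normal[OF Y \<sigma>]
    have I: "integrable std_normal_distribution (\<lambda>x. x\<^sup>2)" "integral\<^sup>L std_normal_distribution (\<lambda>x. x\<^sup>2) = 1"
      using integrable_std_normal_distribution_moment[of 2] std_normal_distribution_even_moments(1)[of 1]
      by (simp_all add: fact_numeral)
    have int: "integrable M (\<lambda>x. (Y x / \<sigma>)\<^sup>2)"
      using I(1) unfolding D[symmetric] by (subst (asm) integrable_distr_eq) simp_all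
    moreover have "expectation (\<lambda>x. (Y x / \<sigma>)\<^sup>2) = 1"
      using I(2) unfolding D[symmetric] by (subst (asm) integral_distr) simp_all
    moreover have "(Y x)\<^sup>2 = \<sigma>\<^sup>2 * (Y x / \<sigma>)\<^sup>2" for x
      using \<sigma> by (simp add: power_divide)
    ultimately show ?thesis
      using integrable_mult_right[OF int, of "\<sigma>\<^sup>2"] integral_mult_right_zero[of M "\<sigma>\<^sup>2" "\<lambda>x. (Y x / \<sigma>)\<^sup>2"]
      by simp
  qed
  then show "integrable M (\<lambda>x. (Y x)\<^sup>2)" "expectation (\<lambda>x. (Y x)\<^sup>2) = \<sigma>\<^sup>2" by auto
qed

lemma (in prob_space) gaussian_char_if_centered_gaussian:
  assumes "centered_gaussian M Y"
  shows "\<exists>\<sigma>. gaussian_char \<sigma> Y"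
proof -
  have [measurable]: "Y \<in> borel_measurable M"
    using assms by (simp add: centered_gaussian_def)
  consider "AE x in M. Y x = 0" | \<sigma> where "\<sigma> > 0" "distributed M lborel Y (normal_density 0 \<sigma>)"
    using assms by (auto simp: centered_gaussian_def)
  then show ?thesis
  proof cases
    case 1
    have "expectation (\<lambda>x. cos (t * Y x)) = expectation (\<lambda>x. 1)" "expectation (\<lambda>x. sin (t * Y x))
        = expectation (\<lambda>x. 0)" for t
      by (rule integral_cong_AE; use 1 in \<open>auto elim!: eventually_mono\<close>)+
    then have "gaussian_char 0 Y"
      by (simp add: gaussian_char_def prob_space)
    then show ?thesis ..
  next
    case (2 \<sigma>)
    have "distributed M lborel (\<lambda>x. Y x / \<sigma>) std_normal_density"
      using 2 normal_standard_normal_convert[of \<sigma> Y 0] by simp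
    then have "distr M lborel (\<lambda>x. Y x / \<sigma>) = std_normal_distribution"
      by (rule distributed_distr_eq_density)
    then have D: "distr M borel (\<lambda>x. Y x / \<sigma>) = std_normal_distribution"
      by (metis distr_cong sets_lborel)
    have "Complex (expectation (\<lambda>x. cos (t * Y x))) (expectation (\<lambda>x. sin (t * Y x)))
        = Complex (exp (- (\<sigma> * t)\<^sup>2 / 2)) 0" for t
      using char_distr_Complex[of "\<lambda>x. Y x / \<sigma>" "\<sigma> * t"] 2(1)
      by (simp add: D char_std_normal_distribution complex_eq_iff mult.commute)
    then have "gaussian_char \<sigma> Y"
      using 2(1) by (simp add: gaussian_char_def complex_eq_iff)
    then show ?thesis ..
  qed
qed

lemma abs_cos_diff_le: "\<bar>cos a - cos b\<bar> \<le> \<bar>a - b\<bar>" for a b :: real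
proof -
  have "\<bar>cos a - cos b\<bar> = 2 * \<bar>sin ((a + b) / 2)\<bar> * \<bar>sin ((b - a) / 2)\<bar>"
    by (simp add: cos_diff_cos abs_mult)
  also have "\<dots> \<le> 2 * 1 * \<bar>(b - a) / 2\<bar>"
    by (intro mult_mono abs_sin_x_le_abs_x) auto
  finally show ?thesis by simp
qed

lemma abs_sin_diff_le: "\<bar>sin a - sin b\<bar> \<le> \<bar>a - b\<bar>" for a b :: real
proof -
  have "\<bar>sin a - sin b\<bar> = 2 * \<bar>sin ((a - b) / 2)\<bar> * \<bar>cos ((a + b) / 2)\<bar>"
    by (simp add: sin_diff_sin abs_mult)
  also have "\<dots> \<le> 2 * \<bar>(a - b) / 2\<bar> * 1"
    by (intro mult_mono abs_sin_x_le_abs_x) auto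
  finally show ?thesis by simp
qed

text \<open>Under convergence in probability the characteristic functions converge pointwise. At
  \<open>t = 1\<close> the limit determines the variance, and its powers give all other
  \<open>t\<close>, because each approximating function at \<open>t\<close> is its value at 1 to the
  power of the square of \<open>t\<close>.\<close>

lemma (in prob_space) gaussian_char_limit:
  assumes [measurable]: "Y \<in> borel_measurable M"
    and Z: "\<And>n. gaussian_char (\<sigma> n) (Z n)"
    and lim: "(\<lambda>n. expectation (\<lambda>x. min 1 \<bar>Y x - Z n x\<bar>)) \<longlonglongrightarrow> 0"
  shows "\<exists>\<sigma>. gaussian_char \<sigma> Y"
proof -
  have [measurable]: "Z n \<in> borel_measurable M" for n
    using Z[of n] by (simp add: gaussian_char_def)
  have conv: "(\<lambda>n. expectation (\<lambda>x. f (t * Z n x))) \<longlonglongrightarrow> expectation (\<lambda>x. f (t * Y x))"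
    if f: "f = cos \<or> f = sin" for f :: "real \<Rightarrow> real" and t
  proof -
    have [measurable]: "f \<in> borel_measurable borel" using f by auto
    have f1: "\<bar>f a\<bar> \<le> 1" for a
      using f by (elim disjE) simp_all
    have f2: "\<bar>f a - f b\<bar> \<le> \<bar>a - b\<bar>" for a b
      using f by (elim disjE) (simp_all add: abs_cos_diff_le abs_sin_diff_le)
    have int: "integrable M (\<lambda>x. f (t * U x))" if "U \<in> borel_measurable M" for U
    proof (rule integrable_bounded)
      show "\<bar>f (t * U x)\<bar> \<le> 1" for x by (rule f1)
      show "(\<lambda>x. f (t * U x)) \<in> borel_measurable M"
        using that by simp
    qed
    have intm: "integrable M (\<lambda>x. min 1 \<bar>Y x - Z n x\<bar>)" for n
      by (rule integrable_bounded[where C = 1]) auto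
    \<comment> \<open>Where the variables differ by at most 1, the Lipschitz bound gives the factor
      \<bar>t\<bar>; elsewhere two values in [-1, 1] differ by at most 2. Hence
      \<open>2 + \<bar>t\<bar>\<close>.\<close>
    have "\<bar>expectation (\<lambda>x. f (t * Z n x)) - expectation (\<lambda>x. f (t * Y x))\<bar>
        \<le> (2 + \<bar>t\<bar>) * expectation (\<lambda>x. min 1 \<bar>Y x - Z n x\<bar>)" for n
    proof -
      have "\<bar>expectation (\<lambda>x. f (t * Z n x)) - expectation (\<lambda>x. f (t * Y x))\<bar>
          = \<bar>expectation (\<lambda>x. f (t * Z n x) - f (t * Y x))\<bar>"
        by (simp add: int)
      also have "\<dots> \<le> expectation (\<lambda>x. \<bar>f (t * Z n x) - f (t * Y x)\<bar>)"
        by (rule integral_abs_bound)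
      also have "\<dots> \<le> expectation (\<lambda>x. (2 + \<bar>t\<bar>) * min 1 \<bar>Y x - Z n x\<bar>)"
      proof (rule integral_mono)
        show "integrable M (\<lambda>x. \<bar>f (t * Z n x) - f (t * Y x)\<bar>)"
          by (intro integrable_abs Bochner_Integration.integrable_diff int) fact+
        show "integrable M (\<lambda>x. (2 + \<bar>t\<bar>) * min 1 \<bar>Y x - Z n x\<bar>)"
          by (intro integrable_mult_right intm)
        fix x
        show "\<bar>f (t * Z n x) - f (t * Y x)\<bar> \<le> (2 + \<bar>t\<bar>) * min 1 \<bar>Y x - Z n x\<bar>"
        proof (cases "\<bar>Y x - Z n x\<bar> \<le> 1")
          case True
          have "\<bar>f (t * Z n x) - f (t * Y x)\<bar> \<le> \<bar>t * (Z n x - Y x)\<bar>"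
            using f2[of "t * Z n x" "t * Y x"] by (simp add: right_diff_distrib)
          also have "\<dots> \<le> (2 + \<bar>t\<bar>) * \<bar>Y x - Z n x\<bar>"
            unfolding abs_mult by (intro mult_mono) auto
          finally show ?thesis using True by simp
        next
          case False
          then show ?thesis
            using f1[of "t * Z n x"] f1[of "t * Y x"] by simp
        qed
      qed
      finally show ?thesis by simp
    qed
    then have "(\<lambda>n. expectation (\<lambda>x. f (t * Z n x)) - expectation (\<lambda>x. f (t * Y x))) \<longlonglongrightarrow> 0"
      by (intro Lim_null_comparison[OF always_eventually tendsto_mult_right_zero[OF lim, of "2 + \<bar>t\<bar>"]])
        (simp only: real_norm_def, blast)
    then show ?thesis by (simp add: LIM_zero_iff)
  qed
  define \<phi> where "\<phi> t = expectation (\<lambda>x. cos (t * Y x))" for t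
  have \<phi>: "(\<lambda>n. exp (- (\<sigma> n * t)\<^sup>2 / 2)) \<longlonglongrightarrow> \<phi> t" for t
    using conv[of cos t] Z by (simp add: \<phi>_def gaussian_char_def)
  have sin0: "expectation (\<lambda>x. sin (t * Y x)) = 0" for t
    using conv[of sin t] Z by (simp add: gaussian_char_def LIMSEQ_const_iff)
  define \<rho> where "\<rho> = \<phi> 1"
  have \<rho>lim: "(\<lambda>n. exp (- (\<sigma> n)\<^sup>2 / 2)) \<longlonglongrightarrow> \<rho>"
    using \<phi>[of 1] by (simp add: \<rho>_def)
  have powr: "exp (- (\<sigma> n * t)\<^sup>2 / 2) = exp (- (\<sigma> n)\<^sup>2 / 2) powr (t\<^sup>2)" for n t
    by (simp add: powr_def power_mult_distrib)
  have \<rho>0: "\<rho> \<ge> 0"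
    by (rule LIMSEQ_le_const[OF \<rho>lim]) auto
  have \<rho>1: "\<rho> \<le> 1"
    by (rule LIMSEQ_le_const2[OF \<rho>lim]) auto
  \<comment> \<open>A zero limit means that the variances escape to infinity: \<phi> would then
    vanish off the origin and equal 1 there, against the continuity of characteristic
    functions.\<close>
  have "\<rho> \<noteq> 0"
  proof
    assume "\<rho> = 0"
    have 0: "\<phi> t = 0" if "t \<noteq> 0" for t
    proof (rule LIMSEQ_unique[OF \<phi>])
      show "(\<lambda>n. exp (- (\<sigma> n * t)\<^sup>2 / 2)) \<longlonglongrightarrow> 0"
        unfolding powr using \<rho>lim \<open>\<rho> = 0\<close> that
        by (intro tendsto_zero_powrI[OF _ tendsto_const]) auto
    qed
    have "isCont (char (distr M borel Y)) 0"
      by (intro real_distribution.isCont_char real_distribution_distr) simp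
    then have "isCont (\<lambda>t. Re (char (distr M borel Y) t)) 0"
      by (rule isCont_Re)
    then have "isCont \<phi> 0"
      by (simp add: char_distr_Complex \<phi>_def[abs_def])
    then have "(\<lambda>n. \<phi> (inverse (real (Suc n)))) \<longlonglongrightarrow> \<phi> 0"
      using LIMSEQ_inverse_real_of_nat by (rule isCont_tendsto_compose)
    then have "\<phi> 0 = 0"
      using 0 by (simp add: LIMSEQ_const_iff)
    then show False by (simp add: \<phi>_def prob_space)
  qed
  then have "\<rho> > 0" using \<rho>0 by simp
  \<comment> \<open>The solution of exp (- s^2 / 2) = \<rho>; the root is real because \<rho> \<le>
    1.\<close>
  define s where "s = sqrt (- 2 * ln \<rho>)"
  have s2: "s\<^sup>2 = - 2 * ln \<rho>" "s \<ge> 0"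
    using \<open>\<rho> > 0\<close> \<rho>1 by (simp_all add: s_def)
  have "\<phi> t = exp (- (s * t)\<^sup>2 / 2)" for t
  proof -
    have "(\<lambda>n. exp (- (\<sigma> n)\<^sup>2 / 2) powr (t\<^sup>2)) \<longlonglongrightarrow> \<rho> powr (t\<^sup>2)"
      using \<rho>lim by (rule tendsto_powr[OF _ tendsto_const \<open>\<rho> \<noteq> 0\<close>])
    moreover have "(\<lambda>n. exp (- (\<sigma> n)\<^sup>2 / 2) powr (t\<^sup>2)) \<longlonglongrightarrow> \<phi> t"
      using \<phi>[of t] unfolding powr .
    ultimately have "\<phi> t = \<rho> powr (t\<^sup>2)"
      using LIMSEQ_unique by blast
    also have "\<dots> = exp (t\<^sup>2 * ln \<rho>)"
      using \<open>\<rho> \<noteq> 0\<close> by (simp add: powr_def)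
    also have "t\<^sup>2 * ln \<rho> = - (s * t)\<^sup>2 / 2"
      by (simp add: power_mult_distrib s2(1))
    finally show ?thesis .
  qed
  then have "gaussian_char s Y"
    unfolding gaussian_char_def using s2(2) sin0 assms(1) \<phi>_def by metis
  then show ?thesis ..
qed

section \<open>Linear spaces of centered Gaussian variables\<close>

text \<open>\<open>V\<close> plays the part of a Gaussian Hilbert space: linear combinations stay
  Gaussian, so joint laws are governed by covariances. Closure under almost sure limits is the axiom
  that admits the derivatives of the field.\<close>

locale gaussian_space = prob_space P for P :: "'w measure" +
  fixes V :: "('w \<Rightarrow> real) set"
  assumes gauss: "Y \<in> V \<Longrightarrow> \<exists>\<sigma>. gaussian_char \<sigma> Y"
    and zero: "(\<lambda>_. 0) \<in> V"
    and add: "Y \<in> V \<Longrightarrow> Z \<in> V \<Longrightarrow> (\<lambda>\<omega>. Y \<omega> + Z \<omega>) \<in> V"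
    and scale: "Y \<in> V \<Longrightarrow> (\<lambda>\<omega>. a * Y \<omega>) \<in> V"
    and limit: "(\<And>n::nat. U n \<in> V) \<Longrightarrow> Y \<in> borel_measurable P
      \<Longrightarrow> (AE \<omega> in P. (\<lambda>n. U n \<omega>) \<longlonglongrightarrow> Y \<omega>) \<Longrightarrow> Y \<in> V"
begin

lemma measurable_V: "Y \<in> V \<Longrightarrow> Y \<in> borel_measurable P"
  using gauss by (auto simp: gaussian_char_def)

lemma diff: "Y \<in> V \<Longrightarrow> Z \<in> V \<Longrightarrow> (\<lambda>\<omega>. Y \<omega> - Z \<omega>) \<in> V"
  using add[OF _ scale[of Z "-1"], of Y] by simp

lemma sum: "(\<And>i. i \<in> F \<Longrightarrow> Y i \<in> V) \<Longrightarrow> (\<lambda>\<omega>. \<Sum>i\<in>F. Y i \<omega>) \<in> V"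
  by (induction F rule: infinite_finite_induct) (auto simp: zero add)

lemma integrable_square: "Y \<in> V \<Longrightarrow> integrable P (\<lambda>\<omega>. (Y \<omega>)\<^sup>2)"
  using gauss gaussian_char_square by blast

lemma integrable_mult:
  assumes "Y \<in> V" "Z \<in> V"
  shows "integrable P (\<lambda>\<omega>. Y \<omega> * Z \<omega>)"
proof (rule Bochner_Integration.integrable_bound)
  show "integrable P (\<lambda>\<omega>. (Y \<omega>)\<^sup>2 + (Z \<omega>)\<^sup>2)"
    using assms by (intro Bochner_Integration.integrable_add integrable_square)
  have "norm (Y \<omega> * Z \<omega>) \<le> norm ((Y \<omega>)\<^sup>2 + (Z \<omega>)\<^sup>2)" for \<omega>
  proof -
    have "2 * (\<bar>Y \<omega>\<bar> * \<bar>Z \<omega>\<bar>) \<le> \<bar>Y \<omega>\<bar>\<^sup>2 + \<bar>Z \<omega>\<bar>\<^sup>2"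
      using sum_squares_bound[of "\<bar>Y \<omega>\<bar>" "\<bar>Z \<omega>\<bar>"] by simp
    moreover have "0 \<le> \<bar>Y \<omega>\<bar> * \<bar>Z \<omega>\<bar>" by simp
    ultimately have "\<bar>Y \<omega>\<bar> * \<bar>Z \<omega>\<bar> \<le> (Y \<omega>)\<^sup>2 + (Z \<omega>)\<^sup>2"
      unfolding power2_abs by linarith
    then show ?thesis by (simp add: abs_mult)
  qed
  then show "AE \<omega> in P. norm (Y \<omega> * Z \<omega>) \<le> norm ((Y \<omega>)\<^sup>2 + (Z \<omega>)\<^sup>2)"
    by simp
  show "(\<lambda>\<omega>. Y \<omega> * Z \<omega>) \<in> borel_measurable P"
    using assms by (intro borel_measurable_times measurable_V)
qed

lemma expectation_cos: "Y \<in> V \<Longrightarrow> expectation (\<lambda>\<omega>. cos (Y \<omega>)) = exp (- expectation (\<lambda>\<omega>. (Y \<omega>)\<^sup>2) / 2)"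
  and expectation_sin: "Y \<in> V \<Longrightarrow> expectation (\<lambda>\<omega>. sin (Y \<omega>)) = 0"
proof -
  assume "Y \<in> V"
  then obtain \<sigma> where \<sigma>: "gaussian_char \<sigma> Y" using gauss by blast
  then show "expectation (\<lambda>\<omega>. cos (Y \<omega>)) = exp (- expectation (\<lambda>\<omega>. (Y \<omega>)\<^sup>2) / 2)" "expectation (\<lambda>\<omega>. sin (Y \<omega>)) = 0"
    using gaussian_char_square(2)[OF \<sigma>] unfolding gaussian_char_def by (auto dest!: spec[where x = 1])
qed

lemma second_moment_add:
  assumes "Y \<in> V" "Z \<in> V"
  shows "expectation (\<lambda>\<omega>. (Y \<omega> + Z \<omega>)\<^sup>2)
    = expectation (\<lambda>\<omega>. (Y \<omega>)\<^sup>2) + 2 * expectation (\<lambda>\<omega>. Y \<omega> * Z \<omega>) + expectation (\<lambda>\<omega>. (Z \<omega>)\<^sup>2)"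
proof -
  have "(Y \<omega> + Z \<omega>)\<^sup>2 = (Y \<omega>)\<^sup>2 + 2 * (Y \<omega> * Z \<omega>) + (Z \<omega>)\<^sup>2" for \<omega>
    by (simp add: power2_sum)
  then show ?thesis
    using integrable_square[OF assms(1)] integrable_square[OF assms(2)] integrable_mult[OF assms]
    by simp
qed

lemma Cauchy_Schwarz_V:
  assumes "Y \<in> V" "Z \<in> V"
  shows "(expectation (\<lambda>\<omega>. Y \<omega> * Z \<omega>))\<^sup>2 \<le> expectation (\<lambda>\<omega>. (Y \<omega>)\<^sup>2) * expectation (\<lambda>\<omega>. (Z \<omega>)\<^sup>2)"
proof -
  define a b c where abc: "a = expectation (\<lambda>\<omega>. (Y \<omega>)\<^sup>2)" "b = expectation (\<lambda>\<omega>. Y \<omega> * Z \<omega>)"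
    "c = expectation (\<lambda>\<omega>. (Z \<omega>)\<^sup>2)"
  have quad: "0 \<le> a * t\<^sup>2 - 2 * b * t + c" for t
  proof -
    have "0 \<le> expectation (\<lambda>\<omega>. (t * Y \<omega> + - Z \<omega>)\<^sup>2)" by simp
    also have "\<dots> = a * t\<^sup>2 - 2 * b * t + c"
      using second_moment_add[OF scale[OF assms(1), of t] scale[OF assms(2), of "-1"]]
      by (simp add: abc power_mult_distrib mult.assoc)
    finally show ?thesis .
  qed
  have "a \<ge> 0" by (simp add: abc)
  have "b\<^sup>2 \<le> a * c"
  proof (cases "a = 0")
    case True
    have "b = 0"
    proof (rule ccontr)
      assume "b \<noteq> 0"
      \<comment> \<open>For \<open>a = 0\<close> the quadratic is affine in \<open>t\<close>; at
        this \<open>t\<close> it would equal -1.\<close>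
      then have "2 * b * ((c + 1) / (2 * b)) = c + 1" by simp
      then show False using quad[of "(c + 1) / (2 * b)"] True by simp
    qed
    then show ?thesis using True by simp
  next
    case False
    then have "a > 0" using \<open>a \<ge> 0\<close> by simp
    \<comment> \<open>The minimizer of the quadratic.\<close>
    define q where "q = b / a"
    have b: "b = q * a" using \<open>a > 0\<close> by (simp add: q_def)
    have "0 \<le> a * (a * q\<^sup>2 - 2 * b * q + c)"
      using quad[of q] \<open>a > 0\<close> by (intro mult_nonneg_nonneg) auto
    also have "\<dots> = a * c - b\<^sup>2"
      unfolding b by (simp add: algebra_simps power2_eq_square)
    finally show ?thesis by simp
  qed
  then show ?thesis by (simp add: abc)
qed

text \<open>For Gaussian variables almost sure convergence upgrades to mean square convergence: the
  bounded variables \<open>cos (U n)\<close> have expectation exp (- E U^2 / 2), and dominated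
  convergence sends this to 1.\<close>

lemma second_moment_tendsto_0:
  assumes U: "\<And>n::nat. U n \<in> V" and lim: "AE \<omega> in P. (\<lambda>n. U n \<omega>) \<longlonglongrightarrow> 0"
  shows "(\<lambda>n. expectation (\<lambda>\<omega>. (U n \<omega>)\<^sup>2)) \<longlonglongrightarrow> 0"
proof -
  have [measurable]: "U n \<in> borel_measurable P" for n by (rule measurable_V[OF U])
  have "AE \<omega> in P. (\<lambda>n. cos (U n \<omega>)) \<longlonglongrightarrow> 1"
    using lim by (rule eventually_mono) (use tendsto_cos[where a = "0::real"] in auto)
  then have "(\<lambda>n. expectation (\<lambda>\<omega>. cos (U n \<omega>))) \<longlonglongrightarrow> expectation (\<lambda>\<omega>. 1)"
    by (intro integral_dominated_convergence[where w = "\<lambda>_. 1" and f = "\<lambda>\<omega>. 1"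
          and s = "\<lambda>n \<omega>. cos (U n \<omega>)"]) (simp_all add: borel_measurable_cos)
  then have "(\<lambda>n. exp (- expectation (\<lambda>\<omega>. (U n \<omega>)\<^sup>2) / 2)) \<longlonglongrightarrow> 1"
    unfolding expectation_cos[OF U] by (simp add: prob_space)
  then have "(\<lambda>n. ln (exp (- expectation (\<lambda>\<omega>. (U n \<omega>)\<^sup>2) / 2))) \<longlonglongrightarrow> ln 1"
    by (rule tendsto_ln) simp
  from tendsto_mult[OF tendsto_const[of "-2"] this] show ?thesis
    by (simp only: ln_exp ln_one) simp
qed

text \<open>Gaussianity replaces a dominating function here. The continuity and differentiability of
  all covariance functions rest on this lemma.\<close>

lemma covariance_tendsto_0:
  assumes U: "\<And>n::nat. U n \<in> V" and lim: "AE \<omega> in P. (\<lambda>n. U n \<omega>) \<longlonglongrightarrow> 0" and \<xi>: "\<xi> \<in> V"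
  shows "(\<lambda>n. expectation (\<lambda>\<omega>. U n \<omega> * \<xi> \<omega>)) \<longlonglongrightarrow> 0"
proof -
  have bound: "(\<lambda>n. expectation (\<lambda>\<omega>. (U n \<omega>)\<^sup>2) * expectation (\<lambda>\<omega>. (\<xi> \<omega>)\<^sup>2)) \<longlonglongrightarrow> 0"
    using second_moment_tendsto_0[OF U lim] by (rule tendsto_mult_left_zero)
  have "(\<lambda>n. (expectation (\<lambda>\<omega>. U n \<omega> * \<xi> \<omega>))\<^sup>2) \<longlonglongrightarrow> 0"
  proof (rule tendsto_sandwich[OF _ _ tendsto_const bound])
    show "\<forall>\<^sub>F n in sequentially. 0 \<le> (expectation (\<lambda>\<omega>. U n \<omega> * \<xi> \<omega>))\<^sup>2"
      by (rule always_eventually) simp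
    show "\<forall>\<^sub>F n in sequentially. (expectation (\<lambda>\<omega>. U n \<omega> * \<xi> \<omega>))\<^sup>2
        \<le> expectation (\<lambda>\<omega>. (U n \<omega>)\<^sup>2) * expectation (\<lambda>\<omega>. (\<xi> \<omega>)\<^sup>2)"
      by (intro always_eventually allI Cauchy_Schwarz_V U \<xi>)
  qed
  then show ?thesis by simp
qed

text \<open>For uncorrelated variables of \<open>V\<close> the second moments of
  \<open>U + t * \<xi>\<close> and \<open>U - t * \<xi>\<close> are sums, so the exponentials factor
  and \<open>f (U)\<close> is uncorrelated with cosine and sine of \<open>t * \<xi>\<close>. After
  subtracting its mean \<open>m\<close>, \<open>orthogonal_indicator\<close> replaces these by an
  indicator of \<xi>.\<close>

lemma orthogonal_trig_indicator:
  assumes U: "U \<in> V" and \<xi>: "\<xi> \<in> V" and orth: "expectation (\<lambda>\<omega>. U \<omega> * \<xi> \<omega>) = 0"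
    and f: "f = cos \<or> f = sin" and A: "A \<in> sets borel"
  shows "expectation (\<lambda>\<omega>. (indicator A (\<xi> \<omega>) - expectation (\<lambda>\<omega>. indicat_real A (\<xi> \<omega>))) * f (U \<omega>)) = 0"
proof -
  note [measurable] = measurable_V[OF U] measurable_V[OF \<xi>] A
  have [measurable]: "f \<in> borel_measurable borel" and f1: "\<bar>f y\<bar> \<le> 1" for y
    using f by (elim disjE; simp)+
  define a s where "a = expectation (\<lambda>\<omega>. (U \<omega>)\<^sup>2)" and "s = expectation (\<lambda>\<omega>. (\<xi> \<omega>)\<^sup>2)"
  have plus: "(\<lambda>\<omega>. U \<omega> + t * \<xi> \<omega>) \<in> V" and minus: "(\<lambda>\<omega>. U \<omega> - t * \<xi> \<omega>) \<in> V" for t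
    by (intro add diff scale U \<xi>)+
  have sq: "expectation (\<lambda>\<omega>. (U \<omega> + t * \<xi> \<omega>)\<^sup>2) = a + t\<^sup>2 * s" for t
    using second_moment_add[OF U scale[OF \<xi>, of t]] orth
    by (simp add: a_def s_def power_mult_distrib mult.left_commute[of _ t])
  have sq': "expectation (\<lambda>\<omega>. (U \<omega> - t * \<xi> \<omega>)\<^sup>2) = a + t\<^sup>2 * s" for t
    using sq[of "-t"] by simp
  have Ec: "expectation (\<lambda>\<omega>. cos (U \<omega>)) = exp (- a / 2)" "expectation (\<lambda>\<omega>. cos (t * \<xi> \<omega>)) = exp (- (t\<^sup>2 * s) / 2)"
    "expectation (\<lambda>\<omega>. cos (U \<omega> + t * \<xi> \<omega>)) = exp (- (a + t\<^sup>2 * s) / 2)"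
    "expectation (\<lambda>\<omega>. cos (U \<omega> - t * \<xi> \<omega>)) = exp (- (a + t\<^sup>2 * s) / 2)" for t
    using expectation_cos[OF U] expectation_cos[OF scale[OF \<xi>, of t]]
      expectation_cos[OF plus, of t] expectation_cos[OF minus, of t]
    by (simp_all only: sq sq' a_def[symmetric] power_mult_distrib integral_mult_right_zero s_def[symmetric])
  have Es: "expectation (\<lambda>\<omega>. sin (U \<omega>)) = 0" "expectation (\<lambda>\<omega>. sin (t * \<xi> \<omega>)) = 0"
    "expectation (\<lambda>\<omega>. sin (U \<omega> + t * \<xi> \<omega>)) = 0" "expectation (\<lambda>\<omega>. sin (U \<omega> - t * \<xi> \<omega>)) = 0" for t
    by (rule expectation_sin[OF U] expectation_sin[OF scale[OF \<xi>]] expectation_sin[OF plus]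
        expectation_sin[OF minus])+
  have ints: "integrable P (\<lambda>\<omega>. cos (U \<omega> + t * \<xi> \<omega>))" "integrable P (\<lambda>\<omega>. cos (U \<omega> - t * \<xi> \<omega>))"
    "integrable P (\<lambda>\<omega>. sin (U \<omega> + t * \<xi> \<omega>))" "integrable P (\<lambda>\<omega>. sin (U \<omega> - t * \<xi> \<omega>))" for t
    by (rule integrable_bounded[where C = 1]; simp)+
  have prod: "expectation (\<lambda>\<omega>. f (U \<omega>) * h (t * \<xi> \<omega>)) = expectation (\<lambda>\<omega>. f (U \<omega>)) * expectation (\<lambda>\<omega>. h (t * \<xi> \<omega>))"
    if h: "h = cos \<or> h = sin" for h :: "real \<Rightarrow> real" and t
  proof -
    consider "f = cos" "h = cos" | "f = cos" "h = sin" | "f = sin" "h = cos" | "f = sin" "h = sin"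
      using f h by blast
    then show ?thesis
    proof cases
      case 1
      have "expectation (\<lambda>\<omega>. cos (U \<omega>) * cos (t * \<xi> \<omega>))
          = expectation (\<lambda>\<omega>. (cos (U \<omega> + t * \<xi> \<omega>) + cos (U \<omega> - t * \<xi> \<omega>)) / 2)"
        by (simp only: cos_add cos_diff) simp
      also have "\<dots> = exp (- (a + t\<^sup>2 * s) / 2)"
        by (simp only: integral_divide_zero Bochner_Integration.integral_add[OF ints(1,2)] Ec) simp
      also have "\<dots> = exp (- a / 2) * exp (- (t\<^sup>2 * s) / 2)"
        by (simp add: exp_add[symmetric] field_simps)
      finally show ?thesis by (simp only: 1 Ec)
    next
      case 2
      have "expectation (\<lambda>\<omega>. cos (U \<omega>) * sin (t * \<xi> \<omega>))
          = expectation (\<lambda>\<omega>. (sin (U \<omega> + t * \<xi> \<omega>) - sin (U \<omega> - t * \<xi> \<omega>)) / 2)"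
        by (simp only: sin_add sin_diff) simp
      also have "\<dots> = 0"
        by (simp only: integral_divide_zero Bochner_Integration.integral_diff[OF ints(3,4)] Es) simp
      finally show ?thesis by (simp add: 2 Es)
    next
      case 3
      have "expectation (\<lambda>\<omega>. sin (U \<omega>) * cos (t * \<xi> \<omega>))
          = expectation (\<lambda>\<omega>. (sin (U \<omega> + t * \<xi> \<omega>) + sin (U \<omega> - t * \<xi> \<omega>)) / 2)"
        by (simp only: sin_add sin_diff) simp
      also have "\<dots> = 0"
        by (simp only: integral_divide_zero Bochner_Integration.integral_add[OF ints(3,4)] Es) simp
      finally show ?thesis by (simp add: 3 Es)
    next
      case 4
      have "expectation (\<lambda>\<omega>. sin (U \<omega>) * sin (t * \<xi> \<omega>))
          = expectation (\<lambda>\<omega>. (cos (U \<omega> - t * \<xi> \<omega>) - cos (U \<omega> + t * \<xi> \<omega>)) / 2)"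
        by (simp only: cos_add cos_diff) simp
      also have "\<dots> = 0"
        by (simp only: integral_divide_zero Bochner_Integration.integral_diff[OF ints(2,1)] Ec) simp
      finally show ?thesis by (simp add: 4 Es)
    qed
  qed
  have intf: "integrable P (\<lambda>\<omega>. f (U \<omega>))"
    by (rule integrable_bounded[where C = 1]) (simp_all add: f1)
  have inth: "integrable P (\<lambda>\<omega>. h (t * \<xi> \<omega>))" if "h = cos \<or> h = sin" for h :: "real \<Rightarrow> real" and t
    using that by (elim disjE; intro integrable_bounded[where C = 1]; simp)
  have intfh: "integrable P (\<lambda>\<omega>. f (U \<omega>) * h (t * \<xi> \<omega>))" if h: "h = cos \<or> h = sin" for h :: "real \<Rightarrow> real" and t
  proof (rule integrable_bounded)
    have "\<bar>h y\<bar> \<le> 1" for y using h by (elim disjE; simp)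
    then show "\<bar>f (U \<omega>) * h (t * \<xi> \<omega>)\<bar> \<le> 1 * 1" for \<omega>
      unfolding abs_mult by (intro mult_mono f1) auto
    show "(\<lambda>\<omega>. f (U \<omega>) * h (t * \<xi> \<omega>)) \<in> borel_measurable P"
      using h by (elim disjE; simp)
  qed
  define m where "m = expectation (\<lambda>\<omega>. f (U \<omega>))"
  have cen: "expectation (\<lambda>\<omega>. (f (U \<omega>) - m) * h (t * \<xi> \<omega>)) = 0"
    if h: "h = cos \<or> h = sin" for h :: "real \<Rightarrow> real" and t
    using prod[OF h, of t] intfh[OF h, of t] inth[OF h, of t] by (simp add: left_diff_distrib m_def)
  have "expectation (\<lambda>\<omega>. (f (U \<omega>) - m) * indicator A (\<xi> \<omega>)) = 0"
  proof (rule orthogonal_indicator[where C = "1 + \<bar>m\<bar>"])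
    show "\<bar>f (U \<omega>) - m\<bar> \<le> 1 + \<bar>m\<bar>" for \<omega>
      using f1[of "U \<omega>"] by linarith
    show "expectation (\<lambda>\<omega>. (f (U \<omega>) - m) * cos (t * \<xi> \<omega>)) = 0"
      "expectation (\<lambda>\<omega>. (f (U \<omega>) - m) * sin (t * \<xi> \<omega>)) = 0" for t
      using cen[of cos t] cen[of sin t] by simp_all
  qed simp_all
  note E0 = this
  have I: "integrable P (\<lambda>\<omega>. f (U \<omega>) * indicator A (\<xi> \<omega>))" "integrable P (\<lambda>\<omega>. indicat_real A (\<xi> \<omega>))"
    by (rule integrable_bounded[where C = 1]; simp add: f1 indicator_def)+
  have "(f (U \<omega>) - m) * indicator A (\<xi> \<omega>) = f (U \<omega>) * indicator A (\<xi> \<omega>) - m * indicat_real A (\<xi> \<omega>)" for \<omega>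
    by (simp add: left_diff_distrib)
  then have E1: "expectation (\<lambda>\<omega>. f (U \<omega>) * indicator A (\<xi> \<omega>)) = m * expectation (\<lambda>\<omega>. indicat_real A (\<xi> \<omega>))"
    using E0 I by simp
  have "(indicator A (\<xi> \<omega>) - p) * f (U \<omega>) = f (U \<omega>) * indicator A (\<xi> \<omega>) - p * f (U \<omega>)" for \<omega> p
    by (simp add: algebra_simps)
  then show ?thesis
    using I intf E1 by (simp add: m_def)
qed

end

section \<open>Independence of uncorrelated Gaussian families\<close>

lemma emeasure_distr_indicator:
  assumes f: "f \<in> measurable M N" and X: "X \<in> sets N"
  shows "emeasure (distr M N f) X = (\<integral>\<^sup>+\<omega>. ennreal (indicator X (f \<omega>)) \<partial>M)"
proof -
  have "emeasure (distr M N f) X = emeasure M (f -` X \<inter> space M)"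
    by (rule emeasure_distr[OF f X])
  also have "\<dots> = (\<integral>\<^sup>+\<omega>. indicator (f -` X \<inter> space M) \<omega> \<partial>M)"
    by (rule nn_integral_indicator[symmetric]) (rule measurable_sets[OF f X])
  also have "\<dots> = (\<integral>\<^sup>+\<omega>. ennreal (indicator X (f \<omega>)) \<partial>M)"
    by (rule nn_integral_cong) (simp split: split_indicator)
  finally show ?thesis .
qed

context gaussian_space begin

abbreviation coords :: "('i \<Rightarrow> real) measure" where
  "coords \<equiv> PiM UNIV (\<lambda>_. borel)"

text \<open>For fixed \<open>A\<close>, the law of \<open>W\<close> weighted by the indicator of
  \<open>\<xi> \<in> A\<close> is compared with \<open>p\<close> times the law of \<open>W\<close>.
  These are finite measures on an infinite product, so agreement on finite-dimensional cylinders is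
  enough, and there only linear combinations of finitely many \<open>W j\<close> occur.\<close>

lemma indep_if_uncorrelated:
  fixes W :: "'i \<Rightarrow> 'w \<Rightarrow> real"
  assumes \<xi>: "\<xi> \<in> V" and W: "\<And>i. W i \<in> V" and orth: "\<And>i. expectation (\<lambda>\<omega>. W i \<omega> * \<xi> \<omega>) = 0"
  shows "distr P borel \<xi> \<Otimes>\<^sub>M distr P coords (\<lambda>\<omega> i. W i \<omega>)
    = distr P (borel \<Otimes>\<^sub>M coords) (\<lambda>\<omega>. (\<xi> \<omega>, \<lambda>i. W i \<omega>))"
proof (rule pair_measure_eqI)
  have [measurable]: "\<xi> \<in> borel_measurable P" "W i \<in> borel_measurable P" for i
    by (rule measurable_V[OF \<xi>] measurable_V[OF W])+
  have mW [measurable]: "(\<lambda>\<omega> i. W i \<omega>) \<in> measurable P coords"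
    by (rule measurable_abs_UNIV) simp
  show "sigma_finite_measure (distr P borel \<xi>)" "sigma_finite_measure (distr P coords (\<lambda>\<omega> i. W i \<omega>))"
    by (intro prob_space_imp_sigma_finite prob_space_distr; simp)+
  show "sets (distr P borel \<xi> \<Otimes>\<^sub>M distr P coords (\<lambda>\<omega> i. W i \<omega>))
      = sets (distr P (borel \<Otimes>\<^sub>M coords) (\<lambda>\<omega>. (\<xi> \<omega>, \<lambda>i. W i \<omega>)))"
    by (simp cong: sets_pair_measure_cong)
  fix A B assume "A \<in> sets (distr P borel \<xi>)" "B \<in> sets (distr P coords (\<lambda>\<omega> i. W i \<omega>))"
  then have A [measurable]: "A \<in> sets borel" and B [measurable]: "B \<in> sets coords" by simp_all
  define p where "p = expectation (\<lambda>\<omega>. indicat_real A (\<xi> \<omega>))"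
  have p0: "0 \<le> p" by (simp add: p_def)
  define M1 where "M1 = distr (density P (\<lambda>\<omega>. ennreal (indicator A (\<xi> \<omega>)))) coords (\<lambda>\<omega> i. W i \<omega>)"
  define M2 where "M2 = distr (density P (\<lambda>\<omega>. ennreal p)) coords (\<lambda>\<omega> i. W i \<omega>)"
  have em1: "emeasure M1 X = (\<integral>\<^sup>+\<omega>. ennreal (indicator A (\<xi> \<omega>) * indicator X (\<lambda>i. W i \<omega>)) \<partial>P)"
    and em2: "emeasure M2 X = (\<integral>\<^sup>+\<omega>. ennreal (p * indicator X (\<lambda>i. W i \<omega>)) \<partial>P)"
    if [measurable]: "X \<in> sets coords" for X
  proof -
    let ?S = "(\<lambda>\<omega> i. W i \<omega>) -` X \<inter> space P"
    have S: "?S \<in> sets P" by (rule measurable_sets[OF mW that])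
    have "emeasure M1 X = emeasure (density P (\<lambda>\<omega>. ennreal (indicator A (\<xi> \<omega>)))) ?S"
      unfolding M1_def using mW that by (subst emeasure_distr) simp_all
    also have "\<dots> = (\<integral>\<^sup>+\<omega>. ennreal (indicator A (\<xi> \<omega>)) * indicator ?S \<omega> \<partial>P)"
      by (rule emeasure_density[OF _ S]) simp
    also have "\<dots> = (\<integral>\<^sup>+\<omega>. ennreal (indicator A (\<xi> \<omega>) * indicator X (\<lambda>i. W i \<omega>)) \<partial>P)"
      by (rule nn_integral_cong) (simp split: split_indicator)
    finally show "emeasure M1 X = (\<integral>\<^sup>+\<omega>. ennreal (indicator A (\<xi> \<omega>) * indicator X (\<lambda>i. W i \<omega>)) \<partial>P)" .
    have "emeasure M2 X = emeasure (density P (\<lambda>\<omega>. ennreal p)) ?S"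
      unfolding M2_def using mW that by (subst emeasure_distr) simp_all
    also have "\<dots> = (\<integral>\<^sup>+\<omega>. ennreal p * indicator ?S \<omega> \<partial>P)"
      by (rule emeasure_density[OF _ S]) simp
    also have "\<dots> = (\<integral>\<^sup>+\<omega>. ennreal (p * indicator X (\<lambda>i. W i \<omega>)) \<partial>P)"
      by (rule nn_integral_cong) (simp split: split_indicator)
    finally show "emeasure M2 X = (\<integral>\<^sup>+\<omega>. ennreal (p * indicator X (\<lambda>i. W i \<omega>)) \<partial>P)" .
  qed
  have "M1 = M2"
  proof (rule measure_eqI_PiM_infinite[where I = UNIV and M = "\<lambda>_. borel"])
    show "sets M1 = sets coords" "sets M2 = sets coords" by (simp_all add: M1_def M2_def)
    show "finite_measure M1"
      unfolding M1_def
    proof (intro finite_measure.finite_measure_distr finite_measureI)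
      have "emeasure (density P (\<lambda>\<omega>. ennreal (indicat_real A (\<xi> \<omega>)))) (space P)
          = (\<integral>\<^sup>+\<omega>. ennreal (indicat_real A (\<xi> \<omega>)) \<partial>P)"
        by (simp add: emeasure_density cong: nn_integral_cong)
      also have "\<dots> \<le> (\<integral>\<^sup>+\<omega>. 1 \<partial>P)"
        by (intro nn_integral_mono) (simp add: indicator_def)
      finally show "emeasure (density P (\<lambda>\<omega>. ennreal (indicat_real A (\<xi> \<omega>))))
          (space (density P (\<lambda>\<omega>. ennreal (indicat_real A (\<xi> \<omega>))))) \<noteq> \<infinity>"
        by (auto simp: emeasure_space_1 top_unique)
    qed simp
    fix C :: "'i \<Rightarrow> real set" and J :: "'i set"
    assume J: "finite J" "J \<subseteq> UNIV" and C: "\<And>i. i \<in> J \<Longrightarrow> C i \<in> sets borel"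
    let ?X = "prod_emb UNIV (\<lambda>_. borel :: real measure) J (Pi\<^sub>E J C)"
    have X: "?X \<in> sets coords" using J C by (intro sets_PiM_I) auto
    have ind: "indicator ?X (\<lambda>i. W i \<omega>) = (\<Prod>j\<in>J. indicat_real (C j) (W j \<omega>))" for \<omega>
    proof -
      have "(\<lambda>i. W i \<omega>) \<in> ?X \<longleftrightarrow> (\<forall>j\<in>J. W j \<omega> \<in> C j)"
        by (auto simp: prod_emb_iff PiE_iff)
      moreover have "(\<Prod>j\<in>J. indicat_real (C j) (W j \<omega>)) = (if \<forall>j\<in>J. W j \<omega> \<in> C j then 1 else 0)"
        using J(1) by (auto simp: indicator_def)
      ultimately show ?thesis by (simp add: indicator_def)
    qed
    have mX: "(\<lambda>\<omega>. indicat_real ?X (\<lambda>i. W i \<omega>)) \<in> borel_measurable P"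
      using measurable_compose[OF mW borel_measurable_indicator[OF X]] .
    have i1: "integrable P (\<lambda>\<omega>. indicator A (\<xi> \<omega>) * indicat_real ?X (\<lambda>i. W i \<omega>))"
      using mX by (intro integrable_bounded[where C = 1]) (auto simp: indicator_def)
    have i2: "integrable P (\<lambda>\<omega>. p * indicat_real ?X (\<lambda>i. W i \<omega>))"
      using mX p0 by (intro integrable_bounded[where C = p]) (auto simp: indicator_def)
    have orth_p: "expectation (\<lambda>\<omega>. (indicator A (\<xi> \<omega>) - p) * f (\<Sum>j\<in>J. s j * W j \<omega>)) = 0"
      if f: "f = cos \<or> f = sin" for f :: "real \<Rightarrow> real" and s
      unfolding p_def
    proof (rule orthogonal_trig_indicator[OF _ \<xi> _ f A])
      show "(\<lambda>\<omega>. \<Sum>j\<in>J. s j * W j \<omega>) \<in> V" by (intro sum scale W)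
      have "(\<Sum>j\<in>J. s j * W j \<omega>) * \<xi> \<omega> = (\<Sum>j\<in>J. s j * (W j \<omega> * \<xi> \<omega>))" for \<omega>
        by (simp add: sum_distrib_right mult.assoc)
      then show "expectation (\<lambda>\<omega>. (\<Sum>j\<in>J. s j * W j \<omega>) * \<xi> \<omega>) = 0"
        by (simp add: integrable_mult[OF W \<xi>] orth)
    qed
    have "expectation (\<lambda>\<omega>. (indicator A (\<xi> \<omega>) - p) * (\<Prod>j\<in>J. indicator (C j) (W j \<omega>))) = 0"
    proof (rule orthogonal_indicators[OF J(1), where C = "1 + p"])
      show "\<bar>indicator A (\<xi> \<omega>) - p\<bar> \<le> 1 + p" for \<omega>
        using p0 by (simp add: abs_le_iff split: split_indicator)
    qed (use C orth_p in simp_all)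
    then have "expectation (\<lambda>\<omega>. indicator A (\<xi> \<omega>) * indicat_real ?X (\<lambda>i. W i \<omega>) - p
        * indicat_real ?X (\<lambda>i. W i \<omega>)) = 0"
      by (simp only: ind left_diff_distrib)
    then have "expectation (\<lambda>\<omega>. indicator A (\<xi> \<omega>) * indicat_real ?X (\<lambda>i. W i \<omega>))
        = expectation (\<lambda>\<omega>. p * indicat_real ?X (\<lambda>i. W i \<omega>))"
      using i1 i2 by simp
    then show "emeasure M1 ?X = emeasure M2 ?X"
      unfolding em1[OF X] em2[OF X] using i1 i2 p0
      by (subst (1 2) nn_integral_eq_integral) auto
  qed
  then have "emeasure M1 B = emeasure M2 B" by simp
  moreover have "emeasure M1 B = emeasure (distr P (borel \<Otimes>\<^sub>M coords) (\<lambda>\<omega>. (\<xi> \<omega>, \<lambda>i. W i \<omega>))) (A \<times> B)"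
  proof -
    have "emeasure (distr P (borel \<Otimes>\<^sub>M coords) (\<lambda>\<omega>. (\<xi> \<omega>, \<lambda>i. W i \<omega>))) (A \<times> B)
        = (\<integral>\<^sup>+\<omega>. ennreal (indicator (A \<times> B) (\<xi> \<omega>, \<lambda>i. W i \<omega>)) \<partial>P)"
      by (rule emeasure_distr_indicator) (use A B mW in \<open>simp_all add: measurable_Pair\<close>)
    also have "\<dots> = emeasure M1 B"
      unfolding em1[OF B] by (rule nn_integral_cong) (simp split: split_indicator)
    finally show ?thesis ..
  qed
  moreover have "emeasure M2 B = emeasure (distr P borel \<xi>) A * emeasure (distr P coords (\<lambda>\<omega> i. W i \<omega>)) B"
  proof -
    have "emeasure (distr P borel \<xi>) A = (\<integral>\<^sup>+\<omega>. ennreal (indicat_real A (\<xi> \<omega>)) \<partial>P)"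
      by (rule emeasure_distr_indicator) (use A in simp_all)
    also have "\<dots> = ennreal p"
      unfolding p_def
    proof (rule nn_integral_eq_integral)
      show "integrable P (\<lambda>\<omega>. indicat_real A (\<xi> \<omega>))"
        by (rule integrable_bounded[where C = 1]) (simp_all split: split_indicator)
    qed simp
    finally have "emeasure (distr P borel \<xi>) A = ennreal p" .
    moreover have "emeasure (distr P coords (\<lambda>\<omega> i. W i \<omega>)) B = (\<integral>\<^sup>+\<omega>. ennreal (indicat_real B (\<lambda>i. W i \<omega>)) \<partial>P)"
      by (rule emeasure_distr_indicator[OF mW B])
    moreover have "emeasure M2 B = ennreal p * (\<integral>\<^sup>+\<omega>. ennreal (indicat_real B (\<lambda>i. W i \<omega>)) \<partial>P)"
    proof -
      have "(\<lambda>\<omega>. ennreal (indicat_real B (\<lambda>i. W i \<omega>))) \<in> borel_measurable P"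
        using measurable_compose[OF mW borel_measurable_indicator[OF B]] by simp
      then show ?thesis
        unfolding em2[OF B] using p0 by (simp add: ennreal_mult' nn_integral_cmult)
    qed
    ultimately show ?thesis by simp
  qed
  ultimately show "emeasure (distr P borel \<xi>) A * emeasure (distr P coords (\<lambda>\<omega> i. W i \<omega>)) B
      = emeasure (distr P (borel \<Otimes>\<^sub>M coords) (\<lambda>\<omega>. (\<xi> \<omega>, \<lambda>i. W i \<omega>))) (A \<times> B)"
    by simp
qed

end

section \<open>Null sets under translations of a Gaussian family\<close>

lemma AE_lborel_translate:
  fixes c :: "'b::euclidean_space"
  assumes [measurable]: "{x. Q x} \<in> sets borel"
  shows "(AE x in lborel. Q (c + x)) \<longleftrightarrow> (AE x in lborel. Q x)"
proof -
  have "(AE x in distr lborel borel ((+) c). Q x) \<longleftrightarrow> (AE x in lborel. Q (c + x))"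
    by (rule AE_distr_iff) simp_all
  then show ?thesis unfolding lborel_distr_plus by (rule sym)
qed

text \<open>\<open>negligible\<close> refers to the completed Lebesgue measure; Borel measurability
  brings the null set down to \<open>lborel\<close>.\<close>

lemma AE_lborel_if_negligible:
  fixes Q :: "'b::euclidean_space \<Rightarrow> bool"
  assumes "{x. \<not> Q x} \<in> sets borel" "negligible {x. \<not> Q x}"
  shows "AE x in lborel. Q x"
proof -
  have "{x. \<not> Q x} \<in> null_sets (completion lborel)"
    using assms(2) by (simp add: negligible_iff_null_sets)
  then have "{x. \<not> Q x} \<in> null_sets lborel"
    using assms(1) by (simp add: null_sets_def)
  then show ?thesis by (rule AE_I') auto
qed

context gaussian_space begin

text \<open>Writing \<open>W i = \<alpha> i * \<zeta> + W' i\<close> with \<open>\<zeta>\<close> standard normal and independent of \<open>W'\<close>, a shift of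
  \<open>\<zeta>\<close> by a constant does not change the null sets, as the normal law and Lebesgue measure have
  the same ones.\<close>

lemma Cameron_Martin_null:
  fixes W :: "'i \<Rightarrow> 'w \<Rightarrow> real"
  assumes \<xi>: "\<xi> \<in> V" and W: "\<And>i. W i \<in> V" and B [measurable]: "B \<in> sets coords"
    and null: "AE \<omega> in P. (\<lambda>i. W i \<omega> + \<eta> * expectation (\<lambda>\<omega>. W i \<omega> * \<xi> \<omega>)) \<notin> B"
  shows "AE \<omega> in P. (\<lambda>i. W i \<omega>) \<notin> B"
proof -
  obtain \<sigma> where \<sigma>: "gaussian_char \<sigma> \<xi>" using gauss[OF \<xi>] by blast
  then have "\<sigma> \<ge> 0" by (simp add: gaussian_char_def)
  show ?thesis
  proof (cases "\<sigma> = 0")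
    \<comment> \<open>A vanishing variance of \<xi> forces all its covariances to vanish, so the
      translation is zero.\<close>
    case True
    then have "(expectation (\<lambda>\<omega>. W i \<omega> * \<xi> \<omega>))\<^sup>2 \<le> 0" for i
      using Cauchy_Schwarz_V[OF W \<xi>, of i] gaussian_char_square(2)[OF \<sigma>] by simp
    then have "expectation (\<lambda>\<omega>. W i \<omega> * \<xi> \<omega>) = 0" for i
      by simp
    then show ?thesis using null by simp
  next
    case False
    then have \<sigma>0: "\<sigma> > 0" using \<open>\<sigma> \<ge> 0\<close> by simp
    define \<zeta> where "\<zeta> \<omega> = \<xi> \<omega> / \<sigma>" for \<omega>
    have \<zeta>: "\<zeta> \<in> V" using scale[OF \<xi>, of "1 / \<sigma>"] by (simp add: \<zeta>_def[abs_def])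
    have \<zeta>2: "expectation (\<lambda>\<omega>. \<zeta> \<omega> * \<zeta> \<omega>) = 1"
      using gaussian_char_square[OF \<sigma>] \<sigma>0 by (simp add: \<zeta>_def power2_eq_square)
    have D: "distr P borel \<zeta> = std_normal_distribution"
      using distr_std_normal[OF \<sigma> \<sigma>0] by (simp add: \<zeta>_def[abs_def])
    define \<alpha> where "\<alpha> i = expectation (\<lambda>\<omega>. W i \<omega> * \<zeta> \<omega>)" for i
    define W' where "W' i \<omega> = W i \<omega> - \<alpha> i * \<zeta> \<omega>" for i \<omega>
    have W': "W' i \<in> V" for i
      unfolding W'_def[abs_def] by (intro diff scale W \<zeta>)
    have orth: "expectation (\<lambda>\<omega>. W' i \<omega> * \<zeta> \<omega>) = 0" for i
      using integrable_mult[OF W \<zeta>, of i] integrable_mult[OF \<zeta> \<zeta>] \<zeta>2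
      by (simp add: W'_def left_diff_distrib mult.assoc \<alpha>_def)
    have shift: "expectation (\<lambda>\<omega>. W i \<omega> * \<xi> \<omega>) = \<alpha> i * \<sigma>" for i
      using \<sigma>0 by (simp add: \<alpha>_def \<zeta>_def)
    have [measurable]: "\<zeta> \<in> borel_measurable P" "W' i \<in> borel_measurable P" for i
      by (rule measurable_V[OF \<zeta>] measurable_V[OF W'])+
    define \<mu> where "\<mu> = distr P coords (\<lambda>\<omega> i. W' i \<omega>)"
    have mW' [measurable]: "(\<lambda>\<omega> i. W' i \<omega>) \<in> measurable P coords"
      by (rule measurable_abs_UNIV) simp
    interpret \<mu>: prob_space \<mu> unfolding \<mu>_def by (rule prob_space_distr) simp
    interpret N: prob_space std_normal_distribution
      by (rule prob_space_normal_density) simp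
    interpret pair_sigma_finite std_normal_distribution \<mu> ..
    have joint: "std_normal_distribution \<Otimes>\<^sub>M \<mu> = distr P (borel \<Otimes>\<^sub>M coords) (\<lambda>\<omega>. (\<zeta> \<omega>, \<lambda>i. W' i \<omega>))"
      using indep_if_uncorrelated[OF \<zeta> W' orth] by (simp add: D \<mu>_def)
    define Q where "Q w x \<longleftrightarrow> (\<lambda>i. w i + \<alpha> i * x) \<notin> B" for w and x :: real
    have mQ: "(\<lambda>z. (\<lambda>i. snd z i + \<alpha> i * (c + fst z))) \<in> measurable (borel \<Otimes>\<^sub>M coords) coords" for c
      by (rule measurable_abs_UNIV) measurable
    have msQ: "{z \<in> space (borel \<Otimes>\<^sub>M coords). Q (snd z) (c + fst z)} \<in> sets (borel \<Otimes>\<^sub>M coords)" for c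
      unfolding Q_def using measurable_sets[OF mQ sets.compl_sets[OF B], of c]
      by (simp add: space_PiM vimage_def Int_def conj_commute)
    \<comment> \<open>The right-hand side does not mention \<open>c\<close>. The instance
      \<open>c = \<eta> * \<sigma>\<close> is the hypothesis and the instance \<open>c = 0\<close>
      is the goal.\<close>
    have key: "(AE \<omega> in P. Q (\<lambda>i. W' i \<omega>) (c + \<zeta> \<omega>)) \<longleftrightarrow> (AE w in \<mu>. AE x in lborel. Q w x)" for c
    proof -
      have S: "sets (std_normal_distribution \<Otimes>\<^sub>M \<mu>) = sets (borel \<Otimes>\<^sub>M coords)"
        by (rule sets_pair_measure_cong) (simp_all add: \<mu>_def)
      have Sp: "space (std_normal_distribution \<Otimes>\<^sub>M \<mu>) = space (borel \<Otimes>\<^sub>M coords)"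
        by (rule sets_eq_imp_space_eq[OF S])
      have "(AE \<omega> in P. Q (\<lambda>i. W' i \<omega>) (c + \<zeta> \<omega>))
          \<longleftrightarrow> (AE z in std_normal_distribution \<Otimes>\<^sub>M \<mu>. Q (snd z) (c + fst z))"
        unfolding joint using msQ by (subst AE_distr_iff) simp_all
      also have "\<dots> \<longleftrightarrow> (AE x in std_normal_distribution. AE w in \<mu>. Q w (c + x))"
        by (rule AE_pair_iff[symmetric]) (use msQ S Sp in simp)
      also have "\<dots> \<longleftrightarrow> (AE w in \<mu>. AE x in std_normal_distribution. Q w (c + x))"
        by (rule AE_commute) (use msQ S Sp in simp)
      also have "\<dots> \<longleftrightarrow> (AE w in \<mu>. AE x in lborel. Q w (c + x))"
        by (simp add: AE_density normal_density_pos)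
      also have "\<dots> \<longleftrightarrow> (AE w in \<mu>. AE x in lborel. Q w x)"
      proof (intro arg_cong[where f = "almost_everywhere \<mu>"] ext AE_lborel_translate)
        fix w :: "'i \<Rightarrow> real"
        have "(\<lambda>x. (\<lambda>i. w i + \<alpha> i * x)) \<in> measurable borel coords"
          by (rule measurable_abs_UNIV) measurable
        from measurable_sets[OF this sets.compl_sets[OF B]] show "{x. Q w x} \<in> sets borel"
          by (simp add: Q_def space_PiM vimage_def)
      qed
      finally show ?thesis .
    qed
    have "AE \<omega> in P. Q (\<lambda>i. W' i \<omega>) (\<eta> * \<sigma> + \<zeta> \<omega>)"
      using null unfolding shift by (simp add: Q_def W'_def algebra_simps)
    then have "AE \<omega> in P. Q (\<lambda>i. W' i \<omega>) (0 + \<zeta> \<omega>)"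
      unfolding key .
    then show ?thesis by (simp add: Q_def W'_def)
  qed
qed

lemma Cameron_Martin_null_sum:
  fixes W :: "'i \<Rightarrow> 'w \<Rightarrow> real"
  assumes "finite F" and \<xi>: "\<And>b. b \<in> F \<Longrightarrow> \<xi> b \<in> V" and W: "\<And>i. W i \<in> V" and "B \<in> sets coords"
    and "AE \<omega> in P. (\<lambda>i. W i \<omega> + (\<Sum>b\<in>F. \<eta> b * expectation (\<lambda>\<omega>. W i \<omega> * \<xi> b \<omega>))) \<notin> B"
  shows "AE \<omega> in P. (\<lambda>i. W i \<omega>) \<notin> B"
  using assms(1,2,4,5)
proof (induction F arbitrary: B rule: finite_induct)
  case empty
  then show ?case by simp
next
  case (insert b F)
  define s where "s i = (\<Sum>b\<in>F. \<eta> b * expectation (\<lambda>\<omega>. W i \<omega> * \<xi> b \<omega>))" for i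
  have "(\<lambda>w. (\<lambda>i. w i + s i)) \<in> measurable coords coords"
    by (rule measurable_abs_UNIV) measurable
  \<comment> \<open>The translations by the other \<xi> are moved into the set, so that a single one
    remains to be removed.\<close>
  from measurable_sets[OF this insert.prems(2)] have B': "{w. (\<lambda>i. w i + s i) \<in> B} \<in> sets coords"
    by (simp add: space_PiM vimage_def)
  have "AE \<omega> in P. (\<lambda>i. W i \<omega> + \<eta> b * expectation (\<lambda>\<omega>. W i \<omega> * \<xi> b \<omega>)) \<notin> {w. (\<lambda>i. w i + s i) \<in> B}"
    using insert.prems(3) insert.hyps by (simp add: s_def add.assoc)
  then have "AE \<omega> in P. (\<lambda>i. W i \<omega>) \<notin> {w. (\<lambda>i. w i + s i) \<in> B}"
    by (rule Cameron_Martin_null[OF insert.prems(1) W B', of b, OF insertI1])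
  then show ?case
    using insert.prems by (intro insert.IH) (auto simp: s_def)
qed

text \<open>Fubini exchanges "for every outcome, almost every shift" with "for almost every shift,
  almost every outcome". One good shift \<eta> exists, and \<open>Cameron_Martin_null_sum\<close>
  removes it.\<close>

lemma null_if_negligible_shifts:
  fixes W :: "'i \<Rightarrow> 'w \<Rightarrow> real" and \<xi> :: "'n::euclidean_space \<Rightarrow> 'w \<Rightarrow> real"
  assumes \<xi>: "\<And>b. b \<in> Basis \<Longrightarrow> \<xi> b \<in> V" and W: "\<And>i. W i \<in> V" and B: "B \<in> sets coords"
    and negl: "\<And>\<omega>. negligible {\<eta>. (\<lambda>i. W i \<omega> + (\<Sum>b\<in>Basis. (\<eta> \<bullet> b) * expectation (\<lambda>\<omega>. W i \<omega> * \<xi> b \<omega>))) \<in> B}"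
  shows "AE \<omega> in P. (\<lambda>i. W i \<omega>) \<notin> B"
proof -
  define \<Phi> where "\<Phi> \<omega> \<eta> i = W i \<omega> + (\<Sum>b\<in>Basis. (\<eta> \<bullet> b) * expectation (\<lambda>\<omega>. W i \<omega> * \<xi> b \<omega>))"
    for \<omega> and \<eta> :: 'n and i
  have [measurable]: "W i \<in> borel_measurable P" for i by (rule measurable_V[OF W])
  have m\<Phi>: "(\<lambda>z. \<Phi> (fst z) (snd z)) \<in> measurable (P \<Otimes>\<^sub>M lborel) coords"
    unfolding \<Phi>_def[abs_def] by (rule measurable_abs_UNIV) measurable
  have ms: "{z \<in> space (P \<Otimes>\<^sub>M lborel). \<Phi> (fst z) (snd z) \<notin> B} \<in> sets (P \<Otimes>\<^sub>M lborel)"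
    using measurable_sets[OF m\<Phi> sets.compl_sets[OF B]]
    by (simp add: space_PiM vimage_def Int_def conj_commute)
  interpret pair_sigma_finite P "lborel :: 'n measure" ..
  have "AE \<omega> in P. AE \<eta> in lborel. \<Phi> \<omega> \<eta> \<notin> B"
  proof (rule AE_I2, rule AE_lborel_if_negligible)
    fix \<omega> assume "\<omega> \<in> space P"
    have "\<Phi> \<omega> \<in> measurable borel coords"
      unfolding \<Phi>_def[abs_def] by (rule measurable_abs_UNIV) measurable
    from measurable_sets[OF this B] show "{\<eta>. \<not> \<Phi> \<omega> \<eta> \<notin> B} \<in> sets borel"
      by (simp add: vimage_def)
    show "negligible {\<eta>. \<not> \<Phi> \<omega> \<eta> \<notin> B}"
      using negl[of \<omega>] by (simp add: \<Phi>_def[abs_def])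
  qed
  then have "AE \<eta> in lborel. AE \<omega> in P. \<Phi> \<omega> \<eta> \<notin> B"
    using AE_commute[OF ms] by simp
  \<comment> \<open>Lebesgue measure is nonzero, so a property holding almost everywhere holds
    somewhere.\<close>
  moreover have "ae_filter (lborel :: 'n measure) \<noteq> bot"
    by (simp add: ae_filter_eq_bot_iff)
  ultimately obtain \<eta> where "AE \<omega> in P. \<Phi> \<omega> \<eta> \<notin> B"
    using eventually_happens' by blast
  then show ?thesis
    unfolding \<Phi>_def[abs_def]
    by (rule Cameron_Martin_null_sum[rotated 4]) (simp_all add: \<xi> W B)
qed

end

section \<open>The Gaussian space of a field\<close>

text \<open>The closure of the linear span of the field in probability. The truncated distance E
  (min 1 \<bar>Y - Z\<bar>) metrizes this convergence and is finite for all measurable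
  functions.\<close>

definition gaussian_hull :: "'w measure \<Rightarrow> ('w \<Rightarrow> 'a \<Rightarrow> real) \<Rightarrow> ('w \<Rightarrow> real) set" where
  "gaussian_hull P X = {Y \<in> borel_measurable P. \<forall>\<epsilon>>0. \<exists>S a. finite S
     \<and> (\<integral>\<omega>. min 1 \<bar>Y \<omega> - (\<Sum>p\<in>S. a p * X \<omega> p)\<bar> \<partial>P) < \<epsilon>}"

lemma gaussian_hullE:
  assumes "Y \<in> gaussian_hull P X" "\<epsilon> > 0"
  obtains S a where "finite S" "(\<integral>\<omega>. min 1 \<bar>Y \<omega> - (\<Sum>p\<in>S. a p * X \<omega> p)\<bar> \<partial>P) < \<epsilon>"
  using assms by (auto simp: gaussian_hull_def)

context prob_space begin

lemma integrable_min_1: "Y \<in> borel_measurable M \<Longrightarrow> integrable M (\<lambda>\<omega>. min 1 \<bar>Y \<omega>\<bar> :: real)"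
  by (rule integrable_bounded[where C = 1]) simp_all

lemma expectation_min_1_add:
  fixes Y Z :: "'a \<Rightarrow> real"
  assumes "Y \<in> borel_measurable M" "Z \<in> borel_measurable M"
  shows "expectation (\<lambda>\<omega>. min 1 \<bar>Y \<omega> + Z \<omega>\<bar>) \<le> expectation (\<lambda>\<omega>. min 1 \<bar>Y \<omega>\<bar>) + expectation (\<lambda>\<omega>. min 1 \<bar>Z \<omega>\<bar>)"
proof -
  have "expectation (\<lambda>\<omega>. min 1 \<bar>Y \<omega> + Z \<omega>\<bar>) \<le> expectation (\<lambda>\<omega>. min 1 \<bar>Y \<omega>\<bar> + min 1 \<bar>Z \<omega>\<bar>)"
  proof (rule integral_mono)
    show "min 1 \<bar>Y \<omega> + Z \<omega>\<bar> \<le> min 1 \<bar>Y \<omega>\<bar> + min 1 \<bar>Z \<omega>\<bar>" for \<omega>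
      using abs_triangle_ineq[of "Y \<omega>" "Z \<omega>"] unfolding min_def by auto
  qed (intro integrable_min_1 Bochner_Integration.integrable_add borel_measurable_add assms)+
  then show ?thesis
    using integrable_min_1[OF assms(1)] integrable_min_1[OF assms(2)] by simp
qed

lemma measurable_field:
  assumes "centered_gaussian_field M X"
  shows "(\<lambda>\<omega>. \<Sum>p\<in>S. a p * X \<omega> p) \<in> borel_measurable M"
proof (cases "finite S")
  case True
  then show ?thesis using assms by (simp add: centered_gaussian_field_def centered_gaussian_def)
qed simp

text \<open>The linear operations follow from inequalities for the truncated distance, Gaussianity
  from \<open>gaussian_char_limit\<close>, and closure under almost sure limits from dominated
  convergence.\<close>

lemma gaussian_space_hull:
  assumes X: "centered_gaussian_field M X"
  shows "gaussian_space M (gaussian_hull M X)"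
proof
  note mX [measurable] = measurable_field[OF X]
  show "\<exists>\<sigma>. gaussian_char \<sigma> Y" if Y: "Y \<in> gaussian_hull M X" for Y
  proof -
    have [measurable]: "Y \<in> borel_measurable M" using Y by (simp add: gaussian_hull_def)
    have "\<exists>Z \<sigma>. gaussian_char \<sigma> Z \<and> expectation (\<lambda>\<omega>. min 1 \<bar>Y \<omega> - Z \<omega>\<bar>) < inverse (real (Suc n))" for n
    proof -
      have pos: "inverse (real (Suc n)) > 0" by simp
      obtain S a where S: "finite S"
        and lt: "expectation (\<lambda>\<omega>. min 1 \<bar>Y \<omega> - (\<Sum>p\<in>S. a p * X \<omega> p)\<bar>) < inverse (real (Suc n))"
        by (rule gaussian_hullE[OF Y pos])
      have "centered_gaussian M (\<lambda>\<omega>. \<Sum>p\<in>S. a p * X \<omega> p)"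
        using X S by (simp add: centered_gaussian_field_def)
      from gaussian_char_if_centered_gaussian[OF this] lt show ?thesis by blast
    qed
    then obtain Z \<sigma> where \<sigma>: "\<And>n. gaussian_char (\<sigma> n) (Z n)"
      and lt: "\<And>n. expectation (\<lambda>\<omega>. min 1 \<bar>Y \<omega> - Z n \<omega>\<bar>) < inverse (real (Suc n))"
      by metis
    have "(\<lambda>n. expectation (\<lambda>\<omega>. min 1 \<bar>Y \<omega> - Z n \<omega>\<bar>)) \<longlonglongrightarrow> 0"
    proof (rule tendsto_sandwich[OF _ _ tendsto_const LIMSEQ_inverse_real_of_nat])
      show "\<forall>\<^sub>F n in sequentially. 0 \<le> expectation (\<lambda>\<omega>. min 1 \<bar>Y \<omega> - Z n \<omega>\<bar>)"
        by (intro always_eventually allI Bochner_Integration.integral_nonneg) simp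
      show "\<forall>\<^sub>F n in sequentially. expectation (\<lambda>\<omega>. min 1 \<bar>Y \<omega> - Z n \<omega>\<bar>) \<le> inverse (real (Suc n))"
        by (intro always_eventually allI less_imp_le lt)
    qed
    from gaussian_char_limit[OF \<open>Y \<in> borel_measurable M\<close> \<sigma> this] show ?thesis .
  qed
  have zero: "expectation (\<lambda>\<omega>. min 1 \<bar>0 - (\<Sum>p\<in>{}. a p * X \<omega> p)\<bar>) = 0" for a :: "'b \<Rightarrow> real"
    by simp
  show "(\<lambda>_. 0) \<in> gaussian_hull M X"
    unfolding gaussian_hull_def mem_Collect_eq
  proof (intro conjI allI impI)
    fix \<epsilon> :: real assume "\<epsilon> > 0"
    then show "\<exists>S a. finite S \<and> expectation (\<lambda>\<omega>. min 1 \<bar>0 - (\<Sum>p\<in>S. a p * X \<omega> p)\<bar>) < \<epsilon>"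
      using zero by (metis finite.emptyI)
  qed simp
  show "(\<lambda>\<omega>. Y \<omega> + Z \<omega>) \<in> gaussian_hull M X" if YZ: "Y \<in> gaussian_hull M X" "Z \<in> gaussian_hull M X" for Y Z
    unfolding gaussian_hull_def mem_Collect_eq
  proof (intro conjI allI impI)
    have [measurable]: "Y \<in> borel_measurable M" "Z \<in> borel_measurable M"
      using YZ by (simp_all add: gaussian_hull_def)
    then show "(\<lambda>\<omega>. Y \<omega> + Z \<omega>) \<in> borel_measurable M" by simp
    fix \<epsilon> :: real assume "\<epsilon> > 0"
    then have "\<epsilon> / 2 > 0" by simp
    obtain S a where S1: "finite S"
      and lt1: "expectation (\<lambda>\<omega>. min 1 \<bar>Y \<omega> - (\<Sum>p\<in>S. a p * X \<omega> p)\<bar>) < \<epsilon> / 2"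
      by (rule gaussian_hullE[OF YZ(1) \<open>\<epsilon> / 2 > 0\<close>])
    obtain S' a' where S2: "finite S'"
      and lt2: "expectation (\<lambda>\<omega>. min 1 \<bar>Z \<omega> - (\<Sum>p\<in>S'. a' p * X \<omega> p)\<bar>) < \<epsilon> / 2"
      by (rule gaussian_hullE[OF YZ(2) \<open>\<epsilon> / 2 > 0\<close>])
    note S = S1 S2 and lt = lt1 lt2
    \<comment> \<open>The coefficients add up at points common to \<open>S\<close> and
      \<open>S'\<close>.\<close>
    define b where "b p = (if p \<in> S then a p else 0) + (if p \<in> S' then a' p else 0)" for p
    have b: "(\<Sum>p\<in>S \<union> S'. b p * X \<omega> p) = (\<Sum>p\<in>S. a p * X \<omega> p) + (\<Sum>p\<in>S'. a' p * X \<omega> p)" for \<omega>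
    proof -
      have "(\<Sum>p\<in>S \<union> S'. b p * X \<omega> p)
          = (\<Sum>p\<in>S \<union> S'. (if p \<in> S then a p * X \<omega> p else 0)) + (\<Sum>p\<in>S \<union> S'. (if p \<in> S' then a' p * X \<omega> p else 0))"
        unfolding sum.distrib[symmetric] by (intro sum.cong) (auto simp: b_def algebra_simps)
      also have "\<dots> = (\<Sum>p\<in>(S \<union> S') \<inter> S. a p * X \<omega> p) + (\<Sum>p\<in>(S \<union> S') \<inter> S'. a' p * X \<omega> p)"
        using S by (simp only: sum.inter_restrict finite_UnI)
      also have "(S \<union> S') \<inter> S = S" by blast
      also have "(S \<union> S') \<inter> S' = S'" by blast
      finally show ?thesis .
    qed
    have "expectation (\<lambda>\<omega>. min 1 \<bar>Y \<omega> + Z \<omega> - (\<Sum>p\<in>S \<union> S'. b p * X \<omega> p)\<bar>)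
        = expectation (\<lambda>\<omega>. min 1 \<bar>(Y \<omega> - (\<Sum>p\<in>S. a p * X \<omega> p)) + (Z \<omega> - (\<Sum>p\<in>S'. a' p * X \<omega> p))\<bar>)"
      by (simp only: b add_diff_add)
    also have "\<dots> \<le> expectation (\<lambda>\<omega>. min 1 \<bar>Y \<omega> - (\<Sum>p\<in>S. a p * X \<omega> p)\<bar>)
        + expectation (\<lambda>\<omega>. min 1 \<bar>Z \<omega> - (\<Sum>p\<in>S'. a' p * X \<omega> p)\<bar>)"
      by (rule expectation_min_1_add) simp_all
    finally have "expectation (\<lambda>\<omega>. min 1 \<bar>Y \<omega> + Z \<omega> - (\<Sum>p\<in>S \<union> S'. b p * X \<omega> p)\<bar>) < \<epsilon>"
      using lt by linarith
    then show "\<exists>S a. finite S \<and> expectation (\<lambda>\<omega>. min 1 \<bar>Y \<omega> + Z \<omega> - (\<Sum>p\<in>S. a p * X \<omega> p)\<bar>) < \<epsilon>"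
      using S by (intro exI[of _ "S \<union> S'"] exI[of _ b] conjI finite_UnI)
  qed
  show "(\<lambda>\<omega>. c * Y \<omega>) \<in> gaussian_hull M X" if Y: "Y \<in> gaussian_hull M X" for Y c
    unfolding gaussian_hull_def mem_Collect_eq
  proof (intro conjI allI impI)
    have [measurable]: "Y \<in> borel_measurable M"
      using Y by (simp_all add: gaussian_hull_def)
    then show "(\<lambda>\<omega>. c * Y \<omega>) \<in> borel_measurable M" by simp
    fix \<epsilon> :: real assume "\<epsilon> > 0"
    \<comment> \<open>The truncation is not homogeneous: scaling by \<open>c\<close> costs the
      factor \<open>1 + \<bar>c\<bar>\<close>, which also works for \<bar>c\<bar> < 1.\<close>
    then have pos: "\<epsilon> / (1 + \<bar>c\<bar>) > 0" by simp
    obtain S a where S: "finite S"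
      and lt: "expectation (\<lambda>\<omega>. min 1 \<bar>Y \<omega> - (\<Sum>p\<in>S. a p * X \<omega> p)\<bar>) < \<epsilon> / (1 + \<bar>c\<bar>)"
      by (rule gaussian_hullE[OF Y pos])
    let ?Z = "\<lambda>\<omega>. Y \<omega> - (\<Sum>p\<in>S. a p * X \<omega> p)"
    have "c * Y \<omega> - (\<Sum>p\<in>S. c * a p * X \<omega> p) = c * ?Z \<omega>" for \<omega>
      by (simp add: right_diff_distrib sum_distrib_left mult.assoc)
    then have "expectation (\<lambda>\<omega>. min 1 \<bar>c * Y \<omega> - (\<Sum>p\<in>S. c * a p * X \<omega> p)\<bar>) = expectation (\<lambda>\<omega>. min 1 \<bar>c * ?Z \<omega>\<bar>)"
      by simp
    also have "\<dots> \<le> expectation (\<lambda>\<omega>. (1 + \<bar>c\<bar>) * min 1 \<bar>?Z \<omega>\<bar>)"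
    proof (rule integral_mono)
      show "integrable M (\<lambda>\<omega>. min 1 \<bar>c * ?Z \<omega>\<bar>)" by (rule integrable_min_1) simp
      show "integrable M (\<lambda>\<omega>. (1 + \<bar>c\<bar>) * min 1 \<bar>?Z \<omega>\<bar>)"
        by (intro integrable_mult_right integrable_min_1) simp
      show "min 1 \<bar>c * ?Z \<omega>\<bar> \<le> (1 + \<bar>c\<bar>) * min 1 \<bar>?Z \<omega>\<bar>" for \<omega>
      proof (cases "\<bar>?Z \<omega>\<bar> \<le> 1")
        case True
        have "\<bar>c * ?Z \<omega>\<bar> \<le> (1 + \<bar>c\<bar>) * \<bar>?Z \<omega>\<bar>"
          unfolding abs_mult by (intro mult_right_mono) auto
        then show ?thesis using True by (simp add: min_def)
      next
        case False
        then have "min 1 \<bar>?Z \<omega>\<bar> = 1" by simp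
        moreover have "min 1 \<bar>c * ?Z \<omega>\<bar> \<le> 1 + \<bar>c\<bar>"
          by (rule order_trans[OF min.cobounded1]) simp
        ultimately show ?thesis by (simp only: mult_1_right)
      qed
    qed
    also have "\<dots> = (1 + \<bar>c\<bar>) * expectation (\<lambda>\<omega>. min 1 \<bar>?Z \<omega>\<bar>)" by simp
    also have "\<dots> < \<epsilon>" using lt by (simp add: pos_less_divide_eq mult.commute)
    finally show "\<exists>S a. finite S \<and> expectation (\<lambda>\<omega>. min 1 \<bar>c * Y \<omega> - (\<Sum>p\<in>S. a p * X \<omega> p)\<bar>) < \<epsilon>"
      using S by (intro exI[of _ S] exI[of _ "\<lambda>p. c * a p"] conjI)
  qed
  show "Y \<in> gaussian_hull M X" if U: "\<And>n. U n \<in> gaussian_hull M X" and Y: "Y \<in> borel_measurable M"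
    and lim: "AE \<omega> in M. (\<lambda>n. U n \<omega>) \<longlonglongrightarrow> Y \<omega>" for U :: "nat \<Rightarrow> 'a \<Rightarrow> real" and Y
    unfolding gaussian_hull_def mem_Collect_eq
  proof (intro conjI allI impI Y)
    note [measurable] = Y
    have [measurable]: "U n \<in> borel_measurable M" for n
      using U[of n] by (simp add: gaussian_hull_def)
    fix \<epsilon> :: real assume "\<epsilon> > 0"
    have "AE \<omega> in M. (\<lambda>n. min 1 \<bar>Y \<omega> - U n \<omega>\<bar>) \<longlonglongrightarrow> 0"
      using lim
    proof (rule eventually_mono)
      fix \<omega> assume "(\<lambda>n. U n \<omega>) \<longlonglongrightarrow> Y \<omega>"
      then have "(\<lambda>n. min 1 \<bar>Y \<omega> - U n \<omega>\<bar>) \<longlonglongrightarrow> min 1 \<bar>Y \<omega> - Y \<omega>\<bar>"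
        by (intro tendsto_min tendsto_rabs tendsto_diff tendsto_const)
      then show "(\<lambda>n. min 1 \<bar>Y \<omega> - U n \<omega>\<bar>) \<longlonglongrightarrow> 0" by simp
    qed
    then have "(\<lambda>n. expectation (\<lambda>\<omega>. min 1 \<bar>Y \<omega> - U n \<omega>\<bar>)) \<longlonglongrightarrow> expectation (\<lambda>\<omega>. 0)"
      by (intro integral_dominated_convergence[where w = "\<lambda>_. 1" and f = "\<lambda>\<omega>. 0"
          and s = "\<lambda>n \<omega>. min 1 \<bar>Y \<omega> - U n \<omega>\<bar>"]) simp_all
    then have "\<forall>\<^sub>F n in sequentially. expectation (\<lambda>\<omega>. min 1 \<bar>Y \<omega> - U n \<omega>\<bar>) < \<epsilon> / 2"
      using \<open>\<epsilon> > 0\<close> by (intro order_tendstoD(2)[where y = 0]) simp_all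
    from eventually_happens'[OF sequentially_bot this]
    obtain n where n: "expectation (\<lambda>\<omega>. min 1 \<bar>Y \<omega> - U n \<omega>\<bar>) < \<epsilon> / 2" ..
    have pos: "\<epsilon> / 2 > 0" using \<open>\<epsilon> > 0\<close> by simp
    obtain S a where S: "finite S"
      and lt: "expectation (\<lambda>\<omega>. min 1 \<bar>U n \<omega> - (\<Sum>p\<in>S. a p * X \<omega> p)\<bar>) < \<epsilon> / 2"
      by (rule gaussian_hullE[OF U pos])
    have telescope: "(Y \<omega> - U n \<omega>) + (U n \<omega> - s) = Y \<omega> - s" for \<omega> s
      by simp
    have "expectation (\<lambda>\<omega>. min 1 \<bar>Y \<omega> - (\<Sum>p\<in>S. a p * X \<omega> p)\<bar>)
        = expectation (\<lambda>\<omega>. min 1 \<bar>(Y \<omega> - U n \<omega>) + (U n \<omega> - (\<Sum>p\<in>S. a p * X \<omega> p))\<bar>)"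
      by (simp only: telescope)
    also have "\<dots> \<le> expectation (\<lambda>\<omega>. min 1 \<bar>Y \<omega> - U n \<omega>\<bar>) + expectation (\<lambda>\<omega>. min 1 \<bar>U n \<omega> - (\<Sum>p\<in>S. a p * X \<omega> p)\<bar>)"
      by (rule expectation_min_1_add) simp_all
    finally have "expectation (\<lambda>\<omega>. min 1 \<bar>Y \<omega> - (\<Sum>p\<in>S. a p * X \<omega> p)\<bar>) < \<epsilon>"
      using lt n by linarith
    then show "\<exists>S a. finite S \<and> expectation (\<lambda>\<omega>. min 1 \<bar>Y \<omega> - (\<Sum>p\<in>S. a p * X \<omega> p)\<bar>) < \<epsilon>"
      using S by (intro exI[of _ S] exI[of _ a] conjI)
  qed
qed

lemma field_in_gaussian_hull:
  assumes X: "centered_gaussian_field M X"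
  shows "(\<lambda>\<omega>. X \<omega> p) \<in> gaussian_hull M X"
  unfolding gaussian_hull_def mem_Collect_eq
proof (intro conjI allI impI)
  show "(\<lambda>\<omega>. X \<omega> p) \<in> borel_measurable M"
    using measurable_field[OF X, of "\<lambda>_. 1" "{p}"] by simp
  fix \<epsilon> :: real assume "\<epsilon> > 0"
  then have "expectation (\<lambda>\<omega>. min 1 \<bar>X \<omega> p - (\<Sum>q\<in>{p}. 1 * X \<omega> q)\<bar>) < \<epsilon>" by simp
  then show "\<exists>S a. finite S \<and> expectation (\<lambda>\<omega>. min 1 \<bar>X \<omega> p - (\<Sum>p\<in>S. a p * X \<omega> p)\<bar>) < \<epsilon>"
    by (intro exI[of _ "{p}"] exI[of _ "\<lambda>_. 1"] conjI) simp_all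
qed

end

section \<open>Parametric Sard theorem and jets in a chart\<close>

text \<open>A point \<open>z\<close> is a zero for the parameter \<eta> iff \<eta> =
  \<open>G z\<close>, where \<open>G z\<close> is minus the inverse of \<open>L z\<close> applied to
  \<open>h z\<close>. If \<open>D\<close> is the derivative at \<open>z\<close> of the map with
  \<eta> frozen at \<open>G z\<close>, then \<open>G\<close> has derivative
  \<open>- M z \<circ> D\<close>, with \<open>M z\<close> inverse to \<open>L z\<close>. So the bad
  parameters are critical values of \<open>G\<close>, and Sard applies to \<open>G\<close>.\<close>

lemma parametric_Sard:
  fixes h :: "'n::euclidean_space \<Rightarrow> 'n" and L :: "'n \<Rightarrow> 'n \<Rightarrow> 'n"
  assumes lin: "\<And>z. z \<in> Z \<Longrightarrow> linear (L z)"
    and c: "c > 0" "\<And>z v. z \<in> Z \<Longrightarrow> c * norm v \<le> norm (L z v)"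
    and cont: "\<And>v. continuous_on Z (\<lambda>z. L z v)"
  shows "negligible {\<eta>. \<exists>z\<in>Z. h z + L z \<eta> = 0
    \<and> (\<exists>D. ((\<lambda>z. h z + L z \<eta>) has_derivative D) (at z within Z) \<and> \<not> inj D)}"
proof -
  have inj: "inj (L z)" if "z \<in> Z" for z
  proof (rule injI)
    fix u v assume "L z u = L z v"
    then have "L z (u - v) = 0" using lin[OF that] by (simp add: linear_diff)
    then have "c * norm (u - v) \<le> 0" using c(2)[OF that, of "u - v"] by simp
    then show "u = v" using c(1) by (simp add: mult_le_0_iff)
  qed
  have surj: "surj (L z)" if "z \<in> Z" for z
    by (rule linear_injective_imp_surjective[OF lin[OF that] inj[OF that]]) simp
  define M where "M z = inv (L z)" for z
  have LM: "L z (M z w) = w" if "z \<in> Z" for z w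
    unfolding M_def by (rule surj_f_inv_f[OF surj[OF that]])
  have normM: "norm (M z w) \<le> norm w / c" if "z \<in> Z" for z w
    using c(2)[OF that, of "M z w"] c(1) by (simp add: LM[OF that] pos_le_divide_eq mult.commute)
  have linM: "linear (M z)" if z: "z \<in> Z" for z
  proof (rule linearI)
    have "L z (M z (u + v)) = L z (M z u + M z v)" for u v
      using lin[OF z] by (simp add: LM[OF z] linear_add)
    then show "M z (u + v) = M z u + M z v" for u v
      using inj[OF z] by (simp add: inj_eq)
    have "L z (M z (r *\<^sub>R u)) = L z (r *\<^sub>R M z u)" for r u
      using lin[OF z] by (simp add: LM[OF z] linear_scale)
    then show "M z (r *\<^sub>R u) = r *\<^sub>R M z u" for r u
      using inj[OF z] by (simp add: inj_eq)
  qed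
  define G where "G z = M z (- h z)" for z
  have G: "h z + L z (G z) = 0" if "z \<in> Z" for z
    using LM[OF that] by (simp add: G_def)
  have G_unique: "\<eta> = G z" if "z \<in> Z" "h z + L z \<eta> = 0" for z \<eta>
  proof -
    have "L z \<eta> = L z (G z)" using G[OF that(1)] that(2) by (metis add_left_cancel)
    then show ?thesis using inj[OF that(1)] by (simp add: inj_eq)
  qed
  define Q where "Q z D \<longleftrightarrow> ((\<lambda>z'. h z' + L z' (G z)) has_derivative D) (at z within Z) \<and> \<not> inj D" for z D
  define Z0 where "Z0 = {z \<in> Z. \<exists>D. Q z D}"
  \<comment> \<open>Derivatives within \<open>Z\<close> need not be unique; one singular derivative
    is chosen at each point of \<open>Z0\<close>.\<close>
  define D where "D z = (SOME D. Q z D)" for z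
  have D: "Q z (D z)" if "z \<in> Z0" for z
    unfolding D_def using that by (intro someI_ex[of "Q z"]) (simp add: Z0_def)
  have "negligible (G ` Z0)"
  proof (rule Sard_singular[where f' = "\<lambda>z \<delta>. - M z (D z \<delta>)"])
    fix z assume z0: "z \<in> Z0"
    then have z: "z \<in> Z" by (simp add: Z0_def)
    have der: "((\<lambda>z'. h z' + L z' (G z)) has_derivative D z) (at z within Z)" and ninj: "\<not> inj (D z)"
      using D[OF z0] by (simp_all add: Q_def)
    have blD: "bounded_linear (D z)" using der by (rule has_derivative_bounded_linear)
    have blM: "bounded_linear (M z)" using linM[OF z] by (simp add: linear_conv_bounded_linear)
    obtain B where B: "B > 0" "\<And>\<delta>. norm (D z \<delta>) \<le> norm \<delta> * B"
      using bounded_linear.pos_bounded[OF blD] by blast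
    show "\<not> inj (\<lambda>\<delta>. - M z (D z \<delta>))"
      using ninj unfolding inj_def by (metis LM[OF z] minus_equation_iff)
    show "(G has_derivative (\<lambda>\<delta>. - M z (D z \<delta>))) (at z within Z0)"
      unfolding has_derivative_within_alt
    proof (intro conjI allI impI)
      show "bounded_linear (\<lambda>\<delta>. - M z (D z \<delta>))"
        by (intro bounded_linear_minus bounded_linear_compose[OF blM blD])
      fix e :: real assume e: "e > 0"
      define e1 where "e1 = e * c / 2"
      define e2 where "e2 = e * c\<^sup>2 / (2 * B)"
      have e12: "e1 > 0" "e2 > 0" using e c(1) B(1) by (simp_all add: e1_def e2_def)
      obtain d1 where d1: "d1 > 0"
        "\<And>z'. z' \<in> Z \<Longrightarrow> norm (z' - z) < d1 \<Longrightarrow>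
          norm (h z' + L z' (G z) - (h z + L z (G z)) - D z (z' - z)) \<le> e1 * norm (z' - z)"
        using der e12(1) unfolding has_derivative_within_alt by meson
      have "continuous_on Z (\<lambda>z'. \<Sum>b\<in>Basis. norm (L z' b - L z b))"
        by (intro continuous_on_sum continuous_on_norm continuous_on_diff cont continuous_on_const)
      then obtain d2 where d2: "d2 > 0"
        "\<And>z'. z' \<in> Z \<Longrightarrow> dist z' z < d2 \<Longrightarrow>
          dist (\<Sum>b\<in>Basis. norm (L z' b - L z b)) (\<Sum>b\<in>Basis. norm (L z b - L z b)) < e2"
        using z e12(2) unfolding continuous_on_iff by meson
      have close: "norm (L z' w - L z w) \<le> e2 * norm w" if "z' \<in> Z" "norm (z' - z) < d2" for z' w
      proof -
        have rep: "L y w = (\<Sum>b\<in>Basis. (w \<bullet> b) *\<^sub>R L y b)" if "y \<in> Z" for y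
          by (subst euclidean_representation[of w, symmetric])
            (simp only: linear_sum[OF lin[OF that]] linear_scale[OF lin[OF that]])
        have "norm (L z' w - L z w) = norm (\<Sum>b\<in>Basis. (w \<bullet> b) *\<^sub>R (L z' b - L z b))"
          unfolding rep[OF that(1)] rep[OF z] by (simp add: sum_subtractf scaleR_diff_right)
        also have "\<dots> \<le> (\<Sum>b\<in>Basis. norm w * norm (L z' b - L z b))"
          by (intro sum_norm_le) (simp add: mult_right_mono Basis_le_norm)
        also have "\<dots> = norm w * (\<Sum>b\<in>Basis. norm (L z' b - L z b))"
          by (simp add: sum_distrib_left)
        also have "\<dots> \<le> norm w * e2"
          using d2(2)[OF that(1)] that(2) by (intro mult_left_mono) (simp_all add: dist_norm)
        finally show ?thesis by (simp add: mult.commute)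
      qed
      show "\<exists>d>0. \<forall>y\<in>Z0. norm (y - z) < d \<longrightarrow> norm (G y - G z - - M z (D z (y - z))) \<le> e * norm (y - z)"
      proof (intro exI[of _ "min d1 d2"] conjI ballI impI)
        fix y assume "y \<in> Z0" and y: "norm (y - z) < min d1 d2"
        then have yZ: "y \<in> Z" by (simp add: Z0_def)
        define w0 where "w0 = - M z (D z (y - z))"
        have Lw0: "L z w0 = - D z (y - z)"
          unfolding w0_def using LM[OF z] lin[OF z] by (simp add: linear_neg)
        \<comment> \<open>\<open>L y\<close> is applied to the error of \<open>G\<close> so that the
          two zero equations can be used; the uniform lower bound \<open>c\<close> then inverts
          \<open>L y\<close> at the moving point.\<close>
        have "L y (G y - G z - w0) = L y (G y) - L y (G z) - L y w0"
          using lin[OF yZ] by (simp add: linear_diff)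
        also have "\<dots> = - (h y + L y (G z) - (h z + L z (G z)) - D z (y - z)) - (L y w0 - L z w0)"
          using G[OF yZ] G[OF z] Lw0 by (simp add: algebra_simps eq_neg_iff_add_eq_0)
        finally have "norm (L y (G y - G z - w0))
            \<le> norm (h y + L y (G z) - (h z + L z (G z)) - D z (y - z)) + norm (L y w0 - L z w0)"
          by (metis norm_triangle_ineq4 norm_minus_cancel)
        also have "\<dots> \<le> e1 * norm (y - z) + e2 * norm w0"
          using y by (intro add_mono d1(2) close yZ) auto
        also have "norm w0 \<le> norm (y - z) * B / c"
          unfolding w0_def norm_minus_cancel
          by (rule order_trans[OF normM[OF z]]) (use B(2) c(1) in \<open>simp add: divide_right_mono\<close>)
        then have "e1 * norm (y - z) + e2 * norm w0 \<le> e1 * norm (y - z) + e2 * (norm (y - z) * B / c)"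
          using mult_left_mono[of "norm w0" "norm (y - z) * B / c" e2] e12(2) by simp
        also have "\<dots> = c * (e * norm (y - z))"
          using B(1) c(1) by (simp add: e1_def e2_def power2_eq_square)
        finally have "norm (L y (G y - G z - w0)) \<le> c * (e * norm (y - z))" by simp
        then have "c * norm (G y - G z - w0) \<le> c * (e * norm (y - z))"
          using c(2)[OF yZ, of "G y - G z - w0"] by linarith
        then show "norm (G y - G z - - M z (D z (y - z))) \<le> e * norm (y - z)"
          using c(1) by (simp add: w0_def)
      qed (use d1 d2 in simp)
    qed
  qed
  moreover have "{\<eta>. \<exists>z\<in>Z. h z + L z \<eta> = 0
    \<and> (\<exists>D. ((\<lambda>z. h z + L z \<eta>) has_derivative D) (at z within Z) \<and> \<not> inj D)} \<subseteq> G ` Z0"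
  proof clarify
    fix \<eta> z E assume z: "z \<in> Z" "h z + L z \<eta> = 0"
      and E: "((\<lambda>z. h z + L z \<eta>) has_derivative E) (at z within Z)" "\<not> inj E"
    have "\<eta> = G z" by (rule G_unique[OF z])
    then have "Q z E" using E by (simp add: Q_def)
    then show "\<eta> \<in> G ` Z0" using z(1) \<open>\<eta> = G z\<close> by (auto simp: Z0_def)
  qed
  ultimately show ?thesis by (rule negligible_subset)
qed

section \<open>Joint differentiability in time and space\<close>

text \<open>The increment from \<open>(t, x)\<close> to \<open>(s, y)\<close> is first taken in time
  at \<open>y\<close>, then in space at time \<open>t\<close>. Uniformity in \<open>y\<close> of the
  time quotient and continuity of \<open>q'\<close> replace \<open>q' y\<close> by
  \<open>q' x\<close>; no space derivative at other times occurs.\<close>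

lemma has_derivative_joint:
  fixes q :: "real \<Rightarrow> 'b::real_normed_vector \<Rightarrow> real"
  assumes t: "t \<in> I" and x: "x \<in> K"
    and unif: "uniform_limit K (\<lambda>s y. (q s y - q t y) / (s - t)) q' (at t within I)"
    and cont: "continuous_on K q'" and der: "(q t has_derivative A) (at x within K)"
  shows "((\<lambda>z. q (fst z) (snd z)) has_derivative (\<lambda>z. fst z * q' x + A (snd z))) (at (t, x) within I \<times> K)"
  unfolding has_derivative_within_alt
proof (intro conjI allI impI)
  have blA: "bounded_linear A" using der by (rule has_derivative_bounded_linear)
  show "bounded_linear (\<lambda>z :: real \<times> 'b. fst z * q' x + A (snd z))"
    by (intro bounded_linear_add bounded_linear_mult_const bounded_linear_fst
        bounded_linear_compose[OF blA bounded_linear_snd])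
  fix e :: real assume "e > 0"
  \<comment> \<open>Three errors: the time quotient at \<open>y\<close>, the change of
    \<open>q'\<close> from \<open>y\<close> to \<open>x\<close>, and the space remainder.\<close>
  define e' where "e' = e / 3"
  have e': "e' > 0" using \<open>e > 0\<close> by (simp add: e'_def)
  obtain d1 where d1: "d1 > 0" "\<And>s y. s \<in> I \<Longrightarrow> s \<noteq> t \<Longrightarrow> dist s t < d1 \<Longrightarrow> y \<in> K
      \<Longrightarrow> dist ((q s y - q t y) / (s - t)) (q' y) < e'"
    using unif e' unfolding uniform_limit_iff eventually_at by (metis (no_types, lifting))
  obtain d2 where d2: "d2 > 0" "\<And>y. y \<in> K \<Longrightarrow> dist y x < d2 \<Longrightarrow> dist (q' y) (q' x) < e'"
    using cont x e' unfolding continuous_on_iff by meson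
  obtain d3 where d3: "d3 > 0" "\<And>y. y \<in> K \<Longrightarrow> norm (y - x) < d3 \<Longrightarrow> norm (q t y - q t x - A (y - x))
      \<le> e' * norm (y - x)"
    using der e' unfolding has_derivative_within_alt by meson
  show "\<exists>d>0. \<forall>z\<in>I \<times> K. norm (z - (t, x)) < d \<longrightarrow>
      norm (q (fst z) (snd z) - q (fst (t, x)) (snd (t, x)) -
          (fst (z - (t, x)) * q' x + A (snd (z - (t, x))))) \<le> e * norm (z - (t, x))"
  proof (intro exI[of _ "min d1 (min d2 d3)"] conjI ballI impI)
    fix z assume "z \<in> I \<times> K" and small: "norm (z - (t, x)) < min d1 (min d2 d3)"
    then obtain s y where z: "z = (s, y)" and s: "s \<in> I" and y: "y \<in> K" by auto
    have ns: "\<bar>s - t\<bar> \<le> norm (z - (t, x))" and ny: "norm (y - x) \<le> norm (z - (t, x))"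
      using norm_fst_le[of "s - t" "y - x"] norm_snd_le[of "y - x" "s - t"] by (simp_all add: z)
    have 1: "\<bar>q s y - q t y - (s - t) * q' y\<bar> \<le> e' * \<bar>s - t\<bar>"
    proof (cases "s = t")
      case False
      have "\<bar>(q s y - q t y) / (s - t) - q' y\<bar> \<le> e'"
        using d1(2)[OF s False _ y] ns small by (simp add: dist_real_def less_imp_le)
      then have "\<bar>((q s y - q t y) / (s - t) - q' y) * (s - t)\<bar> \<le> e' * \<bar>s - t\<bar>"
        unfolding abs_mult by (intro mult_right_mono) auto
      moreover have "((q s y - q t y) / (s - t) - q' y) * (s - t) = q s y - q t y - (s - t) * q' y"
        using False by (subst left_diff_distrib) (simp add: mult.commute)
      ultimately show ?thesis by simp
    qed simp
    have "\<bar>q' y - q' x\<bar> \<le> e'"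
      using d2(2)[OF y] ny small by (simp add: dist_real_def dist_norm less_imp_le)
    then have 2: "\<bar>(s - t) * (q' y - q' x)\<bar> \<le> e' * \<bar>s - t\<bar>"
      unfolding abs_mult by (subst mult.commute) (intro mult_right_mono, auto)
    have 3: "\<bar>q t y - q t x - A (y - x)\<bar> \<le> e' * norm (y - x)"
      using d3(2)[OF y] ny small by simp
    have "q s y - q t x - ((s - t) * q' x + A (y - x))
        = (q s y - q t y - (s - t) * q' y) + (s - t) * (q' y - q' x) + (q t y - q t x - A (y - x))"
      by (simp add: algebra_simps)
    then have "\<bar>q s y - q t x - ((s - t) * q' x + A (y - x))\<bar> \<le> e' * \<bar>s - t\<bar> + e' * \<bar>s - t\<bar> + e' * norm (y - x)"
      using 1 2 3 by linarith
    also have "\<dots> \<le> e' * norm (z - (t, x)) + e' * norm (z - (t, x)) + e' * norm (z - (t, x))"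
      using ns ny e' by (intro add_mono mult_left_mono) auto
    also have "\<dots> = e * norm (z - (t, x))" by (simp add: e'_def)
    finally show "norm (q (fst z) (snd z) - q (fst (t, x)) (snd (t, x))
        - (fst (z - (t, x)) * q' x + A (snd (z - (t, x)))))
        \<le> e * norm (z - (t, x))" by (simp add: z)
  qed (use d1 d2 d3 in simp)
qed

lemma continuous_on_joint:
  fixes q :: "real \<Rightarrow> 'b::metric_space \<Rightarrow> real"
  assumes unif: "\<And>t. t \<in> I \<Longrightarrow> uniform_limit K q (q t) (at t within I)"
    and cont: "\<And>t. t \<in> I \<Longrightarrow> continuous_on K (q t)"
  shows "continuous_on (I \<times> K) (\<lambda>z. q (fst z) (snd z))"
  unfolding continuous_on_iff
proof (intro ballI allI impI)
  fix z :: "real \<times> 'b" and e :: real assume "z \<in> I \<times> K" "e > 0"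
  then obtain t x where z: "z = (t, x)" and t: "t \<in> I" and x: "x \<in> K" by auto
  have e2: "e / 2 > 0" using \<open>e > 0\<close> by simp
  obtain d1 where d1: "d1 > 0" "\<And>s y. s \<in> I \<Longrightarrow> s \<noteq> t \<Longrightarrow> dist s t < d1 \<Longrightarrow> y \<in> K \<Longrightarrow> dist (q s y) (q t y) < e / 2"
    using unif[OF t] e2 unfolding uniform_limit_iff eventually_at by (metis (no_types, lifting))
  obtain d2 where d2: "d2 > 0" "\<And>y. y \<in> K \<Longrightarrow> dist y x < d2 \<Longrightarrow> dist (q t y) (q t x) < e / 2"
    using cont[OF t] x e2 unfolding continuous_on_iff by meson
  show "\<exists>d>0. \<forall>w\<in>I \<times> K. dist w z < d \<longrightarrow> dist (q (fst w) (snd w)) (q (fst z) (snd z)) < e"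
  proof (intro exI[of _ "min d1 d2"] conjI ballI impI)
    fix w assume "w \<in> I \<times> K" and small: "dist w z < min d1 d2"
    then obtain s y where w: "w = (s, y)" and s: "s \<in> I" and y: "y \<in> K" by auto
    have "dist s t < d1" "dist y x < d2"
      using small dist_fst_le[of w z] dist_snd_le[of w z] by (simp_all add: w z)
    then have "dist (q s y) (q t y) < e / 2" "dist (q t y) (q t x) < e / 2"
      using d1(2)[OF s _ _ y] d2(2)[OF y] e2 by (cases "s = t"; simp)+
    then show "dist (q (fst w) (snd w)) (q (fst z) (snd z)) < e"
      using dist_triangle[of "q s y" "q t x" "q t y"] by (simp add: w z)
  qed (use d1 d2 in simp)
qed

section \<open>Directional derivatives, gradients and Hessians within a set\<close>

text \<open>The hypothesis of \<open>frechet_derivative_unique_within\<close>. Steps of one sign are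
  allowed, so it holds at boundary points of a half-space as well as in open sets.\<close>

definition unique_derivs :: "'b::euclidean_space set \<Rightarrow> bool" where
  "unique_derivs S \<longleftrightarrow> (\<forall>x\<in>S. \<forall>i\<in>Basis. \<forall>e>0. \<exists>d. 0 < \<bar>d\<bar> \<and> \<bar>d\<bar> < e \<and> x + d *\<^sub>R i \<in> S)"

definition grad :: "'b::euclidean_space set \<Rightarrow> ('b \<Rightarrow> real) \<Rightarrow> 'b \<Rightarrow> 'b" where
  "grad S f x = (\<Sum>b\<in>Basis. dir_deriv S b f x *\<^sub>R b)"

definition hess :: "'b::euclidean_space set \<Rightarrow> ('b \<Rightarrow> real) \<Rightarrow> 'b \<Rightarrow> 'b \<Rightarrow> 'b" where
  "hess S f x u = (\<Sum>b\<in>Basis. dir_deriv S u (dir_deriv S b f) x *\<^sub>R b)"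

text \<open>The 1-jet as a vector. Its target has the dimension of the space of pairs
  \<open>(t, x)\<close>, as the equidimensional Sard theorem requires.\<close>

definition val_grad :: "'b::euclidean_space set \<Rightarrow> ('b \<Rightarrow> real) \<Rightarrow> 'b \<Rightarrow> real \<times> 'b" where
  "val_grad S f x = (f x, grad S f x)"

lemma dir_deriv_cong:
  assumes "x \<in> S" "\<And>y. y \<in> S \<Longrightarrow> f y = g y"
  shows "dir_deriv S v f x = dir_deriv S v g x"
proof -
  have "(f has_derivative D) (at x within S) \<longleftrightarrow> (g has_derivative D) (at x within S)" for D
  proof
    show "(g has_derivative D) (at x within S)" if "(f has_derivative D) (at x within S)"
      by (rule has_derivative_transform[OF assms(1) _ that]) (rule assms(2)[symmetric])
    show "(f has_derivative D) (at x within S)" if "(g has_derivative D) (at x within S)"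
      by (rule has_derivative_transform[OF assms(1) _ that]) (rule assms(2))
  qed
  then show ?thesis by (simp add: dir_deriv_def frechet_derivative_def)
qed

lemma has_derivative_dir_deriv:
  assumes "f differentiable_on S" "x \<in> S"
  shows "(f has_derivative (\<lambda>v. dir_deriv S v f x)) (at x within S)"
  using assms by (simp add: dir_deriv_def differentiable_on_def frechet_derivative_works)

lemma linear_dir_deriv:
  assumes "f differentiable_on S" "x \<in> S"
  shows "linear (\<lambda>v. dir_deriv S v f x)"
  using has_derivative_dir_deriv[OF assms] by (rule has_derivative_linear)

lemma dir_deriv_Basis:
  fixes f :: "'b::euclidean_space \<Rightarrow> real"
  assumes "f differentiable_on S" "x \<in> S"
  shows "dir_deriv S v f x = (\<Sum>b\<in>Basis. (v \<bullet> b) * dir_deriv S b f x)"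
proof -
  note lin = linear_dir_deriv[OF assms]
  have "dir_deriv S (\<Sum>b\<in>Basis. (v \<bullet> b) *\<^sub>R b) f x = (\<Sum>b\<in>Basis. (v \<bullet> b) * dir_deriv S b f x)"
    using linear_sum[OF lin, of "\<lambda>b. (v \<bullet> b) *\<^sub>R b" Basis] linear_scale[OF lin] by simp
  then show ?thesis by (simp add: euclidean_representation)
qed

lemma grad_inner:
  assumes "f differentiable_on S" "x \<in> S"
  shows "grad S f x \<bullet> v = dir_deriv S v f x"
  unfolding dir_deriv_Basis[OF assms, of v] grad_def inner_sum_left
  by (intro sum.cong) (simp_all add: inner_commute)

lemma differentiable_on_cong_set:
  assumes "f differentiable_on S" "\<And>x. x \<in> S \<Longrightarrow> g x = f x"
  shows "g differentiable_on S"
  unfolding differentiable_on_def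
proof (rule ballI)
  fix x assume x: "x \<in> S"
  have "(g has_derivative (\<lambda>v. dir_deriv S v f x)) (at x within S)"
    by (rule has_derivative_transform[OF x assms(2) has_derivative_dir_deriv[OF assms(1) x]])
  then show "g differentiable (at x within S)" by (rule differentiableI)
qed

lemma C1_on_cong:
  fixes f :: "'b::euclidean_space \<Rightarrow> real"
  assumes "C1_on S f" "\<And>x. x \<in> S \<Longrightarrow> g x = f x"
  shows "C1_on S g"
proof -
  have "g differentiable_on S"
    using assms by (intro differentiable_on_cong_set[of f S g]) (simp_all add: C1_on_def)
  moreover have "continuous_on S (dir_deriv S v g)" for v
  proof (rule continuous_on_eq)
    show "continuous_on S (dir_deriv S v f)" using assms(1) by (simp add: C1_on_def)
    show "dir_deriv S v f x = dir_deriv S v g x" if "x \<in> S" for x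
      by (rule dir_deriv_cong[OF that]) (rule assms(2)[symmetric])
  qed
  ultimately show ?thesis by (simp add: C1_on_def)
qed

lemma C2_onD:
  fixes f :: "'b::euclidean_space \<Rightarrow> real"
  assumes "C2_on S f"
  shows "f differentiable_on S" "dir_deriv S v f differentiable_on S" "continuous_on S f"
    "continuous_on S (dir_deriv S v f)" "continuous_on S (dir_deriv S u (dir_deriv S v f))"
  using assms by (auto simp: C2_on_def C1_on_def intro: differentiable_imp_continuous_on)

context
  fixes S :: "'b::euclidean_space set"
  assumes U: "unique_derivs S"
begin

lemma dir_deriv_eq:
  assumes "x \<in> S" "(f has_derivative D) (at x within S)"
  shows "dir_deriv S v f x = D v"
proof -
  have "f differentiable (at x within S)" using assms(2) by (auto simp: differentiable_def)
  then have "(f has_derivative frechet_derivative f (at x within S)) (at x within S)"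
    by (simp add: frechet_derivative_works)
  then have "frechet_derivative f (at x within S) = D"
    by (rule frechet_derivative_unique_within[OF _ assms(2)])
      (use U assms(1) in \<open>auto simp: unique_derivs_def\<close>)
  then show ?thesis by (simp add: dir_deriv_def)
qed

lemma dir_deriv_sum:
  fixes f :: "'i \<Rightarrow> 'b \<Rightarrow> real"
  assumes "\<And>i. i \<in> F \<Longrightarrow> f i differentiable_on S" "x \<in> S"
  shows "dir_deriv S v (\<lambda>y. \<Sum>i\<in>F. a i * f i y) x = (\<Sum>i\<in>F. a i * dir_deriv S v (f i) x)"
  using assms by (intro dir_deriv_eq has_derivative_sum has_derivative_mult_right has_derivative_dir_deriv)

lemma C1_on_sum:
  fixes f :: "'i \<Rightarrow> 'b \<Rightarrow> real"
  assumes f: "\<And>i. i \<in> F \<Longrightarrow> C1_on S (f i)"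
  shows "C1_on S (\<lambda>y. \<Sum>i\<in>F. a i * f i y)"
proof -
  have d: "f i differentiable_on S" if "i \<in> F" for i using f[OF that] by (simp add: C1_on_def)
  have "continuous_on S (\<lambda>x. \<Sum>i\<in>F. a i * dir_deriv S v (f i) x)" for v
    using f by (intro continuous_on_sum continuous_on_mult_left) (simp add: C1_on_def)
  then have "continuous_on S (dir_deriv S v (\<lambda>y. \<Sum>i\<in>F. a i * f i y))" for v
    by (subst continuous_on_cong[OF refl dir_deriv_sum[OF d]])
  moreover have "(\<lambda>y. \<Sum>i\<in>F. a i * f i y) differentiable_on S"
    unfolding differentiable_on_def
  proof (rule ballI)
    fix x assume x: "x \<in> S"
    have "((\<lambda>y. \<Sum>i\<in>F. a i * f i y) has_derivative (\<lambda>v. \<Sum>i\<in>F. a i * dir_deriv S v (f i) x)) (at x within S)"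
      by (intro has_derivative_sum has_derivative_mult_right has_derivative_dir_deriv[OF d x])
    then show "(\<lambda>y. \<Sum>i\<in>F. a i * f i y) differentiable (at x within S)" by (rule differentiableI)
  qed
  ultimately show ?thesis by (simp add: C1_on_def)
qed

lemma C2_on_sum:
  fixes f :: "'i \<Rightarrow> 'b \<Rightarrow> real"
  assumes f: "\<And>i. i \<in> F \<Longrightarrow> C2_on S (f i)"
  shows "C2_on S (\<lambda>y. \<Sum>i\<in>F. a i * f i y)"
proof -
  have d: "f i differentiable_on S" if "i \<in> F" for i using f[OF that] by (simp add: C2_on_def)
  have "C1_on S (f i)" if "i \<in> F" for i
    using f[OF that] C2_onD[OF f[OF that]] by (simp add: C1_on_def)
  then have "(\<lambda>y. \<Sum>i\<in>F. a i * f i y) differentiable_on S"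
    using C1_on_sum[of F f a] by (simp add: C1_on_def)
  moreover have "C1_on S (dir_deriv S v (\<lambda>y. \<Sum>i\<in>F. a i * f i y))" for v
    using f by (intro C1_on_cong[OF C1_on_sum dir_deriv_sum[OF d]]) (simp_all add: C2_on_def)
  ultimately show ?thesis by (simp add: C2_on_def)
qed

lemma dir_deriv2_sum:
  fixes f :: "'i \<Rightarrow> 'b \<Rightarrow> real"
  assumes f: "\<And>i. i \<in> F \<Longrightarrow> C2_on S (f i)" and x: "x \<in> S"
  shows "dir_deriv S u (dir_deriv S v (\<lambda>y. \<Sum>i\<in>F. a i * f i y)) x
      = (\<Sum>i\<in>F. a i * dir_deriv S u (dir_deriv S v (f i)) x)"
proof -
  have "dir_deriv S u (dir_deriv S v (\<lambda>y. \<Sum>i\<in>F. a i * f i y)) x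
      = dir_deriv S u (\<lambda>y. \<Sum>i\<in>F. a i * dir_deriv S v (f i) y) x"
    by (intro dir_deriv_cong[OF x] dir_deriv_sum C2_onD(1)[OF f])
  also have "\<dots> = (\<Sum>i\<in>F. a i * dir_deriv S u (dir_deriv S v (f i)) x)"
    by (intro dir_deriv_sum C2_onD(2)[OF f] x)
  finally show ?thesis .
qed

lemma C2_on_lincomb:
  fixes f g :: "'b \<Rightarrow> real"
  assumes "C2_on S f" "C2_on S g"
  shows "C2_on S (\<lambda>y. a * f y + b * g y)"
  using C2_on_sum[of "UNIV :: bool set" "\<lambda>i. if i then f else g" "\<lambda>i. if i then a else b"] assms
  by (simp add: UNIV_bool add.commute)

lemma dir_deriv_lincomb:
  fixes f g :: "'b \<Rightarrow> real"
  assumes "f differentiable_on S" "g differentiable_on S" "x \<in> S"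
  shows "dir_deriv S v (\<lambda>y. a * f y + b * g y) x = a * dir_deriv S v f x + b * dir_deriv S v g x"
  using dir_deriv_sum[of "UNIV :: bool set" "\<lambda>i. if i then f else g" x v "\<lambda>i. if i then a else b"] assms
  by (simp add: UNIV_bool add.commute)

lemma dir_deriv2_lincomb:
  fixes f g :: "'b \<Rightarrow> real"
  assumes "C2_on S f" "C2_on S g" "x \<in> S"
  shows "dir_deriv S u (dir_deriv S v (\<lambda>y. a * f y + b * g y)) x
    = a * dir_deriv S u (dir_deriv S v f) x + b * dir_deriv S u (dir_deriv S v g) x"
  using dir_deriv2_sum[of "UNIV :: bool set" "\<lambda>i. if i then f else g" x u v "\<lambda>i. if i then a else b"] assms
  by (simp add: UNIV_bool add.commute)

lemma hess_inner:
  fixes f :: "'b \<Rightarrow> real"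
  assumes f: "C2_on S f" and x: "x \<in> S"
  shows "hess S f x u \<bullet> v = dir_deriv S u (dir_deriv S v f) x"
proof -
  have "dir_deriv S u (dir_deriv S v f) x = dir_deriv S u (\<lambda>y. \<Sum>b\<in>Basis. (v \<bullet> b) * dir_deriv S b f y) x"
    by (intro dir_deriv_cong[OF x] dir_deriv_Basis C2_onD(1)[OF f])
  also have "\<dots> = (\<Sum>b\<in>Basis. (v \<bullet> b) * dir_deriv S u (dir_deriv S b f) x)"
    by (intro dir_deriv_sum C2_onD(2)[OF f] x)
  also have "\<dots> = hess S f x u \<bullet> v"
    unfolding hess_def inner_sum_left by (intro sum.cong) (simp_all add: inner_commute)
  finally show ?thesis ..
qed

lemma linear_hess:
  fixes f :: "'b \<Rightarrow> real"
  assumes f: "C2_on S f" and x: "x \<in> S"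
  shows "linear (hess S f x)"
proof -
  note lin = linear_dir_deriv[OF C2_onD(2)[OF f] x]
  show ?thesis
    by (rule linearI)
      (simp_all only: hess_def linear_add[OF lin] linear_scale[OF lin] scaleR_add_left sum.distrib
        scaleR_sum_right real_scaleR_def scaleR_scaleR)
qed

end

lemma unique_derivs_open: "open S \<Longrightarrow> unique_derivs S"
  unfolding unique_derivs_def
proof (intro ballI allI impI)
  fix x i :: 'a and e :: real assume "open S" "x \<in> S" "i \<in> Basis" "e > 0"
  then obtain r where r: "r > 0" "ball x r \<subseteq> S" by (meson open_contains_ball)
  define d where "d = min r e / 2"
  have "d > 0" "d < r" "d < e" using r \<open>e > 0\<close> by (auto simp: d_def)
  moreover have "x + d *\<^sub>R i \<in> ball x r"
    using calculation \<open>i \<in> Basis\<close> by (simp add: dist_norm)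
  ultimately show "\<exists>d. 0 < \<bar>d\<bar> \<and> \<bar>d\<bar> < e \<and> x + d *\<^sub>R i \<in> S"
    using r by (intro exI[of _ d]) auto
qed

lemma unique_derivs_half_space:
  fixes S :: "(real \<times> 'e::euclidean_space) set"
  assumes "openin (top_of_set half_space) S"
  shows "unique_derivs S"
  unfolding unique_derivs_def
proof (intro ballI allI impI)
  fix x i :: "real \<times> 'e" and e :: real assume x: "x \<in> S" and i: "i \<in> Basis" and e: "e > 0"
  obtain O1 where O1: "open O1" "S = half_space \<inter> O1" using assms by (auto simp: openin_open)
  then obtain r where r: "r > 0" "ball x r \<subseteq> O1" using x by (meson IntD2 open_contains_ball)
  define d where "d = min r e / 2"
  have d: "d > 0" "d < r" "d < e" using r e by (auto simp: d_def)
  \<comment> \<open>Positive steps along basis vectors never leave the half-space.\<close>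
  have "fst i \<ge> 0" using i by (auto simp: Basis_prod_def)
  then have "x + d *\<^sub>R i \<in> half_space" using x O1 d by (simp add: half_space_def)
  moreover have "x + d *\<^sub>R i \<in> ball x r"
    using d i by (simp add: dist_norm)
  ultimately show "\<exists>d. 0 < \<bar>d\<bar> \<and> \<bar>d\<bar> < e \<and> x + d *\<^sub>R i \<in> S"
    using r O1 d by (intro exI[of _ d]) auto
qed

section \<open>Curves of functions and the map from time and position to the 1-jet\<close>

text \<open>Differentiability in time is asked of the 1-jet, the map to which Sard is applied;
  continuity in time is asked of second derivatives and of the velocity, which enter the defect
  function.\<close>

definition C1_curve_on :: "'b::euclidean_space set \<Rightarrow> real set \<Rightarrow> (real \<Rightarrow> 'b \<Rightarrow> real) \<Rightarrow> (real \<Rightarrow> 'b \<Rightarrow> real) \<Rightarrow>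
    bool" where
  "C1_curve_on S I c c' \<longleftrightarrow> (\<forall>t\<in>I. C2_on S (c t) \<and> C2_on S (c' t))
    \<and> (\<forall>K t. compact K \<and> K \<subseteq> S \<and> t \<in> I \<longrightarrow>
        uniform_limit K (\<lambda>s x. (c s x - c t x) / (s - t)) (c' t) (at t within I)
      \<and> (\<forall>v. uniform_limit K (\<lambda>s x. (dir_deriv S v (c s) x - dir_deriv S v (c t) x) / (s - t))
              (dir_deriv S v (c' t)) (at t within I))
      \<and> (\<forall>u v. uniform_limit K (\<lambda>s x. dir_deriv S u (dir_deriv S v (c s)) x)
          (dir_deriv S u (dir_deriv S v (c t))) (at t within I))
      \<and> uniform_limit K c' (c' t) (at t within I))"

text \<open>\<open>has_derivative_joint\<close> is applied to the value and to each partial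
  derivative. Where the gradient vanishes, the first component of the result is
  \<open>fst z * c' t x\<close>, and the restriction to \<open>fst z = 0\<close> is the Hessian: the
  block triangular form on which all nondegeneracy rests.\<close>

lemma has_derivative_val_grad_joint:
  fixes S :: "'b::euclidean_space set"
  assumes U: "unique_derivs S" and c: "C1_curve_on S I c c'" and f: "C2_on S f"
    and K: "compact K" "K \<subseteq> S" and t: "t \<in> I" and x: "x \<in> K"
  shows "((\<lambda>z. val_grad S (\<lambda>y. c (fst z) y + f y) (snd z)) has_derivative
    (\<lambda>z. fst z *\<^sub>R val_grad S (c' t) x
       + (grad S (\<lambda>y. c t y + f y) x \<bullet> snd z, hess S (\<lambda>y. c t y + f y) x (snd z)))) (at (t, x) within I \<times> K)"
proof -
  define g where "g s y = c s y + f y" for s y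
  have C2c: "C2_on S (c s)" "C2_on S (c' s)" if "s \<in> I" for s using c that by (simp_all add: C1_curve_on_def)
  have C2g: "C2_on S (g s)" if "s \<in> I" for s
    using C2_on_lincomb[OF U C2c(1)[OF that] f, of 1 1] by (simp add: g_def[abs_def])
  have xS: "x \<in> S" using x K by auto
  have ddg: "dir_deriv S v (g s) y = dir_deriv S v (c s) y + dir_deriv S v f y" if "s \<in> I" "y \<in> S" for s y v
    using dir_deriv_lincomb[OF U C2_onD(1)[OF C2c(1)[OF that(1)]] C2_onD(1)[OF f] that(2), of v 1 1]
    by (simp add: g_def[abs_def])
  have 0: "((\<lambda>z. g (fst z) (snd z)) has_derivative (\<lambda>z. fst z * c' t x + grad S (g t) x \<bullet> snd z)) (at (t,
      x) within I \<times> K)"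
  proof (rule has_derivative_joint[OF t x])
    show "uniform_limit K (\<lambda>s y. (g s y - g t y) / (s - t)) (c' t) (at t within I)"
      using c K t by (simp add: C1_curve_on_def g_def)
    show "continuous_on K (c' t)" using C2_onD(3)[OF C2c(2)[OF t]] K by (blast intro: continuous_on_subset)
    have "(g t has_derivative (\<lambda>v. grad S (g t) x \<bullet> v)) (at x within S)"
      using has_derivative_dir_deriv[OF C2_onD(1)[OF C2g[OF t]] xS]
      by (simp add: grad_inner[OF C2_onD(1)[OF C2g[OF t]] xS])
    then show "(g t has_derivative (\<lambda>v. grad S (g t) x \<bullet> v)) (at x within K)"
      using K by (rule_tac has_derivative_subset)
  qed
  have 1: "((\<lambda>z. dir_deriv S b (g (fst z)) (snd z)) has_derivative
      (\<lambda>z. fst z * dir_deriv S b (c' t) x + dir_deriv S (snd z) (dir_deriv S b (g t)) x))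
          (at (t, x) within I \<times> K)" for b
  proof (rule has_derivative_joint[OF t x])
    have "uniform_limit K (\<lambda>s x. (dir_deriv S b (c s) x - dir_deriv S b (c t) x) / (s
        - t)) (dir_deriv S b (c' t)) (at t within I)"
      using c K t by (simp add: C1_curve_on_def)
    then show "uniform_limit K (\<lambda>s y. (dir_deriv S b (g s) y - dir_deriv S b (g t) y) / (s
        - t)) (dir_deriv S b (c' t)) (at t within I)"
    proof (rule uniform_limit_cong[THEN iffD1, rotated 2])
      have "\<forall>\<^sub>F s in at t within I. s \<in> I" by (auto simp: eventually_at_filter)
      then show "\<forall>\<^sub>F s in at t within I. \<forall>y\<in>K. (dir_deriv S b (c s) y - dir_deriv S b (c t) y) / (s - t)
          = (dir_deriv S b (g s) y - dir_deriv S b (g t) y) / (s - t)"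
      proof (rule eventually_mono, intro ballI)
        fix s y assume "s \<in> I" "y \<in> K"
        then have "y \<in> S" using K by blast
        then show "(dir_deriv S b (c s) y - dir_deriv S b (c t) y) / (s - t)
          = (dir_deriv S b (g s) y - dir_deriv S b (g t) y) / (s - t)"
          using ddg[OF \<open>s \<in> I\<close>] ddg[OF t] by simp
      qed
    qed simp
    show "continuous_on K (dir_deriv S b (c' t))" using C2_onD(4)[OF C2c(2)[OF t]] K
        by (blast intro: continuous_on_subset)
    show "(dir_deriv S b (g t) has_derivative (\<lambda>v. dir_deriv S v (dir_deriv S b (g t)) x)) (at x within K)"
      using has_derivative_subset[OF has_derivative_dir_deriv[OF C2_onD(2)[OF C2g[OF t]] xS] K(2)] .
  qed
  have "((\<lambda>z. (g (fst z) (snd z), \<Sum>b\<in>Basis. dir_deriv S b (g (fst z)) (snd z) *\<^sub>R b)) has_derivative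
      (\<lambda>z. (fst z * c' t x + grad S (g t) x \<bullet> snd z,
        \<Sum>b\<in>Basis. (fst z * dir_deriv S b (c' t) x + dir_deriv S (snd z) (dir_deriv S b (g t)) x) *\<^sub>R b)))
            (at (t, x) within I \<times> K)"
    by (intro has_derivative_Pair 0 has_derivative_sum has_derivative_scaleR_left 1)
  moreover have "val_grad S (\<lambda>y. c (fst z) y + f y) (snd z)
      = (g (fst z) (snd z), \<Sum>b\<in>Basis. dir_deriv S b (g (fst z)) (snd z) *\<^sub>R b)" for z
    by (simp only: val_grad_def grad_def g_def[abs_def])
  moreover have "fst z *\<^sub>R val_grad S (c' t) x
      + (grad S (\<lambda>y. c t y + f y) x \<bullet> snd z, hess S (\<lambda>y. c t y + f y) x (snd z))
      = (fst z * c' t x + grad S (g t) x \<bullet> snd z,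
        \<Sum>b\<in>Basis. (fst z * dir_deriv S b (c' t) x + dir_deriv S (snd z) (dir_deriv S b (g t)) x) *\<^sub>R b)" for z
  proof -
    have "fst z *\<^sub>R grad S (c' t) x + hess S (g t) x (snd z)
        = (\<Sum>b\<in>Basis. (fst z * dir_deriv S b (c' t) x + dir_deriv S (snd z) (dir_deriv S b (g t)) x) *\<^sub>R b)"
      unfolding grad_def hess_def scaleR_sum_right sum.distrib[symmetric] scaleR_add_left scaleR_scaleR ..
    then show ?thesis by (simp add: val_grad_def g_def[abs_def])
  qed
  ultimately show ?thesis by simp
qed

lemma difference_quotient_tendsto:
  fixes f :: "'b::real_normed_vector \<Rightarrow> real"
  assumes f: "(f has_derivative D) (at x within S)"
    and d: "d \<longlonglongrightarrow> 0" "\<And>n. d n \<noteq> 0" "\<And>n. x + d n *\<^sub>R b \<in> S"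
  shows "(\<lambda>n. (f (x + d n *\<^sub>R b) - f x) / d n) \<longlonglongrightarrow> D b"
proof -
  \<comment> \<open>Restricting to the steps actually taken keeps \<open>x + s *\<^sub>R b\<close>
    in \<open>S\<close>, and reduces the claim to a derivative in one real variable within
    \<open>T\<close>.\<close>
  define T where "T = range d"
  have "((\<lambda>s. x + s *\<^sub>R b) has_derivative (\<lambda>s. s *\<^sub>R b)) (at 0 within T)"
    by (auto intro!: derivative_eq_intros)
  moreover have "(f has_derivative D) (at (x + 0 *\<^sub>R b) within (\<lambda>s. x + s *\<^sub>R b) ` T)"
    by (rule has_derivative_subset) (use f d(3) in \<open>auto simp: T_def\<close>)
  ultimately have "(f \<circ> (\<lambda>s. x + s *\<^sub>R b) has_derivative D \<circ> (\<lambda>s. s *\<^sub>R b)) (at 0 within T)"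
    by (rule diff_chain_within)
  moreover have "D \<circ> (\<lambda>s. s *\<^sub>R b) = (*) (D b)"
    using has_derivative_linear[OF f] by (auto simp: linear_scale)
  ultimately have "((\<lambda>s. f (x + s *\<^sub>R b)) has_field_derivative D b) (at 0 within T)"
    by (simp add: has_field_derivative_def comp_def)
  then have "((\<lambda>s. (f (x + s *\<^sub>R b) - f x) / s) \<longlongrightarrow> D b) (at 0 within T)"
    by (simp add: has_field_derivative_iff)
  then show ?thesis
    using d(1,2) unfolding tendsto_at_iff_sequentially by (auto simp: T_def comp_def)
qed

lemma unique_derivs_sequence:
  assumes "unique_derivs S" "x \<in> S" "b \<in> Basis"
  obtains d where "d \<longlonglongrightarrow> 0" "\<And>n. d n \<noteq> (0::real)" "\<And>n. x + d n *\<^sub>R b \<in> S"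
proof -
  have "\<exists>d. 0 < \<bar>d\<bar> \<and> \<bar>d\<bar> < inverse (real (Suc n)) \<and> x + d *\<^sub>R b \<in> S" for n
    using assms by (simp add: unique_derivs_def)
  then obtain d where d: "\<And>n. 0 < \<bar>d n\<bar>" "\<And>n. \<bar>d n\<bar> < inverse (real (Suc n))" "\<And>n. x + d n *\<^sub>R b \<in> S"
    by metis
  have "d \<longlonglongrightarrow> 0"
    by (rule Lim_null_comparison[OF always_eventually LIMSEQ_inverse_real_of_nat])
      (simp only: real_norm_def less_imp_le[OF d(2)] simp_thms)
  then show thesis using d(1,3) that by (metis abs_zero less_irrefl)
qed

section \<open>Derivatives of the field and of its covariances\<close>

context gaussian_space begin

text \<open>Along basis vectors the derivative is a pointwise limit of difference quotients in
  \<open>V\<close>, with steps that stay in \<open>S\<close>; other directions are linear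
  combinations.\<close>

lemma dir_deriv_in_V:
  fixes Y :: "'w \<Rightarrow> 'b::euclidean_space \<Rightarrow> real"
  assumes U: "unique_derivs S" and dif: "\<And>\<omega>. Y \<omega> differentiable_on S"
    and V: "\<And>x. x \<in> S \<Longrightarrow> (\<lambda>\<omega>. Y \<omega> x) \<in> V" and x: "x \<in> S"
  shows "(\<lambda>\<omega>. dir_deriv S v (Y \<omega>) x) \<in> V"
proof -
  have B: "(\<lambda>\<omega>. dir_deriv S b (Y \<omega>) x) \<in> V" if b: "b \<in> Basis" for b
  proof -
    obtain d where d: "d \<longlonglongrightarrow> 0" "\<And>n. d n \<noteq> (0::real)" "\<And>n. x + d n *\<^sub>R b \<in> S"
      using unique_derivs_sequence[OF U x b] by blast
    have lim: "(\<lambda>n. (Y \<omega> (x + d n *\<^sub>R b) - Y \<omega> x) / d n) \<longlonglongrightarrow> dir_deriv S b (Y \<omega>) x" for \<omega>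
      by (rule difference_quotient_tendsto[OF has_derivative_dir_deriv[OF dif x] d])
    have q: "(\<lambda>\<omega>. (Y \<omega> (x + d n *\<^sub>R b) - Y \<omega> x) / d n) \<in> V" for n
      using scale[OF diff[OF V[OF d(3)[of n]] V[OF x]], of "1 / d n"] by simp
    have "(\<lambda>\<omega>. dir_deriv S b (Y \<omega>) x) \<in> borel_measurable P"
      by (rule borel_measurable_LIMSEQ_real[OF lim measurable_V[OF q]])
    then show ?thesis
      using limit[where U = "\<lambda>n \<omega>. (Y \<omega> (x + d n *\<^sub>R b) - Y \<omega> x) / d n", OF q] lim by simp
  qed
  show ?thesis
    unfolding dir_deriv_Basis[OF dif x, of v] by (intro sum scale B)
qed

lemma covariance_continuous:
  fixes Y :: "'w \<Rightarrow> 'b::metric_space \<Rightarrow> real"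
  assumes cont: "\<And>\<omega>. continuous_on S (Y \<omega>)" and V: "\<And>x. x \<in> S \<Longrightarrow> (\<lambda>\<omega>. Y \<omega> x) \<in> V" and \<xi>: "\<xi> \<in> V"
  shows "continuous_on S (\<lambda>x. expectation (\<lambda>\<omega>. Y \<omega> x * \<xi> \<omega>))"
  unfolding continuous_on_sequentially
proof (intro allI ballI impI)
  fix X x assume x: "x \<in> S" and X: "(\<forall>n. X n \<in> S) \<and> X \<longlonglongrightarrow> x"
  have "(\<lambda>n. expectation (\<lambda>\<omega>. (Y \<omega> (X n) - Y \<omega> x) * \<xi> \<omega>)) \<longlonglongrightarrow> 0"
  proof (rule covariance_tendsto_0[OF _ AE_I2 \<xi>])
    show "(\<lambda>\<omega>. Y \<omega> (X n) - Y \<omega> x) \<in> V" for n using X x by (intro diff V) auto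
    fix \<omega>
    have "(\<lambda>n. Y \<omega> (X n)) \<longlonglongrightarrow> Y \<omega> x"
      using cont[of \<omega>] x X unfolding continuous_on_sequentially comp_def by blast
    then show "(\<lambda>n. Y \<omega> (X n) - Y \<omega> x) \<longlonglongrightarrow> 0" by (rule LIM_zero)
  qed
  moreover have "expectation (\<lambda>\<omega>. (Y \<omega> (X n) - Y \<omega> x) * \<xi> \<omega>)
      = expectation (\<lambda>\<omega>. Y \<omega> (X n) * \<xi> \<omega>) - expectation (\<lambda>\<omega>. Y \<omega> x * \<xi> \<omega>)" for n
    using integrable_mult[OF V \<xi>, of "X n"] integrable_mult[OF V \<xi>, of x] X x by (simp add: left_diff_distrib)
  ultimately show "((\<lambda>x. expectation (\<lambda>\<omega>. Y \<omega> x * \<xi> \<omega>)) \<circ> X) \<longlonglongrightarrow> expectation (\<lambda>\<omega>. Y \<omega> x * \<xi> \<omega>)"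
    by (simp add: comp_def LIM_zero_iff)
qed

text \<open>Differentiation under the expectation: the normalized remainder belongs to
  \<open>V\<close> and tends to 0 for every outcome, so its covariance with \<xi> tends to 0 by
  \<open>covariance_tendsto_0\<close>.\<close>

lemma covariance_has_derivative:
  fixes Y :: "'w \<Rightarrow> 'b::euclidean_space \<Rightarrow> real"
  assumes U: "unique_derivs S" and dif: "\<And>\<omega>. Y \<omega> differentiable_on S"
    and V: "\<And>x. x \<in> S \<Longrightarrow> (\<lambda>\<omega>. Y \<omega> x) \<in> V" and \<xi>: "\<xi> \<in> V" and x: "x \<in> S"
  shows "((\<lambda>x. expectation (\<lambda>\<omega>. Y \<omega> x * \<xi> \<omega>)) has_derivative
    (\<lambda>v. expectation (\<lambda>\<omega>. dir_deriv S v (Y \<omega>) x * \<xi> \<omega>))) (at x within S)"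
  unfolding has_derivative_within
proof (intro conjI)
  have DV: "(\<lambda>\<omega>. dir_deriv S v (Y \<omega>) x) \<in> V" for v by (rule dir_deriv_in_V[OF U dif V x])
  note iD = integrable_mult[OF DV \<xi>]
  note lin = linear_dir_deriv[OF dif x]
  have "linear (\<lambda>v. expectation (\<lambda>\<omega>. dir_deriv S v (Y \<omega>) x * \<xi> \<omega>))"
    by (rule linearI) (simp_all add: linear_add[OF lin] linear_scale[OF lin] distrib_right mult.assoc iD)
  then show "bounded_linear (\<lambda>v. expectation (\<lambda>\<omega>. dir_deriv S v (Y \<omega>) x * \<xi> \<omega>))"
    by (simp add: linear_conv_bounded_linear)
  show "((\<lambda>y. (1 / norm (y - x)) *\<^sub>R (expectation (\<lambda>\<omega>. Y \<omega> y * \<xi> \<omega>) -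
      (expectation (\<lambda>\<omega>. Y \<omega> x * \<xi> \<omega>) + expectation (\<lambda>\<omega>. dir_deriv S (y - x) (Y \<omega>) x * \<xi> \<omega>)))) \<longlongrightarrow> 0) (at x within S)"
    unfolding tendsto_at_iff_sequentially
  proof (intro allI impI)
    fix X assume X: "\<forall>i. X i \<in> S - {x}" "X \<longlonglongrightarrow> x"
    define R where "R n \<omega> = (1 / norm (X n - x)) * (Y \<omega> (X n) - (Y \<omega> x + dir_deriv S (X n - x) (Y \<omega>) x))" for n \<omega>
    have XS: "X n \<in> S" for n using X(1) by blast
    have "(\<lambda>n. expectation (\<lambda>\<omega>. R n \<omega> * \<xi> \<omega>)) \<longlonglongrightarrow> 0"
    proof (rule covariance_tendsto_0[OF _ AE_I2 \<xi>])
      show "R n \<in> V" for n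
        unfolding R_def[abs_def] by (intro scale diff add V XS x DV)
      fix \<omega>
      have "((\<lambda>y. (1 / norm (y - x)) *\<^sub>R (Y \<omega> y - (Y \<omega> x + dir_deriv S (y - x) (Y \<omega>) x))) \<longlongrightarrow> 0) (at x within S)"
        using has_derivative_dir_deriv[OF dif x, of \<omega>] unfolding has_derivative_within by blast
      then have "((\<lambda>y. (1 / norm (y - x)) *\<^sub>R (Y \<omega> y - (Y \<omega> x + dir_deriv S (y - x) (Y \<omega>) x))) \<circ> X) \<longlonglongrightarrow> 0"
        using X unfolding tendsto_at_iff_sequentially by blast
      then show "(\<lambda>n. R n \<omega>) \<longlonglongrightarrow> 0" by (simp add: R_def comp_def)
    qed
    moreover have "expectation (\<lambda>\<omega>. R n \<omega> * \<xi> \<omega>) = (1 / norm (X n - x)) *\<^sub>R (expectation (\<lambda>\<omega>. Y \<omega> (X n) * \<xi> \<omega>) -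
      (expectation (\<lambda>\<omega>. Y \<omega> x * \<xi> \<omega>) + expectation (\<lambda>\<omega>. dir_deriv S (X n - x) (Y \<omega>) x * \<xi> \<omega>)))" for n
    proof -
      have "R n \<omega> * \<xi> \<omega> = (1 / norm (X n - x))
          * (Y \<omega> (X n) * \<xi> \<omega> - (Y \<omega> x * \<xi> \<omega> + dir_deriv S (X n - x) (Y \<omega>) x * \<xi> \<omega>))" for \<omega>
        unfolding R_def by (simp only: mult.assoc left_diff_distrib distrib_right)
      then show ?thesis
        using integrable_mult[OF V[OF XS] \<xi>, of n] integrable_mult[OF V[OF x] \<xi>] iD by simp
    qed
    ultimately show "((\<lambda>y. (1 / norm (y - x)) *\<^sub>R (expectation (\<lambda>\<omega>. Y \<omega> y * \<xi> \<omega>) -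
      (expectation (\<lambda>\<omega>. Y \<omega> x * \<xi> \<omega>) + expectation (\<lambda>\<omega>. dir_deriv S (y - x) (Y \<omega>) x * \<xi> \<omega>)))) \<circ> X) \<longlonglongrightarrow> 0"
      by (simp add: comp_def)
  qed
qed

lemma covariance_dir_deriv:
  fixes Y :: "'w \<Rightarrow> 'b::euclidean_space \<Rightarrow> real"
  assumes U: "unique_derivs S" and diff: "\<And>\<omega>. Y \<omega> differentiable_on S"
    and V: "\<And>x. x \<in> S \<Longrightarrow> (\<lambda>\<omega>. Y \<omega> x) \<in> V" and \<xi>: "\<xi> \<in> V" and x: "x \<in> S"
  shows "dir_deriv S v (\<lambda>x. expectation (\<lambda>\<omega>. Y \<omega> x * \<xi> \<omega>)) x = expectation (\<lambda>\<omega>. dir_deriv S v (Y \<omega>) x * \<xi> \<omega>)"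
  by (rule dir_deriv_eq[OF U x covariance_has_derivative[OF assms]])

lemma covariance_C1_on:
  fixes Y :: "'w \<Rightarrow> 'b::euclidean_space \<Rightarrow> real"
  assumes U: "unique_derivs S" and C1: "\<And>\<omega>. C1_on S (Y \<omega>)"
    and V: "\<And>x. x \<in> S \<Longrightarrow> (\<lambda>\<omega>. Y \<omega> x) \<in> V" and \<xi>: "\<xi> \<in> V"
  shows "C1_on S (\<lambda>x. expectation (\<lambda>\<omega>. Y \<omega> x * \<xi> \<omega>))"
  unfolding C1_on_def
proof (intro conjI allI)
  have diff: "Y \<omega> differentiable_on S" for \<omega> using C1[of \<omega>] by (simp add: C1_on_def)
  show "(\<lambda>x. expectation (\<lambda>\<omega>. Y \<omega> x * \<xi> \<omega>)) differentiable_on S"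
    unfolding differentiable_on_def
    by (intro ballI differentiableI[OF covariance_has_derivative[OF U diff V \<xi>]])
  fix v
  have cd: "continuous_on S (dir_deriv S v (Y \<omega>))" for \<omega> using C1[of \<omega>] by (simp add: C1_on_def)
  have "continuous_on S (\<lambda>x. expectation (\<lambda>\<omega>. dir_deriv S v (Y \<omega>) x * \<xi> \<omega>))"
    by (rule covariance_continuous[OF cd dir_deriv_in_V[OF U diff V] \<xi>])
  then show "continuous_on S (dir_deriv S v (\<lambda>x. expectation (\<lambda>\<omega>. Y \<omega> x * \<xi> \<omega>)))"
    by (rule continuous_on_eq) (rule covariance_dir_deriv[OF U diff V \<xi>, symmetric])
qed

lemma covariance_C2_on:
  fixes Y :: "'w \<Rightarrow> 'b::euclidean_space \<Rightarrow> real"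
  assumes U: "unique_derivs S" and C2: "\<And>\<omega>. C2_on S (Y \<omega>)"
    and V: "\<And>x. x \<in> S \<Longrightarrow> (\<lambda>\<omega>. Y \<omega> x) \<in> V" and \<xi>: "\<xi> \<in> V"
  shows "C2_on S (\<lambda>x. expectation (\<lambda>\<omega>. Y \<omega> x * \<xi> \<omega>))"
    and "\<And>x u v. x \<in> S \<Longrightarrow> dir_deriv S u (dir_deriv S v (\<lambda>x. expectation (\<lambda>\<omega>. Y \<omega> x * \<xi> \<omega>))) x
      = expectation (\<lambda>\<omega>. dir_deriv S u (dir_deriv S v (Y \<omega>)) x * \<xi> \<omega>)"
proof -
  note diff = C2_onD(1)[OF C2] and diff' = C2_onD(2)[OF C2]
  have C1: "C1_on S (Y \<omega>)" "C1_on S (dir_deriv S v (Y \<omega>))" for \<omega> v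
    using C2[of \<omega>] C2_onD[OF C2[of \<omega>]] by (simp_all add: C1_on_def C2_on_def)
  note DV = dir_deriv_in_V[OF U diff V]
  show "C2_on S (\<lambda>x. expectation (\<lambda>\<omega>. Y \<omega> x * \<xi> \<omega>))"
    unfolding C2_on_def
  proof (intro conjI allI)
    show "(\<lambda>x. expectation (\<lambda>\<omega>. Y \<omega> x * \<xi> \<omega>)) differentiable_on S"
      using covariance_C1_on[OF U C1(1) V \<xi>] by (simp add: C1_on_def)
    show "C1_on S (dir_deriv S v (\<lambda>x. expectation (\<lambda>\<omega>. Y \<omega> x * \<xi> \<omega>)))" for v
      by (rule C1_on_cong[OF covariance_C1_on[OF U C1(2) DV \<xi>] covariance_dir_deriv[OF U diff V \<xi>]])
  qed
  fix x u v assume x: "x \<in> S"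
  have "dir_deriv S u (dir_deriv S v (\<lambda>x. expectation (\<lambda>\<omega>. Y \<omega> x * \<xi> \<omega>))) x
      = dir_deriv S u (\<lambda>x. expectation (\<lambda>\<omega>. dir_deriv S v (Y \<omega>) x * \<xi> \<omega>)) x"
    by (rule dir_deriv_cong[OF x covariance_dir_deriv[OF U diff V \<xi>]])
  also have "\<dots> = expectation (\<lambda>\<omega>. dir_deriv S u (dir_deriv S v (Y \<omega>)) x * \<xi> \<omega>)"
    by (rule covariance_dir_deriv[OF U diff' DV \<xi> x])
  finally show "dir_deriv S u (dir_deriv S v (\<lambda>x. expectation (\<lambda>\<omega>. Y \<omega> x * \<xi> \<omega>))) x
      = expectation (\<lambda>\<omega>. dir_deriv S u (dir_deriv S v (Y \<omega>)) x * \<xi> \<omega>)" .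
qed

end

section \<open>Jets as families of real coordinates\<close>

text \<open>Values and derivatives up to order 2 as a point of one product space, so that the
  translation results apply to all of them at once. The list gives the directions in the order of
  differentiation. The default 0, outside \<open>S\<close> and for longer lists, keeps every
  coordinate of the random jet in \<open>V\<close>.\<close>

fun jet :: "'b::euclidean_space set \<Rightarrow> ('b \<Rightarrow> real) \<Rightarrow> 'b \<times> 'b list \<Rightarrow> real" where
  "jet S f (x, []) = (if x \<in> S then f x else 0)"
| "jet S f (x, [v]) = (if x \<in> S then dir_deriv S v f x else 0)"
| "jet S f (x, [v, u]) = (if x \<in> S then dir_deriv S u (dir_deriv S v f) x else 0)"
| "jet S f (x, _ # _ # _ # _) = 0"

lemma jet_cases:
  obtains x where "i = (x, [])" | x v where "i = (x, [v])" | x v u where "i = (x, [v, u])"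
  | x v u w vs where "i = (x, v # u # w # vs)"
  by (metis list.exhaust surj_pair)

section \<open>Nondegeneracy of critical zeros\<close>

text \<open>A nonnegative function of \<open>(t, x, u)\<close> and of the jet \<open>w\<close> of a field \<open>f\<close>, continuous in
  \<open>(t, x, u)\<close>. It vanishes iff \<open>c t + f\<close> has a critical zero at \<open>x\<close> where, in addition,
  \<open>\<rho> t x = 0\<close> or \<open>u\<close> is in the kernel of the Hessian.\<close>

definition defect :: "'b::euclidean_space set \<Rightarrow> (real \<Rightarrow> 'b \<Rightarrow> real) \<Rightarrow> (real \<Rightarrow> 'b \<Rightarrow> real)
    \<Rightarrow> ('b \<times> 'b list \<Rightarrow> real) \<Rightarrow> real \<times> 'b \<times> 'b \<Rightarrow> real" where
  "defect S c \<rho> w z = (let t = fst z; x = fst (snd z); u = snd (snd z) in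
     \<bar>c t x + w (x, [])\<bar> + (\<Sum>b\<in>Basis. \<bar>dir_deriv S b (c t) x + w (x, [b])\<bar>)
     + \<bar>\<rho> t x\<bar> * (\<Sum>b\<in>Basis. \<bar>\<Sum>a\<in>Basis. (u \<bullet> a) * (dir_deriv S a (dir_deriv S b (c t)) x + w (x, [b, a]))\<bar>))"

lemma val_grad_inner:
  assumes "f differentiable_on S" "x \<in> S"
  shows "val_grad S f x \<bullet> \<eta> = fst \<eta> * f x + dir_deriv S (snd \<eta>) f x"
  by (simp add: val_grad_def inner_prod_def grad_inner[OF assms] mult.commute)

lemma defect_nonneg: "defect S c \<rho> w z \<ge> 0"
  unfolding defect_def Let_def by (intro add_nonneg_nonneg mult_nonneg_nonneg sum_nonneg abs_ge_zero)

lemma defect_jet: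
  fixes S :: "'b::euclidean_space set"
  assumes U: "unique_derivs S" and c: "C2_on S (c t)" and f: "C2_on S f" and x: "x \<in> S"
  shows "defect S c \<rho> (jet S f) (t, x, u) = \<bar>fst (val_grad S (\<lambda>y. c t y + f y) x)\<bar>
    + (\<Sum>b\<in>Basis. \<bar>snd (val_grad S (\<lambda>y. c t y + f y) x) \<bullet> b\<bar>)
    + \<bar>\<rho> t x\<bar> * (\<Sum>b\<in>Basis. \<bar>hess S (\<lambda>y. c t y + f y) x u \<bullet> b\<bar>)"
proof -
  define g where "g y = c t y + f y" for y
  have g: "C2_on S g" using C2_on_lincomb[OF U c f, of 1 1] by (simp add: g_def[abs_def])
  have d: "dir_deriv S b g x = dir_deriv S b (c t) x + dir_deriv S b f x" for b
    using dir_deriv_lincomb[OF U C2_onD(1)[OF c] C2_onD(1)[OF f] x, of b 1 1] by (simp add: g_def[abs_def])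
  have dd: "dir_deriv S a (dir_deriv S b g) x
      = dir_deriv S a (dir_deriv S b (c t)) x + dir_deriv S a (dir_deriv S b f) x" for a b
    using dir_deriv2_lincomb[OF U c f x, of a b 1 1] by (simp add: g_def[abs_def])
  have "(\<Sum>a\<in>Basis. (u \<bullet> a) * (dir_deriv S a (dir_deriv S b (c t)) x + jet S f (x, [b, a])))
      = hess S g x u \<bullet> b" for b
    unfolding hess_inner[OF U g x] dir_deriv_Basis[OF C2_onD(2)[OF g] x, of u] by (simp add: dd x)
  moreover have "dir_deriv S b (c t) x + jet S f (x, [b]) = snd (val_grad S g x) \<bullet> b" for b
    by (simp add: val_grad_def grad_inner[OF C2_onD(1)[OF g] x] d x)
  moreover have "c t x + jet S f (x, []) = fst (val_grad S g x)"
    by (simp add: val_grad_def g_def x)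
  ultimately show ?thesis
    unfolding defect_def Let_def fst_conv snd_conv g_def[abs_def] by simp
qed

lemma sum_abs_inner_eq_0: "(\<Sum>b\<in>Basis. \<bar>v \<bullet> b\<bar>) = 0 \<longleftrightarrow> v = (0 :: 'b::euclidean_space)"
  by (simp add: sum_nonneg_eq_0_iff euclidean_all_zero_iff)

lemma defect_jet_eq_0:
  fixes S :: "'b::euclidean_space set"
  assumes U: "unique_derivs S" and c: "C2_on S (c t)" and f: "C2_on S f" and x: "x \<in> S"
  shows "defect S c \<rho> (jet S f) (t, x, u) = 0 \<longleftrightarrow> val_grad S (\<lambda>y. c t y + f y) x = 0
    \<and> (\<rho> t x = 0 \<or> hess S (\<lambda>y. c t y + f y) x u = 0)"
proof -
  have nn: "a + b + d = 0 \<longleftrightarrow> a = 0 \<and> b = 0 \<and> d = 0" if "a \<ge> 0" "b \<ge> 0" "d \<ge> 0" for a b d :: real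
    using that by linarith
  show ?thesis
    unfolding defect_jet[where c = c and t = t, OF U c f x]
    by (subst nn) (simp_all add: sum_nonneg sum_abs_inner_eq_0 prod_eq_iff)
qed

lemma continuous_val_grad_joint:
  fixes S :: "'b::euclidean_space set"
  assumes "unique_derivs S" "C1_curve_on S I c c'" "C2_on S f" "compact K" "K \<subseteq> S"
  shows "continuous_on (I \<times> K) (\<lambda>z. val_grad S (\<lambda>y. c (fst z) y + f y) (snd z))"
  unfolding continuous_on_eq_continuous_within
proof
  fix z assume "z \<in> I \<times> K"
  then have "fst z \<in> I" "snd z \<in> K" by auto
  from has_derivative_continuous[OF has_derivative_val_grad_joint[OF assms this]]
  show "continuous (at z within I \<times> K) (\<lambda>z. val_grad S (\<lambda>y. c (fst z) y + f y) (snd z))" by simp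
qed

lemma continuous_defect:
  fixes S :: "'b::euclidean_space set"
  assumes U: "unique_derivs S" and c: "C1_curve_on S I c c'" and f: "C2_on S f"
    and K: "compact K" "K \<subseteq> S" and \<rho>: "continuous_on (I \<times> K) (\<lambda>z. \<rho> (fst z) (snd z))"
    and Q: "Q \<subseteq> I \<times> K \<times> UNIV"
  shows "continuous_on Q (defect S c \<rho> (jet S f))"
proof -
  define p where "p z = (fst z, fst (snd z))" for z :: "real \<times> 'b \<times> 'b"
  have pQ: "p ` Q \<subseteq> I \<times> K" using Q by (auto simp: p_def)
  have cp: "continuous_on Q p" unfolding p_def[abs_def] by (intro continuous_intros)
  have comp: "continuous_on Q (\<lambda>z. h (p z))" if "continuous_on (I \<times> K) h" for h :: "_ \<Rightarrow> real"
    using continuous_on_compose2[OF that cp pQ] .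
  have C2c: "C2_on S (c t)" if "t \<in> I" for t using c that by (simp add: C1_curve_on_def)
  have vg: "continuous_on Q (\<lambda>z. val_grad S (\<lambda>y. c (fst (p z)) y + f y) (snd (p z)))"
    using continuous_on_compose2[OF continuous_val_grad_joint[OF U c f K] cp pQ] .
  have d2: "continuous_on Q (\<lambda>z. dir_deriv S a (dir_deriv S b (c (fst (p z)))) (snd (p z)))" for a b
  proof (rule comp, rule continuous_on_joint)
    fix t assume t: "t \<in> I"
    show "uniform_limit K (\<lambda>t. dir_deriv S a (dir_deriv S b (c t))) (dir_deriv S a (dir_deriv S b (c t)))
        (at t within I)"
      using c K t by (simp add: C1_curve_on_def)
    show "continuous_on K (dir_deriv S a (dir_deriv S b (c t)))"
      by (rule continuous_on_subset[OF C2_onD(5)[OF C2c[OF t]] K(2)])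
  qed
  have f2: "continuous_on Q (\<lambda>z. dir_deriv S a (dir_deriv S b f) (snd (p z)))" for a b
  proof (rule comp)
    show "continuous_on (I \<times> K) (\<lambda>z. dir_deriv S a (dir_deriv S b f) (snd z))"
      by (rule continuous_on_compose2[OF C2_onD(5)[OF f] continuous_on_snd[OF continuous_on_id]]) (use K in auto)
  qed
  have "continuous_on Q (\<lambda>z. \<bar>fst (val_grad S (\<lambda>y. c (fst (p z)) y + f y) (snd (p z)))\<bar>
    + (\<Sum>b\<in>Basis. \<bar>snd (val_grad S (\<lambda>y. c (fst (p z)) y + f y) (snd (p z))) \<bullet> b\<bar>)
    + \<bar>\<rho> (fst (p z)) (snd (p z))\<bar> * (\<Sum>b\<in>Basis. \<bar>\<Sum>a\<in>Basis. (snd (snd z) \<bullet> a) *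
        (dir_deriv S a (dir_deriv S b (c (fst (p z)))) (snd (p z)) + dir_deriv S a (dir_deriv S b f)
            (snd (p z)))\<bar>))"
    by (intro continuous_on_add continuous_on_mult continuous_on_sum continuous_on_rabs continuous_on_fst
        continuous_on_snd continuous_on_inner continuous_on_const continuous_on_id vg comp[OF \<rho>] d2 f2)
  then show ?thesis
  proof (rule continuous_on_eq)
    fix z assume "z \<in> Q"
    then obtain t x u where z: "z = (t, x, u)" and t: "t \<in> I" and x: "x \<in> S" using Q K by (cases z) auto
    have 1: "dir_deriv S b (c t) x + dir_deriv S b f x = snd (val_grad S (\<lambda>y. c t y + f y) x) \<bullet> b" for b
      using dir_deriv_lincomb[OF U C2_onD(1)[OF C2c[OF t]] C2_onD(1)[OF f] x, of b 1 1]
        grad_inner[OF C2_onD(1)[OF C2_on_lincomb[OF U C2c[OF t] f, of 1 1]] x, of b]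
      by (simp add: val_grad_def)
    show "\<bar>fst (val_grad S (\<lambda>y. c (fst (p z)) y + f y) (snd (p z)))\<bar>
      + (\<Sum>b\<in>Basis. \<bar>snd (val_grad S (\<lambda>y. c (fst (p z)) y + f y) (snd (p z))) \<bullet> b\<bar>)
      + \<bar>\<rho> (fst (p z)) (snd (p z))\<bar> * (\<Sum>b\<in>Basis. \<bar>\<Sum>a\<in>Basis. (snd (snd z) \<bullet> a) *
        (dir_deriv S a (dir_deriv S b (c (fst (p z)))) (snd (p z)) + dir_deriv S a (dir_deriv S b f) (snd (p z)))\<bar>)
      = defect S c \<rho> (jet S f) z"
      by (simp add: z p_def defect_def x 1) (simp add: val_grad_def)
  qed
qed

lemma jet_add_sum:
  fixes S :: "'b::euclidean_space set"
  assumes U: "unique_derivs S" and f: "C2_on S f" and e: "\<And>i. i \<in> F \<Longrightarrow> C2_on S (e i)"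
  shows "jet S (\<lambda>x. f x + (\<Sum>i\<in>F. a i * e i x)) j = jet S f j + (\<Sum>i\<in>F. a i * jet S (e i) j)"
proof -
  have s: "C2_on S (\<lambda>x. \<Sum>i\<in>F. a i * e i x)" by (rule C2_on_sum[OF U e])
  show ?thesis
  proof (cases j rule: jet_cases)
    case (1 x)
    then show ?thesis by simp
  next
    case (2 x v)
    show ?thesis
    proof (cases "x \<in> S")
      case True
      then show ?thesis
        using dir_deriv_lincomb[OF U C2_onD(1)[OF f] C2_onD(1)[OF s] True, of v 1 1]
          dir_deriv_sum[OF U C2_onD(1)[OF e] True, where v = v and a = a and F = F] 2 by simp
    qed (simp add: 2)
  next
    case (3 x v u)
    show ?thesis
    proof (cases "x \<in> S")
      case True
      then show ?thesis
        using dir_deriv2_lincomb[OF U f s True, of u v 1 1]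
          dir_deriv2_sum[OF U e True, where u = u and v = v and a = a and F = F] 3 by simp
    qed (simp add: 3)
  next
    case (4 x v u w vs)
    then show ?thesis by simp
  qed
qed

context gaussian_space begin

lemma jet_in_V:
  fixes Y :: "'w \<Rightarrow> 'b::euclidean_space \<Rightarrow> real"
  assumes U: "unique_derivs S" and C2: "\<And>\<omega>. C2_on S (Y \<omega>)" and V: "\<And>x. x \<in> S \<Longrightarrow> (\<lambda>\<omega>. Y \<omega> x) \<in> V"
  shows "(\<lambda>\<omega>. jet S (Y \<omega>) i) \<in> V"
proof -
  note D1 = dir_deriv_in_V[OF U C2_onD(1)[OF C2] V]
  note D2 = dir_deriv_in_V[OF U C2_onD(2)[OF C2] D1]
  show ?thesis
  proof (cases i rule: jet_cases)
    case (1 x)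
    then show ?thesis by (cases "x \<in> S") (simp_all add: zero V)
  next
    case (2 x v)
    then show ?thesis by (cases "x \<in> S") (simp_all add: zero D1)
  next
    case (3 x v u)
    then show ?thesis by (cases "x \<in> S") (simp_all add: zero D2)
  next
    case (4 x v u w vs)
    then show ?thesis by (simp add: zero)
  qed
qed

text \<open>The covariances of all jets with \<xi> form again the jet of a single function. With
  \<open>jet_add_sum\<close>, a translation of the coordinates is therefore an addition of functions
  to the field.\<close>

lemma jet_covariance:
  fixes Y :: "'w \<Rightarrow> 'b::euclidean_space \<Rightarrow> real"
  assumes U: "unique_derivs S" and C2: "\<And>\<omega>. C2_on S (Y \<omega>)" and V: "\<And>x. x \<in> S \<Longrightarrow> (\<lambda>\<omega>. Y \<omega> x) \<in> V"
    and \<xi>: "\<xi> \<in> V"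
  shows "expectation (\<lambda>\<omega>. jet S (Y \<omega>) i * \<xi> \<omega>) = jet S (\<lambda>x. expectation (\<lambda>\<omega>. Y \<omega> x * \<xi> \<omega>)) i"
  by (cases i rule: jet_cases)
    (simp_all add: covariance_dir_deriv[OF U C2_onD(1)[OF C2] V \<xi>] covariance_C2_on(2)[OF U C2 V \<xi>])

text \<open>The event that the defect has a zero in \<open>Q\<close> is a union over uncountably
  many points. For the jet of a C^2 function the defect is continuous on the compact
  \<open>Q\<close>, so a zero exists iff the values on a countable dense subset come arbitrarily
  close to 0. This is the measurable condition \<open>B\<close>, to which
  \<open>null_if_negligible_shifts\<close> applies.\<close>

lemma defect_nonzero_AE:
  fixes Y :: "'w \<Rightarrow> 'b::euclidean_space \<Rightarrow> real" and \<xi> :: "'n::euclidean_space \<Rightarrow> 'w \<Rightarrow> real"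
  assumes U: "unique_derivs S" and C2: "\<And>\<omega>. C2_on S (Y \<omega>)" and V: "\<And>x. x \<in> S \<Longrightarrow> (\<lambda>\<omega>. Y \<omega> x) \<in> V"
    and \<xi>: "\<And>b. b \<in> Basis \<Longrightarrow> \<xi> b \<in> V" and c: "C1_curve_on S I c c'"
    and K: "compact K" "K \<subseteq> S" and \<rho>: "continuous_on (I \<times> K) (\<lambda>z. \<rho> (fst z) (snd z))"
    and Q: "Q \<subseteq> I \<times> K \<times> UNIV" "compact Q"
    and negl: "\<And>f. C2_on S f \<Longrightarrow> negligible {\<eta>. \<exists>z\<in>Q.
      defect S c \<rho> (jet S (\<lambda>x. f x + (\<Sum>b\<in>Basis. (\<eta> \<bullet> b) * expectation (\<lambda>\<omega>. Y \<omega> x * \<xi> b \<omega>)))) z = 0}"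
  shows "AE \<omega> in P. \<forall>z\<in>Q. defect S c \<rho> (jet S (Y \<omega>)) z \<noteq> 0"
proof -
  obtain D where D: "countable D" "D \<subseteq> Q" "Q \<subseteq> closure D" by (rule separable)
  define B where "B = {w. \<forall>n. \<exists>z\<in>D. defect S c \<rho> w z < inverse (real (Suc n))}"
  have "(\<lambda>w. defect S c \<rho> w z) \<in> borel_measurable coords" for z
    unfolding defect_def Let_def by measurable
  then have "{w. defect S c \<rho> w z < r} \<in> sets coords" for z r
    using borel_measurable_less[of "\<lambda>w. defect S c \<rho> w z" coords "\<lambda>_. r"] by (simp add: space_PiM)
  moreover have "B = (\<Inter>n. \<Union>z\<in>D. {w. defect S c \<rho> w z < inverse (real (Suc n))})"
    by (auto simp: B_def)
  ultimately have mB: "B \<in> sets coords"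
    using D(1) by (auto intro!: sets.countable_INT sets.countable_UN')
  \<comment> \<open>One direction uses that the infimum over \<open>Q\<close> is attained, the other
    that \<open>D\<close> is dense in \<open>Q\<close>.\<close>
  have jetB: "jet S f \<in> B \<longleftrightarrow> (\<exists>z\<in>Q. defect S c \<rho> (jet S f) z = 0)" if f: "C2_on S f" for f
  proof
    have cont: "continuous_on Q (defect S c \<rho> (jet S f))" by (rule continuous_defect[OF U c f K \<rho> Q(1)])
    assume B: "jet S f \<in> B"
    then have "Q \<noteq> {}" using D(2) by (auto simp: B_def)
    then obtain z0 where z0: "z0 \<in> Q" "\<And>z. z \<in> Q \<Longrightarrow> defect S c \<rho> (jet S f) z0 \<le> defect S c \<rho> (jet S f) z"
      using continuous_attains_inf[OF Q(2) _ cont] by blast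
    have "defect S c \<rho> (jet S f) z0 = 0"
    proof (rule ccontr)
      assume "defect S c \<rho> (jet S f) z0 \<noteq> 0"
      then have "defect S c \<rho> (jet S f) z0 > 0" using defect_nonneg[of S c \<rho> "jet S f" z0] by linarith
      then obtain n where n: "inverse (real (Suc n)) < defect S c \<rho> (jet S f) z0" using reals_Archimedean by blast
      then obtain z where "z \<in> D" "defect S c \<rho> (jet S f) z < inverse (real (Suc n))"
        using B unfolding B_def by blast
      then show False using z0(2)[of z] D(2) n by auto
    qed
    then show "\<exists>z\<in>Q. defect S c \<rho> (jet S f) z = 0" using z0(1) by blast
  next
    have cont: "continuous_on Q (defect S c \<rho> (jet S f))" by (rule continuous_defect[OF U c f K \<rho> Q(1)])
    assume "\<exists>z\<in>Q. defect S c \<rho> (jet S f) z = 0"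
    then obtain z where z: "z \<in> Q" "defect S c \<rho> (jet S f) z = 0" by blast
    have "\<exists>y\<in>D. defect S c \<rho> (jet S f) y < inverse (real (Suc n))" for n
    proof -
      have "inverse (real (Suc n)) > 0" by simp
      then obtain d where d: "d > 0" "\<And>y. y \<in> Q \<Longrightarrow> dist y z < d \<Longrightarrow>
          dist (defect S c \<rho> (jet S f) y) (defect S c \<rho> (jet S f) z) < inverse (real (Suc n))"
        using cont z(1) unfolding continuous_on_iff by meson
      have "z \<in> closure D" using z(1) D(3) by blast
      then obtain y where y: "y \<in> D" "dist y z < d" using d(1) by (meson closure_approachable)
      have "y \<in> Q" using y(1) D(2) by blast
      from d(2)[OF this y(2)] show ?thesis
        using y(1) z(2) by (intro bexI[of _ y]) (auto simp: dist_real_def simp del: of_nat_Suc)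
    qed
    then show "jet S f \<in> B" by (simp add: B_def)
  qed
  have "AE \<omega> in P. (\<lambda>i. jet S (Y \<omega>) i) \<notin> B"
  proof (rule null_if_negligible_shifts[OF \<xi> jet_in_V[OF U C2 V] mB])
    fix \<omega>
    have e: "C2_on S (\<lambda>x. expectation (\<lambda>\<omega>. Y \<omega> x * \<xi> b \<omega>))" if "b \<in> Basis" for b
      by (rule covariance_C2_on(1)[OF U C2 V \<xi>[OF that]])
    have "(\<lambda>i. jet S (Y \<omega>) i + (\<Sum>b\<in>Basis. (\<eta> \<bullet> b) * expectation (\<lambda>\<omega>. jet S (Y \<omega>) i * \<xi> b \<omega>)))
        = jet S (\<lambda>x. Y \<omega> x + (\<Sum>b\<in>Basis. (\<eta> \<bullet> b) * expectation (\<lambda>\<omega>. Y \<omega> x * \<xi> b \<omega>)))" for \<eta>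
      using jet_covariance[OF U C2 V \<xi>] by (simp add: fun_eq_iff jet_add_sum[OF U C2 e])
    moreover have "C2_on S (\<lambda>x. Y \<omega> x + (\<Sum>b\<in>Basis. (\<eta> \<bullet> b) * expectation (\<lambda>\<omega>. Y \<omega> x * \<xi> b \<omega>)))" for \<eta>
    proof -
      have "C2_on S (\<lambda>x. \<Sum>b\<in>Basis. (\<eta> \<bullet> b) * expectation (\<lambda>\<omega>. Y \<omega> x * \<xi> b \<omega>))"
        by (rule C2_on_sum[OF U e])
      from C2_on_lincomb[OF U C2 this, where a = 1 and b = 1] show ?thesis by simp
    qed
    ultimately show "negligible {\<eta>. (\<lambda>i. jet S (Y \<omega>) i
        + (\<Sum>b\<in>Basis. (\<eta> \<bullet> b) * expectation (\<lambda>\<omega>. jet S (Y \<omega>) i * \<xi> b \<omega>))) \<in> B}"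
      using negl[OF C2, of \<omega>] by (simp add: jetB)
  qed
  then show ?thesis
    by (rule eventually_mono) (use jetB[OF C2] in auto)
qed

end

section \<open>Almost sure absence of degenerate critical zeros\<close>

context gaussian_space begin

text \<open>The shifts are the covariances with the coordinates of the 1-jet at
  \<open>x\<^sub>0\<close>. Their effect on the 1-jet at \<open>x\<^sub>0\<close> itself is the
  covariance matrix of that jet, which is positive definite by \<open>nondeg\<close>; by continuity
  invertibility persists nearby with a uniform bound.\<close>

lemma shift_bounded_below:
  fixes Y :: "'w \<Rightarrow> 'b::euclidean_space \<Rightarrow> real" and x\<^sub>0 :: 'b and S :: "'b set"
  defines "e \<equiv> \<lambda>b x. expectation (\<lambda>\<omega>. Y \<omega> x * (val_grad S (Y \<omega>) x\<^sub>0 \<bullet> b))"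
  assumes U: "unique_derivs S" and C2: "\<And>\<omega>. C2_on S (Y \<omega>)" and V: "\<And>x. x \<in> S \<Longrightarrow> (\<lambda>\<omega>. Y \<omega> x) \<in> V"
    and x0: "x\<^sub>0 \<in> S" and nondeg: "\<And>\<eta>. \<eta> \<noteq> 0 \<Longrightarrow> expectation (\<lambda>\<omega>. (val_grad S (Y \<omega>) x\<^sub>0 \<bullet> \<eta>)\<^sup>2) \<noteq> 0"
  shows "\<And>b. (\<lambda>\<omega>. val_grad S (Y \<omega>) x\<^sub>0 \<bullet> b) \<in> V" and "\<And>b. C2_on S (e b)"
    and "\<exists>r>0. \<exists>k>0. \<forall>x\<in>S \<inter> cball x\<^sub>0 r. \<forall>\<eta>. k * norm \<eta> \<le> norm (\<Sum>b\<in>Basis. (\<eta> \<bullet> b) *\<^sub>R val_grad S (e b) x)"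
proof -
  have vgV: "(\<lambda>\<omega>. val_grad S (Y \<omega>) x \<bullet> b) \<in> V" if "x \<in> S" for x b
    unfolding val_grad_inner[OF C2_onD(1)[OF C2] that]
    by (intro add scale V dir_deriv_in_V[OF U C2_onD(1)[OF C2] V] that)
  show \<xi>: "(\<lambda>\<omega>. val_grad S (Y \<omega>) x\<^sub>0 \<bullet> b) \<in> V" for b by (rule vgV[OF x0])
  show e: "C2_on S (e b)" for b
    unfolding e_def by (rule covariance_C2_on(1)[OF U C2 V \<xi>])
  have vge: "val_grad S (e b) x \<bullet> \<eta> = expectation (\<lambda>\<omega>. (val_grad S (Y \<omega>) x \<bullet> \<eta>) * (val_grad S (Y \<omega>) x\<^sub>0 \<bullet> b))"
    if x: "x \<in> S" for x b \<eta>
  proof -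
    note D = dir_deriv_in_V[OF U C2_onD(1)[OF C2] V x]
    have "val_grad S (e b) x \<bullet> \<eta> = fst \<eta> * e b x + dir_deriv S (snd \<eta>) (e b) x"
      by (rule val_grad_inner[OF C2_onD(1)[OF e] x])
    also have "dir_deriv S (snd \<eta>) (e b) x
        = expectation (\<lambda>\<omega>. dir_deriv S (snd \<eta>) (Y \<omega>) x * (val_grad S (Y \<omega>) x\<^sub>0 \<bullet> b))"
      unfolding e_def by (rule covariance_dir_deriv[OF U C2_onD(1)[OF C2] V \<xi> x])
    finally show ?thesis
      unfolding val_grad_inner[OF C2_onD(1)[OF C2] x]
      using integrable_mult[OF V[OF x] \<xi>, of b] integrable_mult[OF D \<xi>, of "snd \<eta>" b]
      by (simp add: distrib_right mult.assoc e_def)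
  qed
  define L where "L x \<eta> = (\<Sum>b\<in>Basis. (\<eta> \<bullet> b) *\<^sub>R val_grad S (e b) x)" for x \<eta>
  have lin: "linear (L x)" for x
    unfolding L_def by (intro linear_compose_sum ballI linearI) (simp_all add: inner_add_left scaleR_add_left)
  have "L x\<^sub>0 \<eta> \<bullet> \<eta> = expectation (\<lambda>\<omega>. (val_grad S (Y \<omega>) x\<^sub>0 \<bullet> \<eta>)\<^sup>2)" for \<eta>
  proof -
    have rep: "(\<Sum>b\<in>Basis. (\<eta> \<bullet> b) * (v \<bullet> b)) = v \<bullet> \<eta>" for v :: "real \<times> 'b"
      by (subst (2) euclidean_inner) (simp add: mult.commute)
    have "L x\<^sub>0 \<eta> \<bullet> \<eta> = (\<Sum>b\<in>Basis. (\<eta> \<bullet> b)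
        * expectation (\<lambda>\<omega>. (val_grad S (Y \<omega>) x\<^sub>0 \<bullet> \<eta>) * (val_grad S (Y \<omega>) x\<^sub>0 \<bullet> b)))"
      by (simp add: L_def inner_sum_left vge[OF x0])
    also have "\<dots> = expectation (\<lambda>\<omega>. \<Sum>b\<in>Basis. (\<eta> \<bullet> b) * ((val_grad S (Y \<omega>) x\<^sub>0 \<bullet> \<eta>) * (val_grad S (Y \<omega>) x\<^sub>0 \<bullet> b)))"
      by (simp add: integrable_mult[OF \<xi> \<xi>])
    also have "\<dots> = expectation (\<lambda>\<omega>. (val_grad S (Y \<omega>) x\<^sub>0 \<bullet> \<eta>)\<^sup>2)"
    proof (rule Bochner_Integration.integral_cong[OF refl])
      fix \<omega>
      have "(\<Sum>b\<in>Basis. (\<eta> \<bullet> b) * ((val_grad S (Y \<omega>) x\<^sub>0 \<bullet> \<eta>) * (val_grad S (Y \<omega>) x\<^sub>0 \<bullet> b)))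
          = (val_grad S (Y \<omega>) x\<^sub>0 \<bullet> \<eta>) * (\<Sum>b\<in>Basis. (\<eta> \<bullet> b) * (val_grad S (Y \<omega>) x\<^sub>0 \<bullet> b))"
        by (simp add: sum_distrib_left mult.left_commute)
      then show "(\<Sum>b\<in>Basis. (\<eta> \<bullet> b) * ((val_grad S (Y \<omega>) x\<^sub>0 \<bullet> \<eta>) * (val_grad S (Y \<omega>) x\<^sub>0 \<bullet> b)))
          = (val_grad S (Y \<omega>) x\<^sub>0 \<bullet> \<eta>)\<^sup>2"
        unfolding rep power2_eq_square .
    qed
    finally show ?thesis .
  qed
  then have "L x\<^sub>0 \<eta> \<noteq> 0" if "\<eta> \<noteq> 0" for \<eta> using nondeg[OF that] by (metis inner_zero_left)
  then have "inj (L x\<^sub>0)"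
    using linear_injective_0[OF lin] by blast
  then obtain k where k: "k > 0" "\<And>\<eta>. k * norm \<eta> \<le> norm (L x\<^sub>0 \<eta>)"
    using linear_inj_bounded_below_pos[OF lin] by metis
  have "continuous_on S (\<lambda>x. val_grad S (e b) x)" for b
    unfolding val_grad_def grad_def
    by (intro continuous_on_Pair continuous_on_sum continuous_on_scaleR continuous_on_const C2_onD(3,4)[OF e])
  then have "continuous_on S (\<lambda>x. \<Sum>b\<in>Basis. norm (val_grad S (e b) x - val_grad S (e b) x\<^sub>0))"
    by (intro continuous_on_sum continuous_on_norm continuous_on_diff continuous_on_const)
  \<comment> \<open>Half of the lower bound at \<open>x\<^sub>0\<close> is spent on the variation of
    the linear map, the other half remains on the smaller ball.\<close>
  moreover have "k / 2 > 0" using k(1) by simp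
  ultimately obtain d where d: "d > 0" "\<And>x. x \<in> S \<Longrightarrow> dist x x\<^sub>0 < d \<Longrightarrow>
      dist (\<Sum>b\<in>Basis. norm (val_grad S (e b) x - val_grad S (e b) x\<^sub>0))
        (\<Sum>b\<in>Basis. norm (val_grad S (e b) x\<^sub>0 - val_grad S (e b) x\<^sub>0)) < k / 2"
    using x0 unfolding continuous_on_iff by meson
  have "k / 2 * norm \<eta> \<le> norm (L x \<eta>)" if x: "x \<in> S \<inter> cball x\<^sub>0 (d / 2)" for x \<eta>
  proof -
    have "dist x x\<^sub>0 < d" using x d(1) by (simp add: dist_commute)
    then have small: "(\<Sum>b\<in>Basis. norm (val_grad S (e b) x - val_grad S (e b) x\<^sub>0)) \<le> k / 2"
      using d(2)[of x] x by (simp add: dist_norm)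
    have "norm (L x \<eta> - L x\<^sub>0 \<eta>) = norm (\<Sum>b\<in>Basis. (\<eta> \<bullet> b) *\<^sub>R (val_grad S (e b) x - val_grad S (e b) x\<^sub>0))"
      by (simp add: L_def sum_subtractf scaleR_diff_right)
    also have "\<dots> \<le> (\<Sum>b\<in>Basis. norm \<eta> * norm (val_grad S (e b) x - val_grad S (e b) x\<^sub>0))"
      by (intro sum_norm_le) (simp add: mult_right_mono Basis_le_norm)
    also have "\<dots> = norm \<eta> * (\<Sum>b\<in>Basis. norm (val_grad S (e b) x - val_grad S (e b) x\<^sub>0))"
      by (simp add: sum_distrib_left)
    also have "\<dots> \<le> norm \<eta> * (k / 2)" by (rule mult_left_mono[OF small norm_ge_zero])
    finally have "norm (L x \<eta> - L x\<^sub>0 \<eta>) \<le> norm \<eta> * (k / 2)" .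
    moreover have "norm (L x\<^sub>0 \<eta>) \<le> norm (L x \<eta>) + norm (L x \<eta> - L x\<^sub>0 \<eta>)"
      by (metis norm_minus_commute norm_triangle_sub)
    moreover have "norm \<eta> * (k / 2) = k / 2 * norm \<eta>" "k * norm \<eta> = k / 2 * norm \<eta> + k / 2 * norm \<eta>"
      by (simp_all add: field_simps)
    ultimately show ?thesis using k(2)[of \<eta>] by linarith
  qed
  then show "\<exists>r>0. \<exists>k>0. \<forall>x\<in>S \<inter> cball x\<^sub>0 r. \<forall>\<eta>. k * norm \<eta> \<le> norm (\<Sum>b\<in>Basis. (\<eta> \<bullet> b) *\<^sub>R val_grad S (e b) x)"
    using d(1) k(1) unfolding L_def by (intro exI[of _ "d / 2"] conjI exI[of _ "k / 2"] ballI allI) auto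
qed

text \<open>The radius is fixed before \<open>Q\<close> and \<rho>. The condition on
  \<open>Q\<close> asks only that each zero of the defect be a singular zero of the 1-jet map within
  the projection of \<open>Q\<close> to pairs \<open>(t, x)\<close>; interior, boundary and end-time
  statements are instances.\<close>

lemma local_defect_nonzero_AE:
  fixes Y :: "'w \<Rightarrow> 'b::euclidean_space \<Rightarrow> real"
  assumes U: "unique_derivs S" and C2: "\<And>\<omega>. C2_on S (Y \<omega>)" and V: "\<And>x. x \<in> S \<Longrightarrow> (\<lambda>\<omega>. Y \<omega> x) \<in> V"
    and c: "C1_curve_on S I c c'"
    and loc: "\<exists>r>0. compact (S \<inter> cball x\<^sub>0 r)"
    and x0: "x\<^sub>0 \<in> S" and nondeg: "\<And>\<eta>. \<eta> \<noteq> 0 \<Longrightarrow> expectation (\<lambda>\<omega>. (val_grad S (Y \<omega>) x\<^sub>0 \<bullet> \<eta>)\<^sup>2) \<noteq> 0"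
  shows "\<exists>r>0. compact (S \<inter> cball x\<^sub>0 r) \<and> (\<forall>Q \<rho>. compact Q \<and> Q \<subseteq> I \<times> (S \<inter> cball x\<^sub>0 r) \<times> UNIV
    \<and> continuous_on (I \<times> (S \<inter> cball x\<^sub>0 r)) (\<lambda>z. \<rho> (fst z) (snd z))
    \<and> (\<forall>f t x u. C2_on S f \<and> (t, x, u) \<in> Q \<and> defect S c \<rho> (jet S f) (t, x, u) = 0 \<longrightarrow>
        (\<exists>D. ((\<lambda>z. val_grad S (\<lambda>y. c (fst z) y + f y) (snd z)) has_derivative D)
          (at (t, x) within (\<lambda>z. (fst z, fst (snd z))) ` Q) \<and> \<not> inj D))
    \<longrightarrow> (AE \<omega> in P. \<forall>z\<in>Q. defect S c \<rho> (jet S (Y \<omega>)) z \<noteq> 0))"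
proof -
  define \<xi> where "\<xi> b \<omega> = val_grad S (Y \<omega>) x\<^sub>0 \<bullet> b" for b \<omega>
  define e where "e b x = expectation (\<lambda>\<omega>. Y \<omega> x * \<xi> b \<omega>)" for b x
  note sh = shift_bounded_below[OF U C2 V x0 nondeg, folded \<xi>_def, folded e_def]
  have \<xi>: "\<xi> b \<in> V" for b using sh(1)[of b] by (simp add: \<xi>_def[abs_def])
  have e: "C2_on S (e b)" for b using sh(2)[of b] by (simp add: e_def[abs_def])
  obtain r1 k where r1: "r1 > 0" "k > 0"
    "\<And>x \<eta>. x \<in> S \<inter> cball x\<^sub>0 r1 \<Longrightarrow> k * norm \<eta> \<le> norm (\<Sum>b\<in>Basis. (\<eta> \<bullet> b) *\<^sub>R val_grad S (e b) x)"
    using sh(3) unfolding e_def[abs_def, symmetric] by blast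
  obtain r2 where r2: "r2 > 0" "compact (S \<inter> cball x\<^sub>0 r2)" using loc by blast
  define r where "r = min r1 r2"
  define K where "K = S \<inter> cball x\<^sub>0 r"
  have K: "compact K"
  proof -
    have "K = (S \<inter> cball x\<^sub>0 r2) \<inter> cball x\<^sub>0 r" by (auto simp: K_def r_def)
    then show ?thesis using r2(2) by (simp add: compact_Int_closed)
  qed
  have KS: "K \<subseteq> S" by (simp add: K_def)
  have C2c: "C2_on S (c t)" if "t \<in> I" for t using c that by (simp add: C1_curve_on_def)
  have main: "AE \<omega> in P. \<forall>z\<in>Q. defect S c \<rho> (jet S (Y \<omega>)) z \<noteq> 0"
    if Q: "compact Q" "Q \<subseteq> I \<times> K \<times> UNIV" and \<rho>: "continuous_on (I \<times> K) (\<lambda>z. \<rho> (fst z) (snd z))"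
      and sing: "\<And>f t x u. C2_on S f \<Longrightarrow> (t, x, u) \<in> Q \<Longrightarrow> defect S c \<rho> (jet S f) (t, x, u) = 0 \<Longrightarrow>
        \<exists>D. ((\<lambda>z. val_grad S (\<lambda>y. c (fst z) y + f y) (snd z)) has_derivative D)
          (at (t, x) within (\<lambda>z. (fst z, fst (snd z))) ` Q) \<and> \<not> inj D" for Q \<rho>
  proof (rule defect_nonzero_AE[where \<xi> = \<xi>, OF U C2 V \<xi> c K KS \<rho> Q(2,1)])
    fix f :: "'b \<Rightarrow> real" assume f: "C2_on S f"
    define Z where "Z = (\<lambda>z. (fst z, fst (snd z))) ` Q"
    have Z: "z \<in> Z \<Longrightarrow> fst z \<in> I \<and> snd z \<in> K" for z using Q(2) by (auto simp: Z_def)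
    define h where "h z = val_grad S (\<lambda>y. c (fst z) y + f y) (snd z)" for z
    define L where "L z \<eta> = (\<Sum>b\<in>Basis. (\<eta> \<bullet> b) *\<^sub>R val_grad S (e b) (snd z))" for z :: "real \<times> 'b" and \<eta>
    define f' where "f' \<eta> x = f x + (\<Sum>b\<in>Basis. (\<eta> \<bullet> b) * e b x)" for \<eta> x
    have es: "C2_on S (\<lambda>x. \<Sum>b\<in>Basis. (\<eta> \<bullet> b) * e b x)" for \<eta> by (rule C2_on_sum[OF U e])
    have C2f': "C2_on S (f' \<eta>)" for \<eta>
      using C2_on_lincomb[OF U f es, of 1 1] by (simp add: f'_def[abs_def])
    \<comment> \<open>The jet depends affinely on the parameter \<eta>, which is the form that
      \<open>parametric_Sard\<close> treats.\<close>
    have hL: "val_grad S (\<lambda>y. c (fst z) y + f' \<eta> y) (snd z) = h z + L z \<eta>" if z: "z \<in> Z" for z \<eta>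
    proof -
      have t: "fst z \<in> I" and x: "snd z \<in> S" using Z[OF z] KS by auto
      define g where "g y = c (fst z) y + f y" for y
      have g: "C2_on S g" using C2_on_lincomb[OF U C2c[OF t] f, of 1 1] by (simp add: g_def[abs_def])
      have gs: "C2_on S (\<lambda>y. g y + (\<Sum>b\<in>Basis. (\<eta> \<bullet> b) * e b y))"
        using C2_on_lincomb[OF U g es, of 1 1] by simp
      have D: "dir_deriv S v (\<lambda>y. g y + (\<Sum>b\<in>Basis. (\<eta> \<bullet> b) * e b y)) (snd z)
          = dir_deriv S v g (snd z) + (\<Sum>b\<in>Basis. (\<eta> \<bullet> b) * dir_deriv S v (e b) (snd z))" for v
        using dir_deriv_lincomb[OF U C2_onD(1)[OF g] C2_onD(1)[OF es] x, of v 1 1]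
          dir_deriv_sum[OF U C2_onD(1)[OF e] x, where v = v and F = Basis and a = "\<lambda>b. \<eta> \<bullet> b"] by simp
      have "val_grad S (\<lambda>y. g y + (\<Sum>b\<in>Basis. (\<eta> \<bullet> b) * e b y)) (snd z)
          = val_grad S g (snd z) + (\<Sum>b\<in>Basis. (\<eta> \<bullet> b) *\<^sub>R val_grad S (e b) (snd z))"
      proof (rule euclidean_eqI)
        fix i :: "real \<times> 'b"
        show "val_grad S (\<lambda>y. g y + (\<Sum>b\<in>Basis. (\<eta> \<bullet> b) * e b y)) (snd z) \<bullet> i
          = (val_grad S g (snd z) + (\<Sum>b\<in>Basis. (\<eta> \<bullet> b) *\<^sub>R val_grad S (e b) (snd z))) \<bullet> i"
          unfolding val_grad_inner[OF C2_onD(1)[OF gs] x] inner_add_left inner_sum_left inner_scaleR_left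
            val_grad_inner[OF C2_onD(1)[OF g] x] val_grad_inner[OF C2_onD(1)[OF e] x] D
          by (simp add: algebra_simps sum.distrib sum_distrib_left)
      qed
      then show ?thesis by (simp add: h_def L_def f'_def g_def[abs_def] add.assoc)
    qed
    have "negligible {\<eta>. \<exists>z\<in>Z. h z + L z \<eta> = 0
      \<and> (\<exists>D. ((\<lambda>z. h z + L z \<eta>) has_derivative D) (at z within Z) \<and> \<not> inj D)}"
    proof (rule parametric_Sard)
      show "linear (L z)" for z
        unfolding L_def by (intro linear_compose_sum ballI linearI) (simp_all add: inner_add_left scaleR_add_left)
      show "k > 0" by fact
      show "k * norm v \<le> norm (L z v)" if "z \<in> Z" for z v
        unfolding L_def using Z[OF that] by (intro r1(3)) (auto simp: K_def r_def)
      have "continuous_on S (val_grad S (e b))" for b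
        unfolding val_grad_def[abs_def] grad_def
        by (intro continuous_on_Pair continuous_on_sum continuous_on_scaleR continuous_on_const C2_onD(3,4)[OF e])
      then have "continuous_on Z (\<lambda>z. val_grad S (e b) (snd z))" for b
        by (rule continuous_on_compose2[OF _ continuous_on_snd[OF continuous_on_id]]) (use Z KS in blast)
      then show "continuous_on Z (\<lambda>z. L z v)" for v
        unfolding L_def by (intro continuous_on_sum continuous_on_scaleR continuous_on_const)
    qed
    moreover have "{\<eta>. \<exists>z\<in>Q. defect S c \<rho> (jet S (f' \<eta>)) z = 0} \<subseteq> {\<eta>. \<exists>z\<in>Z. h z + L z \<eta> = 0
      \<and> (\<exists>D. ((\<lambda>z. h z + L z \<eta>) has_derivative D) (at z within Z) \<and> \<not> inj D)}"
    proof clarify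
      fix \<eta> t x u assume z: "(t, x, u) \<in> Q" and 0: "defect S c \<rho> (jet S (f' \<eta>)) (t, x, u) = 0"
      have tx: "(t, x) \<in> Z" using z unfolding Z_def by (rule rev_image_eqI) simp
      have t: "t \<in> I" and x: "x \<in> S" using Z[OF tx] KS by auto
      obtain D where D: "((\<lambda>z. val_grad S (\<lambda>y. c (fst z) y + f' \<eta> y) (snd z)) has_derivative D) (at (t,
          x) within Z)" "\<not> inj D"
        using sing[OF C2f' z 0] unfolding Z_def by blast
      have "((\<lambda>z. h z + L z \<eta>) has_derivative D) (at (t, x) within Z)"
        by (rule has_derivative_transform[OF tx _ D(1)]) (rule hL[symmetric])
      moreover have "h (t, x) + L (t, x) \<eta> = 0"
        using hL[OF tx, of \<eta>] 0 unfolding defect_jet_eq_0[where c = c and t = t, OF U C2c[OF t] C2f' x] by simp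
      ultimately show "\<exists>z\<in>Z. h z + L z \<eta> = 0
        \<and> (\<exists>D. ((\<lambda>z. h z + L z \<eta>) has_derivative D) (at z within Z) \<and> \<not> inj D)"
        using tx D(2) by blast
    qed
    ultimately have "negligible {\<eta>. \<exists>z\<in>Q. defect S c \<rho> (jet S (f' \<eta>)) z = 0}"
      by (rule negligible_subset)
    then show "negligible {\<eta>. \<exists>z\<in>Q. defect S c \<rho> (jet S (\<lambda>x. f x
        + (\<Sum>b\<in>Basis. (\<eta> \<bullet> b) * expectation (\<lambda>\<omega>. Y \<omega> x * \<xi> b \<omega>)))) z = 0}"
      by (simp add: f'_def[abs_def] e_def)
  qed
  have "r > 0" using r1 r2 by (simp add: r_def)
  show ?thesis
  proof (intro exI[of _ r] conjI allI impI)
    show "r > 0" by fact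
    show "compact (S \<inter> cball x\<^sub>0 r)" using K by (simp only: K_def)
    fix Q \<rho>
    assume H: "compact Q \<and> Q \<subseteq> I \<times> (S \<inter> cball x\<^sub>0 r) \<times> UNIV
      \<and> continuous_on (I \<times> (S \<inter> cball x\<^sub>0 r)) (\<lambda>z. \<rho> (fst z) (snd z))
      \<and> (\<forall>f t x u. C2_on S f \<and> (t, x, u) \<in> Q \<and> defect S c \<rho> (jet S f) (t, x, u) = 0 \<longrightarrow>
        (\<exists>D. ((\<lambda>z. val_grad S (\<lambda>y. c (fst z) y + f y) (snd z)) has_derivative D)
          (at (t, x) within (\<lambda>z. (fst z, fst (snd z))) ` Q) \<and> \<not> inj D))"
    note H' = H[folded K_def]
    show "AE \<omega> in P. \<forall>z\<in>Q. defect S c \<rho> (jet S (Y \<omega>)) z \<noteq> 0"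
    proof (rule main)
      show "compact Q" "Q \<subseteq> I \<times> K \<times> UNIV" "continuous_on (I \<times> K) (\<lambda>z. \<rho> (fst z) (snd z))"
        using H' by blast+
      fix f t x u assume a: "C2_on S f" "(t, x, u) \<in> Q" "defect S c \<rho> (jet S f) (t, x, u) = 0"
      show "\<exists>D. ((\<lambda>z. val_grad S (\<lambda>y. c (fst z) y + f y) (snd z)) has_derivative D)
          (at (t, x) within (\<lambda>z. (fst z, fst (snd z))) ` Q) \<and> \<not> inj D"
        by (rule H'[THEN conjunct2, THEN conjunct2, THEN conjunct2, rule_format,
            OF conjI[OF a(1) conjI[OF a(2,3)]]])
    qed
  qed
qed

end

text \<open>Null sets may be united only countably often; Lindelof selects countably many of the
  balls.\<close>

lemma AE_locally:
  fixes S :: "'b::euclidean_space set"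
  assumes "\<And>x. x \<in> S \<Longrightarrow> \<exists>r>0. AE \<omega> in P. \<forall>y\<in>S \<inter> ball x r. R \<omega> y"
  shows "AE \<omega> in P. \<forall>y\<in>S. R \<omega> y"
proof -
  obtain r where r: "\<And>x. x \<in> S \<Longrightarrow> r x > 0" "\<And>x. x \<in> S \<Longrightarrow> AE \<omega> in P. \<forall>y\<in>S \<inter> ball x (r x). R \<omega> y"
    using assms by metis
  define F where "F = (\<lambda>x. ball x (r x)) ` S"
  obtain F' where F': "F' \<subseteq> F" "countable F'" "\<Union>F' = \<Union>F"
    by (rule Lindelof[of F]) (auto simp: F_def)
  have "AE \<omega> in P. \<forall>B\<in>F'. \<forall>y\<in>S \<inter> B. R \<omega> y"
    using F'(1) r(2) by (intro AE_ball_countable'[OF _ F'(2)]) (auto simp: F_def)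
  then show ?thesis
  proof (rule eventually_mono)
    fix \<omega> assume *: "\<forall>B\<in>F'. \<forall>y\<in>S \<inter> B. R \<omega> y"
    show "\<forall>y\<in>S. R \<omega> y"
    proof
      fix y assume "y \<in> S"
      then have "y \<in> ball y (r y)" using r(1) by simp
      then have "y \<in> \<Union>F" using \<open>y \<in> S\<close> unfolding F_def by blast
      then show "R \<omega> y" using * F'(3) \<open>y \<in> S\<close> by blast
    qed
  qed
qed

lemma C2_on_zero:
  assumes "unique_derivs S"
  shows "C2_on S (\<lambda>_. 0 :: real)"
  using C2_on_sum[OF assms, where F = "{}" and f = "\<lambda>_ _. 0" and a = "\<lambda>_. 0"] by simp

lemma linear_val_grad_derivative:
  fixes S :: "'b::euclidean_space set"
  assumes "unique_derivs S" "C2_on S g" "x \<in> S"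
  shows "linear (\<lambda>z :: real \<times> 'b. fst z *\<^sub>R w + (grad S g x \<bullet> snd z, hess S g x (snd z)))"
  using linear_hess[OF assms]
  by (intro linearI) (simp_all add: scaleR_add_left inner_add_right linear_add linear_scale algebra_simps)

text \<open>With \<rho> = \<open>c'\<close> the defect vanishes exactly at the critical zeros where
  the velocity vanishes or \<open>u\<close> is in the kernel of the Hessian. In both cases the block
  triangular derivative of the jet map is singular.\<close>

lemma (in gaussian_space) nondegenerate_AE:
  fixes Y :: "'w \<Rightarrow> 'b::euclidean_space \<Rightarrow> real"
  assumes U: "unique_derivs S" and C2: "\<And>\<omega>. C2_on S (Y \<omega>)" and V: "\<And>x. x \<in> S \<Longrightarrow> (\<lambda>\<omega>. Y \<omega> x) \<in> V"
    and c: "C1_curve_on S I c c'" and I: "compact I"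
    and loc: "\<And>x. x \<in> S \<Longrightarrow> \<exists>r>0. compact (S \<inter> cball x r)"
    and nondeg: "\<And>x \<eta>. x \<in> S \<Longrightarrow> \<eta> \<noteq> 0 \<Longrightarrow> expectation (\<lambda>\<omega>. (val_grad S (Y \<omega>) x \<bullet> \<eta>)\<^sup>2) \<noteq> 0"
  shows "AE \<omega> in P. \<forall>x\<in>S. \<forall>t\<in>I. val_grad S (\<lambda>y. c t y + Y \<omega> y) x = 0 \<longrightarrow>
    c' t x \<noteq> 0 \<and> (\<forall>u. hess S (\<lambda>y. c t y + Y \<omega> y) x u = 0 \<longrightarrow> u = 0)"
proof (rule AE_locally)
  fix x\<^sub>0 assume x0: "x\<^sub>0 \<in> S"
  obtain r where r: "r > 0" "compact (S \<inter> cball x\<^sub>0 r)"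
    and AE: "\<And>Q \<rho>. compact Q \<and> Q \<subseteq> I \<times> (S \<inter> cball x\<^sub>0 r) \<times> UNIV
    \<and> continuous_on (I \<times> (S \<inter> cball x\<^sub>0 r)) (\<lambda>z. \<rho> (fst z) (snd z))
    \<and> (\<forall>f t x u. C2_on S f \<and> (t, x, u) \<in> Q \<and> defect S c \<rho> (jet S f) (t, x, u) = 0 \<longrightarrow>
        (\<exists>D. ((\<lambda>z. val_grad S (\<lambda>y. c (fst z) y + f y) (snd z)) has_derivative D)
          (at (t, x) within (\<lambda>z. (fst z, fst (snd z))) ` Q) \<and> \<not> inj D))
    \<Longrightarrow> (AE \<omega> in P. \<forall>z\<in>Q. defect S c \<rho> (jet S (Y \<omega>)) z \<noteq> 0)"
    using local_defect_nonzero_AE[OF U C2 V c loc[OF x0] x0 nondeg[OF x0]] by blast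
  define K where "K = S \<inter> cball x\<^sub>0 r"
  have K: "compact K" "K \<subseteq> S" using r(2) by (auto simp: K_def)
  have C2c: "C2_on S (c t)" "C2_on S (c' t)" if "t \<in> I" for t using c that by (simp_all add: C1_curve_on_def)
  \<comment> \<open>Kernel vectors are normalized: this makes \<open>Q\<close> compact and excludes
    \<open>u = 0\<close>.\<close>
  define Q where "Q = I \<times> K \<times> sphere (0::'b) 1"
  have "AE \<omega> in P. \<forall>z\<in>Q. defect S c c' (jet S (Y \<omega>)) z \<noteq> 0"
  proof (rule AE, intro conjI allI impI)
    show "compact Q" unfolding Q_def by (intro compact_Times I K(1)) simp
    show "Q \<subseteq> I \<times> (S \<inter> cball x\<^sub>0 r) \<times> UNIV" by (auto simp: Q_def K_def)
    have "continuous_on (I \<times> K) (\<lambda>z. c' (fst z) (snd z))"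
    proof (rule continuous_on_joint)
      fix t assume t: "t \<in> I"
      show "uniform_limit K c' (c' t) (at t within I)" using c K t by (simp add: C1_curve_on_def)
      show "continuous_on K (c' t)" by (rule continuous_on_subset[OF C2_onD(3)[OF C2c(2)[OF t]] K(2)])
    qed
    then show "continuous_on (I \<times> (S \<inter> cball x\<^sub>0 r)) (\<lambda>z. c' (fst z) (snd z))" by (simp add: K_def)
    fix f t x u assume "C2_on S f \<and> (t, x, u) \<in> Q \<and> defect S c c' (jet S f) (t, x, u) = 0"
    then have f: "C2_on S f" and t: "t \<in> I" and x: "x \<in> K" and u: "norm u = 1"
      and 0: "defect S c c' (jet S f) (t, x, u) = 0" by (auto simp: Q_def)
    have xS: "x \<in> S" using x K by blast
    let ?g = "\<lambda>y. c t y + f y"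
    have g: "C2_on S ?g" using C2_on_lincomb[OF U C2c(1)[OF t] f, where a = 1 and b = 1] by simp
    define D where "D z = fst z *\<^sub>R val_grad S (c' t) x + (grad S ?g x \<bullet> snd z, hess S ?g x (snd z))" for z
    have "((\<lambda>z. val_grad S (\<lambda>y. c (fst z) y + f y) (snd z)) has_derivative D) (at (t, x) within I \<times> K)"
      unfolding D_def by (rule has_derivative_val_grad_joint[OF U c f K t x])
    then have der: "((\<lambda>z. val_grad S (\<lambda>y. c (fst z) y + f y) (snd z)) has_derivative D)
        (at (t, x) within (\<lambda>z. (fst z, fst (snd z))) ` Q)"
      by (rule has_derivative_subset) (auto simp: Q_def)
    have vg: "val_grad S ?g x = 0" and deg: "c' t x = 0 \<or> hess S ?g x u = 0"
      using 0 unfolding defect_jet_eq_0[where c = c and t = t, OF U C2c(1)[OF t] f xS] by blast+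
    have grad0: "grad S ?g x = 0" using vg by (simp add: val_grad_def prod_eq_iff)
    have lin: "linear D" unfolding D_def by (rule linear_val_grad_derivative[OF U g xS])
    have "\<not> inj D"
    proof
      assume inj: "inj D"
      from deg show False
      proof
        \<comment> \<open>The image of \<open>D\<close> then lies in a hyperplane, so
          \<open>D\<close> is not onto and, in equal dimensions, not injective.\<close>
        assume "c' t x = 0"
        then have fst0: "fst (D z) = 0" for z by (simp add: D_def grad0 val_grad_def)
        have "surj D" by (rule linear_injective_imp_surjective[OF lin inj]) simp
        then obtain z where "(1, 0) = D z" by (rule surjE)
        then show False using fst0[of z] by (metis fst_conv zero_neq_one)
      next
        assume "hess S ?g x u = 0"
        then have "D (0, u) = 0" by (simp add: D_def grad0 prod_eq_iff)
        then have "(0, u) = (0 :: real \<times> 'b)" using inj linear_0[OF lin] by (metis injD)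
        then show False using u by (simp add: prod_eq_iff)
      qed
    qed
    then show "\<exists>D. ((\<lambda>z. val_grad S (\<lambda>y. c (fst z) y + f y) (snd z)) has_derivative D)
        (at (t, x) within (\<lambda>z. (fst z, fst (snd z))) ` Q) \<and> \<not> inj D"
      using der by blast
  qed
  then have "AE \<omega> in P. \<forall>x\<in>S \<inter> ball x\<^sub>0 r. \<forall>t\<in>I. val_grad S (\<lambda>y. c t y + Y \<omega> y) x = 0 \<longrightarrow>
    c' t x \<noteq> 0 \<and> (\<forall>u. hess S (\<lambda>y. c t y + Y \<omega> y) x u = 0 \<longrightarrow> u = 0)"
  proof (rule eventually_mono, intro ballI impI conjI allI)
    fix \<omega> x t assume no: "\<forall>z\<in>Q. defect S c c' (jet S (Y \<omega>)) z \<noteq> 0"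
      and x: "x \<in> S \<inter> ball x\<^sub>0 r" and t: "t \<in> I" and vg: "val_grad S (\<lambda>y. c t y + Y \<omega> y) x = 0"
    have xS: "x \<in> S" and xK: "x \<in> K" using x by (auto simp: K_def)
    note defect0 = defect_jet_eq_0[where c = c and t = t, OF U C2c(1)[OF t] C2 xS]
    have g: "C2_on S (\<lambda>y. c t y + Y \<omega> y)" using C2_on_lincomb[OF U C2c(1)[OF t] C2, where a = 1 and b = 1] by simp
    have key: "c' t x \<noteq> 0 \<and> hess S (\<lambda>y. c t y + Y \<omega> y) x u \<noteq> 0" if "norm u = 1" for u
    proof -
      have "(t, x, u) \<in> Q" using that t xK by (simp add: Q_def)
      then have "defect S c c' (jet S (Y \<omega>)) (t, x, u) \<noteq> 0" using no by blast
      then show ?thesis unfolding defect0 using vg by blast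
    qed
    \<comment> \<open>Any unit vector serves to extract the claim on the velocity.\<close>
    obtain b :: 'b where "b \<in> Basis" using nonempty_Basis by blast
    then show "c' t x \<noteq> 0" using key[of b] by simp
    fix u assume h: "hess S (\<lambda>y. c t y + Y \<omega> y) x u = 0"
    show "u = 0"
    proof (rule ccontr)
      assume "u \<noteq> 0"
      then have "norm (inverse (norm u) *\<^sub>R u) = 1" by simp
      then show False using key h linear_scale[OF linear_hess[OF U g xS], of "inverse (norm u)" u]
          by (metis scaleR_zero_right)
    qed
  qed
  then show "\<exists>r>0. AE \<omega> in P. \<forall>x\<in>S \<inter> ball x\<^sub>0 r. \<forall>t\<in>I. val_grad S (\<lambda>y. c t y + Y \<omega> y) x = 0 \<longrightarrow>
    c' t x \<noteq> 0 \<and> (\<forall>u. hess S (\<lambda>y. c t y + Y \<omega> y) x u = 0 \<longrightarrow> u = 0)"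
    using r(1) by blast
qed

text \<open>Restricted to boundary points the jet map has one variable fewer than equations, so all
  its zeros are singular. With \<rho> = 0 the defect vanishes at every critical zero, and
  \<open>u\<close> is frozen at 0.\<close>

lemma (in gaussian_space) no_boundary_zero_AE:
  fixes Y :: "'w \<Rightarrow> real \<times> 'e::euclidean_space \<Rightarrow> real"
  assumes U: "unique_derivs S" and C2: "\<And>\<omega>. C2_on S (Y \<omega>)" and V: "\<And>x. x \<in> S \<Longrightarrow> (\<lambda>\<omega>. Y \<omega> x) \<in> V"
    and c: "C1_curve_on S I c c'" and I: "compact I"
    and loc: "\<And>x. x \<in> S \<Longrightarrow> \<exists>r>0. compact (S \<inter> cball x r)"
    and nondeg: "\<And>x \<eta>. x \<in> S \<Longrightarrow> \<eta> \<noteq> 0 \<Longrightarrow> expectation (\<lambda>\<omega>. (val_grad S (Y \<omega>) x \<bullet> \<eta>)\<^sup>2) \<noteq> 0"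
  shows "AE \<omega> in P. \<forall>x\<in>S. fst x = 0 \<longrightarrow> (\<forall>t\<in>I. val_grad S (\<lambda>y. c t y + Y \<omega> y) x \<noteq> 0)"
proof (rule AE_locally)
  fix x\<^sub>0 assume x0: "x\<^sub>0 \<in> S"
  obtain r where r: "r > 0" "compact (S \<inter> cball x\<^sub>0 r)"
    and AE: "\<And>Q \<rho>. compact Q \<and> Q \<subseteq> I \<times> (S \<inter> cball x\<^sub>0 r) \<times> UNIV
    \<and> continuous_on (I \<times> (S \<inter> cball x\<^sub>0 r)) (\<lambda>z. \<rho> (fst z) (snd z))
    \<and> (\<forall>f t x u. C2_on S f \<and> (t, x, u) \<in> Q \<and> defect S c \<rho> (jet S f) (t, x, u) = 0 \<longrightarrow>
        (\<exists>D. ((\<lambda>z. val_grad S (\<lambda>y. c (fst z) y + f y) (snd z)) has_derivative D)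
          (at (t, x) within (\<lambda>z. (fst z, fst (snd z))) ` Q) \<and> \<not> inj D))
    \<Longrightarrow> (AE \<omega> in P. \<forall>z\<in>Q. defect S c \<rho> (jet S (Y \<omega>)) z \<noteq> 0)"
    using local_defect_nonzero_AE[OF U C2 V c loc[OF x0] x0 nondeg[OF x0]] by blast
  define K where "K = S \<inter> cball x\<^sub>0 r"
  have K: "compact K" "K \<subseteq> S" using r(2) by (auto simp: K_def)
  have C2c: "C2_on S (c t)" if "t \<in> I" for t using c that by (simp_all add: C1_curve_on_def)
  define Q where "Q = I \<times> (K \<inter> {x. fst x = 0}) \<times> {0 :: real \<times> 'e}"
  have "AE \<omega> in P. \<forall>z\<in>Q. defect S c (\<lambda>_ _. 0) (jet S (Y \<omega>)) z \<noteq> 0"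
  proof (rule AE, intro conjI allI impI)
    have "closed {x :: real \<times> 'e. fst x = 0}"
      by (intro closed_Collect_eq continuous_intros)
    then show "compact Q" unfolding Q_def by (intro compact_Times I compact_Int_closed K(1)) simp_all
    show "Q \<subseteq> I \<times> (S \<inter> cball x\<^sub>0 r) \<times> UNIV" by (auto simp: Q_def K_def)
    show "continuous_on (I \<times> (S \<inter> cball x\<^sub>0 r)) (\<lambda>z. 0 :: real)" by (rule continuous_on_const)
    fix f t x u assume "C2_on S f \<and> (t, x, u) \<in> Q \<and> defect S c (\<lambda>_ _. 0) (jet S f) (t, x, u) = 0"
    then have f: "C2_on S f" and t: "t \<in> I" and x: "x \<in> K" and fx: "fst x = 0" by (auto simp: Q_def)
    have xS: "x \<in> S" using x K by blast
    define Z where "Z = (\<lambda>z. (fst z, fst (snd z))) ` Q"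
    have Z: "z \<in> Z \<Longrightarrow> fst z \<in> I \<and> snd z \<in> K \<and> fst (snd z) = 0" for z by (auto simp: Z_def Q_def)
    obtain D where "((\<lambda>z. val_grad S (\<lambda>y. c (fst z) y + f y) (snd z)) has_derivative D) (at (t, x) within I \<times> K)"
      using has_derivative_val_grad_joint[OF U c f K t x] by blast
    then have der: "((\<lambda>z. val_grad S (\<lambda>y. c (fst z) y + f y) (snd z)) has_derivative D) (at (t, x) within Z)"
      by (rule has_derivative_subset) (auto simp: Z_def Q_def)
    \<comment> \<open>Increments within the slice are fixed by the projection \<open>p\<close>, so
      \<open>D \<circ> p\<close> is also a derivative within the slice, and it kills the normal
      direction.\<close>
    define p where "p z = (fst z, 0 :: real, snd (snd z))" for z :: "real \<times> real \<times> 'e"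
    have blp: "bounded_linear p"
      unfolding p_def[abs_def]
      by (intro bounded_linear_Pair bounded_linear_fst bounded_linear_zero bounded_linear_snd_comp
          bounded_linear_snd)
    have "((\<lambda>z. val_grad S (\<lambda>y. c (fst z) y + f y) (snd z)) has_derivative (\<lambda>z. D (p z))) (at (t, x) within Z)"
    proof -
      have "p (y - (t, x)) = y - (t, x)" if "y \<in> Z" for y
        using Z[OF that] fx by (simp add: p_def prod_eq_iff)
      then show ?thesis
        using der bounded_linear_compose[OF _ blp, of D] unfolding has_derivative_within_alt by simp
    qed
    moreover have "\<not> inj (\<lambda>z. D (p z))"
    proof
      assume "inj (\<lambda>z. D (p z))"
      moreover have "D (p (0, 1, 0)) = D (p (0, 0, 0))" by (simp add: p_def)
      ultimately have "(0 :: real, 1 :: real, 0 :: 'e) = (0, 0, 0)" by (rule injD)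
      then show False by simp
    qed
    ultimately show "\<exists>D. ((\<lambda>z. val_grad S (\<lambda>y. c (fst z) y + f y) (snd z)) has_derivative D)
        (at (t, x) within (\<lambda>z. (fst z, fst (snd z))) ` Q) \<and> \<not> inj D"
      unfolding Z_def by blast
  qed
  then have "AE \<omega> in P. \<forall>x\<in>S \<inter> ball x\<^sub>0 r. fst x = 0 \<longrightarrow> (\<forall>t\<in>I. val_grad S (\<lambda>y. c t y + Y \<omega> y) x \<noteq> 0)"
  proof (rule eventually_mono, intro ballI impI)
    fix \<omega> x t assume no: "\<forall>z\<in>Q. defect S c (\<lambda>_ _. 0) (jet S (Y \<omega>)) z \<noteq> 0"
      and x: "x \<in> S \<inter> ball x\<^sub>0 r" and t: "t \<in> I" and fx: "fst x = 0"
    have xS: "x \<in> S" and xK: "x \<in> K" using x by (auto simp: K_def)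
    have "(t, x, 0) \<in> Q" using t xK fx by (simp add: Q_def)
    then have "defect S c (\<lambda>_ _. 0) (jet S (Y \<omega>)) (t, x, 0) \<noteq> 0" using no by blast
    then show "val_grad S (\<lambda>y. c t y + Y \<omega> y) x \<noteq> 0"
      unfolding defect_jet_eq_0[where c = c and t = t, OF U C2c[OF t] C2 xS] by blast
  qed
  then show "\<exists>r>0. AE \<omega> in P. \<forall>x\<in>S \<inter> ball x\<^sub>0 r. fst x = 0 \<longrightarrow> (\<forall>t\<in>I. val_grad S (\<lambda>y. c t y + Y \<omega> y) x \<noteq> 0)"
    using r(1) by blast
qed

section \<open>Isolated zeros and the velocity of curves in the discriminant\<close>

text \<open>An injective linear map is bounded below by some \<open>k\<close>; near \<open>z\<close>
  the remainder is at most \<open>k / 2\<close> times the distance, which leaves no room for a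
  second zero.\<close>

lemma isolated_zero:
  fixes F :: "'a::euclidean_space \<Rightarrow> 'c::euclidean_space"
  assumes der: "(F has_derivative D) (at z within Z)" and inj: "inj D" and z: "F z = 0"
  shows "\<exists>d>0. \<forall>w\<in>Z. dist w z < d \<and> F w = 0 \<longrightarrow> w = z"
proof -
  have lin: "linear D" using der by (rule has_derivative_linear)
  obtain k where k: "k > 0" "\<And>v. k * norm v \<le> norm (D v)"
    using linear_inj_bounded_below_pos[OF lin inj] by metis
  have "k / 2 > 0" using k by simp
  then obtain d where d: "d > 0" "\<And>w. w \<in> Z \<Longrightarrow> norm (w - z) < d \<Longrightarrow> norm (F w - F z - D (w - z))
      \<le> k / 2 * norm (w - z)"
    using der unfolding has_derivative_within_alt by meson
  have "w = z" if "w \<in> Z" "dist w z < d" "F w = 0" for w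
  proof -
    have "norm (D (w - z)) \<le> k / 2 * norm (w - z)"
      using d(2)[OF that(1)] that(2,3) z by (simp add: dist_norm)
    then have "k * norm (w - z) \<le> k / 2 * norm (w - z)" using k(2)[of "w - z"] by linarith
    then have "k * norm (w - z) \<le> 0" by simp
    then show ?thesis using k(1) by (simp add: mult_le_0_iff)
  qed
  then show ?thesis using d(1) by blast
qed

text \<open>By continuity the limit point is a critical zero. If the Hessian there were
  nondegenerate and the velocity nonzero, the derivative of the jet map would be injective and
  \<open>(0, x)\<close> an isolated zero; but the zeros \<open>(s n, X n)\<close> converge to it
  with \<open>s n \<noteq> 0\<close>.\<close>

lemma critical_zero_velocity:
  fixes S :: "'b::euclidean_space set"
  assumes U: "unique_derivs S" and \<gamma>: "C1_curve_on S UNIV \<gamma> \<gamma>'" and K: "compact K" "K \<subseteq> S"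
    and s: "s \<longlonglongrightarrow> 0" "\<And>n. s n \<noteq> (0::real)" and x: "X \<longlonglongrightarrow> x" "\<And>n. X n \<in> K" "x \<in> K"
    and crit: "\<And>n. val_grad S (\<gamma> (s n)) (X n) = 0"
  shows "val_grad S (\<gamma> 0) x = 0"
    and "(\<And>u. hess S (\<gamma> 0) x u = 0 \<Longrightarrow> u = 0) \<Longrightarrow> \<gamma>' 0 x = 0"
proof -
  have xS: "x \<in> S" using x K by blast
  note z = C2_on_zero[OF U]
  have C2: "C2_on S (\<gamma> 0)" using \<gamma> by (simp add: C1_curve_on_def)
  have lim: "(\<lambda>n. (s n, X n)) \<longlonglongrightarrow> (0, x)" by (intro tendsto_Pair s x)
  have "continuous_on (UNIV \<times> K) (\<lambda>z. val_grad S (\<gamma> (fst z)) (snd z))"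
    using continuous_val_grad_joint[OF U \<gamma> z K] by simp
  then have "(\<lambda>n. (\<lambda>z. val_grad S (\<gamma> (fst z)) (snd z)) (s n, X n)) \<longlonglongrightarrow> (\<lambda>z. val_grad S (\<gamma> (fst z)) (snd z)) (0, x)"
    by (intro continuous_on_tendsto_compose[where f = "\<lambda>z. val_grad S (\<gamma> (fst z)) (snd z)"
        and s = "UNIV \<times> K", OF _ lim])
      (use x(2,3) in simp_all)
  then show vg: "val_grad S (\<gamma> 0) x = 0" using crit by (simp add: LIMSEQ_const_iff)
  then have grad0: "grad S (\<gamma> 0) x = 0" by (simp add: val_grad_def prod_eq_iff)
  assume h: "\<And>u. hess S (\<gamma> 0) x u = 0 \<Longrightarrow> u = 0"
  define D where "D z = fst z *\<^sub>R val_grad S (\<gamma>' 0) x + (grad S (\<gamma> 0) x \<bullet> snd z, hess S (\<gamma> 0) x (snd z))" for z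
  have der: "((\<lambda>z. val_grad S (\<gamma> (fst z)) (snd z)) has_derivative D) (at (0, x) within UNIV \<times> K)"
    using has_derivative_val_grad_joint[OF U \<gamma> z K UNIV_I x(3)] by (simp add: D_def[abs_def])
  have lin: "linear D" unfolding D_def by (rule linear_val_grad_derivative[OF U C2 xS])
  show "\<gamma>' 0 x = 0"
  proof (rule ccontr)
    assume "\<gamma>' 0 x \<noteq> 0"
    have "inj D"
      unfolding linear_injective_0[OF lin]
    proof (intro allI impI)
      fix z assume "D z = 0"
      then have "fst z * \<gamma>' 0 x = 0" "fst z *\<^sub>R grad S (\<gamma>' 0) x + hess S (\<gamma> 0) x (snd z) = 0"
        by (simp_all add: D_def grad0 val_grad_def prod_eq_iff)
      then have "fst z = 0" "hess S (\<gamma> 0) x (snd z) = 0" using \<open>\<gamma>' 0 x \<noteq> 0\<close> by simp_all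
      then show "z = 0" using h by (simp add: prod_eq_iff)
    qed
    then obtain d where d: "d > 0" "\<And>w. w \<in> UNIV \<times> K \<Longrightarrow> dist w (0, x) < d \<Longrightarrow> val_grad S (\<gamma> (fst w)) (snd w) = 0
        \<Longrightarrow> w = (0, x)"
      using isolated_zero[OF der] vg by (metis fst_conv snd_conv)
    obtain n where "dist (s n, X n) (0, x) < d" using lim d(1) by (meson metric_LIMSEQ_D order_refl)
    then have "(s n, X n) = (0, x)" using x(2) crit by (intro d(2)) auto
    then show False using s(2)[of n] by simp
  qed
qed

lemma dir_deriv_Int_open:
  assumes "open U" "x \<in> S \<inter> U"
  shows "dir_deriv (S \<inter> U) v f x = dir_deriv S v f x"
proof -
  have "at x within (S \<inter> U) = at x within S"
    using assms by (intro at_within_nhd[of x U]) auto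
  then show ?thesis by (simp add: dir_deriv_def)
qed

text \<open>The derivative is bounded by some \<open>B\<close> on the compact \<open>K\<close>, so
  the quotients are eventually below \<open>B + 1\<close> and the increments are uniformly of order
  \<open>\<bar>s - t\<bar>\<close>.\<close>

lemma uniform_limit_if_difference_quotient:
  fixes q :: "real \<Rightarrow> 'b::topological_space \<Rightarrow> real"
  assumes unif: "uniform_limit K (\<lambda>s x. (q s x - q t x) / (s - t)) q' (at t within I)"
    and K: "compact K" and cont: "continuous_on K q'"
  shows "uniform_limit K q (q t) (at t within I)"
  unfolding uniform_limit_iff
proof (intro allI impI)
  fix e :: real assume e: "e > 0"
  have "bounded (q' ` K)" using compact_continuous_image[OF cont K] by (rule compact_imp_bounded)
  then obtain B where B: "B > 0" "\<And>x. x \<in> K \<Longrightarrow> \<bar>q' x\<bar> \<le> B" unfolding bounded_pos by auto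
  have "\<forall>\<^sub>F s in at t within I. \<forall>x\<in>K. dist ((q s x - q t x) / (s - t)) (q' x) < 1"
    using unif zero_less_one unfolding uniform_limit_iff by blast
  moreover have "\<forall>\<^sub>F s in at t within I. dist s t < e / (B + 1) \<and> s \<noteq> t"
    using e B(1) unfolding eventually_at by (intro exI[of _ "e / (B + 1)"]) simp
  ultimately show "\<forall>\<^sub>F s in at t within I. \<forall>x\<in>K. dist (q s x) (q t x) < e"
  proof eventually_elim
    case (elim s)
    show ?case
    proof
      fix x assume x: "x \<in> K"
      have "\<bar>(q s x - q t x) / (s - t)\<bar> \<le> B + 1"
      proof -
        have "\<bar>(q s x - q t x) / (s - t) - q' x\<bar> < 1" using elim(1) x by (simp add: dist_real_def)
        then show ?thesis using B(2)[OF x] by linarith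
      qed
      then have "\<bar>q s x - q t x\<bar> \<le> (B + 1) * \<bar>s - t\<bar>"
        using elim(2) by (simp add: abs_divide pos_divide_le_eq)
      also have "\<dots> < e"
        using elim(2) B(1) by (simp add: dist_real_def pos_less_divide_eq mult.commute)
      finally show "dist (q s x) (q t x) < e" by (simp add: dist_real_def)
    qed
  qed
qed

text \<open>Where one factor vanishes, continuity of the other suffices for the product rule. Hence
  at a critical point the Hessian transforms without differentiating the Jacobian.\<close>

lemma has_derivative_mult_zero:
  fixes a b :: "'b::real_normed_vector \<Rightarrow> real"
  assumes a: "(a has_derivative a') (at x within S)" "a x = 0" and b: "continuous (at x within S) b"
  shows "((\<lambda>y. a y * b y) has_derivative (\<lambda>u. a' u * b x)) (at x within S)"
  unfolding has_derivative_within_alt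
proof (intro conjI allI impI)
  have bl: "bounded_linear a'" using a(1) by (rule has_derivative_bounded_linear)
  show "bounded_linear (\<lambda>u. a' u * b x)" using bl by (rule bounded_linear_mult_const)
  obtain C where C: "C > 0" "\<And>u. norm (a' u) \<le> norm u * C" using bounded_linear.pos_bounded[OF bl] by blast
  fix e :: real assume e: "e > 0"
  define B where "B = \<bar>b x\<bar> + 1"
  have B: "B > 0" by (simp add: B_def)
  define e1 where "e1 = e / (2 * B)"
  \<comment> \<open>The bound 1 keeps \<open>b y\<close> below
    \<open>B = \<bar>b x\<bar> + 1\<close>; the two error terms then contribute \<open>e / 2\<close>
    each.\<close>
  define e2 where "e2 = min 1 (e / (2 * C))"
  have e12: "e1 > 0" "e2 > 0" using e B C by (simp_all add: e1_def e2_def)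
  obtain d1 where d1: "d1 > 0" "\<And>y. y \<in> S \<Longrightarrow> norm (y - x) < d1 \<Longrightarrow> norm (a y - a x - a' (y - x)) \<le> e1 * norm (y - x)"
    using a(1) e12(1) unfolding has_derivative_within_alt by meson
  obtain d2 where d2: "d2 > 0" "\<And>y. y \<in> S \<Longrightarrow> dist y x < d2 \<Longrightarrow> dist (b y) (b x) < e2"
    using b e12(2) unfolding continuous_within_eps_delta by meson
  show "\<exists>d>0. \<forall>y\<in>S. norm (y - x) < d \<longrightarrow> norm (a y * b y - a x * b x - a' (y - x) * b x) \<le> e * norm (y - x)"
  proof (intro exI[of _ "min d1 d2"] conjI ballI impI)
    fix y assume y: "y \<in> S" "norm (y - x) < min d1 d2"
    have b1: "\<bar>b y - b x\<bar> < e2" using d2(2)[OF y(1)] y(2) by (simp add: dist_norm)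
    then have bB: "\<bar>b y\<bar> \<le> B" unfolding B_def e2_def by linarith
    have "a y * b y - a x * b x - a' (y - x) * b x = (a y - a x - a' (y - x)) * b y + a' (y - x) * (b y - b x)"
      by (simp add: a(2) algebra_simps)
    then have "norm (a y * b y - a x * b x - a' (y - x) * b x)
        \<le> norm (a y - a x - a' (y - x)) * \<bar>b y\<bar> + norm (a' (y - x)) * \<bar>b y - b x\<bar>"
      by (metis norm_triangle_ineq norm_mult real_norm_def)
    also have "\<dots> \<le> (e1 * norm (y - x)) * B + (norm (y - x) * C) * (e / (2 * C))"
      using d1(2)[OF y(1)] y(2) bB b1 C e12
      by (intro add_mono mult_mono) (auto simp: e2_def)
    also have "\<dots> = e * norm (y - x)" using B C by (simp add: e1_def)
    finally show "norm (a y * b y - a x * b x - a' (y - x) * b x) \<le> e * norm (y - x)" .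
  qed (use d1 d2 in simp)
qed

section \<open>Change of charts\<close>

text \<open>Two overlapping charts of a manifold, or of its boundary: \<open>\<tau>\<close> is the change of coordinates
  from \<open>S\<close> to \<open>T\<close>, defined on \<open>S \<inter> U\<close>.\<close>

locale coordinate_change =
  fixes S T U W :: "'b::euclidean_space set" and \<tau> \<sigma> :: "'b \<Rightarrow> 'b"
  assumes uS: "unique_derivs (S \<inter> U)" and uT: "unique_derivs (T \<inter> W)" and opn: "open U" "open W"
    and \<tau>: "\<And>x. x \<in> S \<inter> U \<Longrightarrow> \<tau> x \<in> T \<inter> W" "\<And>x. x \<in> S \<inter> U \<Longrightarrow> \<sigma> (\<tau> x) = x"
    and \<sigma>: "\<And>x. x \<in> T \<inter> W \<Longrightarrow> \<sigma> x \<in> S \<inter> U" "\<And>x. x \<in> T \<inter> W \<Longrightarrow> \<tau> (\<sigma> x) = x"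
    and diff: "\<tau> differentiable_on (S \<inter> U)" "\<sigma> differentiable_on (T \<inter> W)"
    and C1: "\<And>v. continuous_on (S \<inter> U) (dir_deriv (S \<inter> U) v \<tau>)"
begin

definition jac :: "'b \<Rightarrow> 'b \<Rightarrow> 'b" where
  "jac x v = dir_deriv (S \<inter> U) v \<tau> x"

lemma has_derivative_jac: "x \<in> S \<inter> U \<Longrightarrow> (\<tau> has_derivative jac x) (at x within S \<inter> U)"
  using has_derivative_dir_deriv[OF diff(1)] by (simp add: jac_def[abs_def])

lemma linear_jac: "x \<in> S \<inter> U \<Longrightarrow> linear (jac x)"
  using has_derivative_jac by (rule has_derivative_linear)

text \<open>The chain rule for \<open>\<sigma> \<circ> \<tau>\<close>, which is the identity on
  \<open>S \<inter> U\<close>, gives a left inverse; uniqueness of derivatives within that set makes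
  the two derivatives equal.\<close>

lemma inj_jac:
  assumes x: "x \<in> S \<inter> U"
  shows "inj (jac x)"
proof -
  let ?M = "\<lambda>v. dir_deriv (T \<inter> W) v \<sigma> (\<tau> x)"
  have sub: "\<tau> ` (S \<inter> U) \<subseteq> T \<inter> W" using \<tau>(1) by blast
  have "(\<sigma> has_derivative ?M) (at (\<tau> x) within \<tau> ` (S \<inter> U))"
    using has_derivative_subset[OF has_derivative_dir_deriv[OF diff(2) \<tau>(1)[OF x]] sub] .
  then have "(\<sigma> \<circ> \<tau> has_derivative ?M \<circ> jac x) (at x within S \<inter> U)"
    by (rule diff_chain_within[OF has_derivative_jac[OF x]])
  then have id: "((\<lambda>y. y) has_derivative ?M \<circ> jac x) (at x within S \<inter> U)"
    by (rule has_derivative_transform[OF x, rotated]) (simp add: \<tau>(2))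
  have "dir_deriv (S \<inter> U) v (\<lambda>y. y) x = ?M (jac x v)" for v
    using dir_deriv_eq[OF uS x id, of v] by simp
  moreover have "dir_deriv (S \<inter> U) v (\<lambda>y. y) x = v" for v
    by (rule dir_deriv_eq[OF uS x]) (rule has_derivative_ident)
  ultimately show ?thesis by (metis injI)
qed

lemma surj_jac: "x \<in> S \<inter> U \<Longrightarrow> surj (jac x)"
  by (rule linear_injective_imp_surjective[OF linear_jac inj_jac]) simp_all

lemma dir_deriv_change:
  fixes f h :: "'b \<Rightarrow> real"
  assumes h: "h differentiable_on T" and fh: "\<And>y. y \<in> S \<inter> U \<Longrightarrow> f y = h (\<tau> y)" and x: "x \<in> S \<inter> U"
  shows "dir_deriv S v f x = dir_deriv T (jac x v) h (\<tau> x)"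
proof -
  have sub: "\<tau> ` (S \<inter> U) \<subseteq> T" and tx: "\<tau> x \<in> T" using \<tau>(1) x by blast+
  have "(h has_derivative (\<lambda>v. dir_deriv T v h (\<tau> x))) (at (\<tau> x) within \<tau> ` (S \<inter> U))"
    by (rule has_derivative_subset[OF has_derivative_dir_deriv[OF h tx] sub])
  from diff_chain_within[OF has_derivative_jac[OF x] this]
  have "(f has_derivative (\<lambda>v. dir_deriv T v h (\<tau> x)) \<circ> jac x) (at x within S \<inter> U)"
    by (rule has_derivative_transform[OF x, rotated]) (simp add: fh)
  from dir_deriv_eq[OF uS x this, of v] show ?thesis
    by (simp add: dir_deriv_Int_open[OF opn(1) x])
qed

lemma critical_change:
  fixes f h :: "'b \<Rightarrow> real"
  assumes h: "h differentiable_on T" and fh: "\<And>y. y \<in> S \<inter> U \<Longrightarrow> f y = h (\<tau> y)" and x: "x \<in> S \<inter> U"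
  shows "(\<forall>v. dir_deriv S v f x = 0) \<longleftrightarrow> (\<forall>v. dir_deriv T v h (\<tau> x) = 0)"
  using dir_deriv_change[OF assms] surj_jac[OF x] by (metis surjE)

text \<open>At a critical point the Hessian of \<open>f\<close> is that of \<open>h\<close> with the
  invertible Jacobian applied to both arguments, so its kernel is trivial as well.\<close>

lemma nondegenerate_change:
  fixes f h :: "'b \<Rightarrow> real"
  assumes uT': "unique_derivs T" and h: "C2_on T h" and fh: "\<And>y. y \<in> S \<inter> U \<Longrightarrow> f y = h (\<tau> y)" and x: "x \<in> S \<inter> U"
    and crit: "\<forall>v. dir_deriv T v h (\<tau> x) = 0"
    and hess: "\<And>u. hess T h (\<tau> x) u = 0 \<Longrightarrow> u = 0"
  shows "nondegenerate (\<lambda>u v. dir_deriv S u (dir_deriv S v f) x)"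
proof -
  have tx: "\<tau> x \<in> T" using \<tau>(1) x by blast
  have sub: "\<tau> ` (S \<inter> U) \<subseteq> T" using \<tau>(1) by blast
  have bilin: "dir_deriv S u (dir_deriv S v f) x = hess T h (\<tau> x) (jac x u) \<bullet> jac x v" for u v
  proof -
    have eq: "dir_deriv S v f y = (\<Sum>b\<in>Basis. dir_deriv T b h (\<tau> y) * (jac y v \<bullet> b))" if y: "y \<in> S \<inter> U" for y
    proof -
      have "dir_deriv S v f y = dir_deriv T (jac y v) h (\<tau> y)"
        by (rule dir_deriv_change[OF C2_onD(1)[OF h] fh y])
      moreover have "\<tau> y \<in> T" using \<tau>(1)[OF y] by blast
      ultimately show ?thesis
        using dir_deriv_Basis[OF C2_onD(1)[OF h], of "\<tau> y" "jac y v"] by (simp add: mult.commute)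
    qed
    have "((\<lambda>y. dir_deriv T b h (\<tau> y) * (jac y v \<bullet> b)) has_derivative
        (\<lambda>u. dir_deriv T (jac x u) (dir_deriv T b h) (\<tau> x) * (jac x v \<bullet> b))) (at x within S \<inter> U)" for b
    proof (rule has_derivative_mult_zero)
      have "(dir_deriv T b h has_derivative (\<lambda>v. dir_deriv T v (dir_deriv T b h) (\<tau> x)))
          (at (\<tau> x) within \<tau> ` (S \<inter> U))"
        by (rule has_derivative_subset[OF has_derivative_dir_deriv[OF C2_onD(2)[OF h] tx] sub])
      from diff_chain_within[OF has_derivative_jac[OF x] this]
      show "((\<lambda>y. dir_deriv T b h (\<tau> y)) has_derivative (\<lambda>u. dir_deriv T (jac x u) (dir_deriv T b h) (\<tau> x)))
          (at x within S \<inter> U)"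
        by (simp add: comp_def)
      show "dir_deriv T b h (\<tau> x) = 0" using crit by blast
      have "continuous_on (S \<inter> U) (\<lambda>y. jac y v \<bullet> b)"
        unfolding jac_def by (intro continuous_on_inner continuous_on_const C1)
      then show "continuous (at x within S \<inter> U) (\<lambda>y. jac y v \<bullet> b)"
        using x by (simp add: continuous_on_eq_continuous_within)
    qed
    then have "((\<lambda>y. \<Sum>b\<in>Basis. dir_deriv T b h (\<tau> y) * (jac y v \<bullet> b)) has_derivative
        (\<lambda>u. \<Sum>b\<in>Basis. dir_deriv T (jac x u) (dir_deriv T b h) (\<tau> x) * (jac x v \<bullet> b))) (at x within S \<inter> U)"
      by (intro has_derivative_sum)
    then have "(dir_deriv S v f has_derivative
        (\<lambda>u. \<Sum>b\<in>Basis. dir_deriv T (jac x u) (dir_deriv T b h) (\<tau> x) * (jac x v \<bullet> b))) (at x within S \<inter> U)"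
      by (rule has_derivative_transform[OF x, rotated]) (rule eq)
    from dir_deriv_eq[OF uS x this, of u] have "dir_deriv S u (dir_deriv S v f) x
        = (\<Sum>b\<in>Basis. dir_deriv T (jac x u) (dir_deriv T b h) (\<tau> x) * (jac x v \<bullet> b))"
      by (simp only: dir_deriv_Int_open[OF opn(1) x])
    also have "\<dots> = hess T h (\<tau> x) (jac x u) \<bullet> jac x v"
      unfolding hess_def inner_sum_left inner_scaleR_left by (intro sum.cong refl) (simp add: inner_commute)
    finally show ?thesis .
  qed
  show ?thesis
    unfolding nondegenerate_def
  proof (intro allI impI)
    fix u assume "\<forall>v. dir_deriv S u (dir_deriv S v f) x = 0"
    then have "hess T h (\<tau> x) (jac x u) \<bullet> w = 0" for w
      using bilin surj_jac[OF x] by (metis surjE)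
    then have "hess T h (\<tau> x) (jac x u) = 0" by (metis inner_eq_zero_iff)
    then have "jac x u = 0" by (rule hess)
    then show "u = 0" using inj_jac[OF x] linear_0[OF linear_jac[OF x]] by (metis injD)
  qed
qed

end

section \<open>Restriction to the boundary\<close>

lemma openin_half_space_Pair:
  assumes "openin (top_of_set half_space) S"
  shows "open {y. (0, y) \<in> S}"
proof -
  obtain Q where Q: "open Q" "S = half_space \<inter> Q" using assms by (auto simp: openin_open)
  have "{y. (0, y) \<in> S} = Pair 0 -` Q" by (auto simp: Q half_space_def)
  moreover have "open (Pair 0 -` Q)" by (intro open_vimage Q(1) continuous_intros)
  ultimately show ?thesis by simp
qed

lemma locally_compact_half_space:
  fixes S :: "(real \<times> 'e::euclidean_space) set"
  assumes "openin (top_of_set half_space) S" "x \<in> S"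
  shows "\<exists>r>0. compact (S \<inter> cball x r)"
proof -
  obtain Q where Q: "open Q" "S = half_space \<inter> Q" using assms by (auto simp: openin_open)
  then obtain r where r: "r > 0" "cball x r \<subseteq> Q" using assms(2) by (meson IntD2 open_contains_cball)
  have "closed (half_space :: (real \<times> 'e) set)"
    unfolding half_space_def by (intro closed_Collect_le continuous_intros)
  moreover have "S \<inter> cball x r = cball x r \<inter> half_space" using r(2) Q(2) by blast
  ultimately show ?thesis using r(1) compact_Int_closed[OF compact_cball] by metis
qed

lemma locally_compact_open:
  fixes S :: "'b::euclidean_space set"
  assumes "open S" "x \<in> S"
  shows "\<exists>r>0. compact (S \<inter> cball x r)"
proof -
  obtain r where r: "r > 0" "cball x r \<subseteq> S" using assms by (meson open_contains_cball)
  then have "S \<inter> cball x r = cball x r" by blast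
  then show ?thesis using r(1) compact_cball by metis
qed

context
  fixes S :: "(real \<times> 'e::euclidean_space) set"
  assumes S: "openin (top_of_set half_space) S"
begin

lemma unique_derivs_restrict: "unique_derivs {y. (0, y) \<in> S}"
  by (rule unique_derivs_open[OF openin_half_space_Pair[OF S]])

lemma has_derivative_restrict:
  assumes "f differentiable_on S" "(0, y) \<in> S"
  shows "((\<lambda>y. f (0, y)) has_derivative (\<lambda>v. dir_deriv S (0, v) f (0, y))) (at y within {y. (0, y) \<in> S})"
proof -
  have "(f has_derivative (\<lambda>v. dir_deriv S v f (0, y))) (at (0, y) within Pair 0 ` {y. (0, y) \<in> S})"
    by (rule has_derivative_subset[OF has_derivative_dir_deriv[OF assms]]) auto
  moreover have "(Pair 0 has_derivative Pair 0) (at y within {y. (0, y) \<in> S})"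
    by (auto intro!: derivative_eq_intros)
  ultimately show ?thesis
    using diff_chain_within[of "Pair 0" "Pair 0" y _ f] by (simp add: comp_def)
qed

lemma dir_deriv_restrict:
  assumes "f differentiable_on S" "(0, y) \<in> S"
  shows "dir_deriv {y. (0, y) \<in> S} v (\<lambda>y. f (0, y)) y = dir_deriv S (0, v) f (0, y)"
  by (rule dir_deriv_eq[OF unique_derivs_restrict _ has_derivative_restrict[OF assms]]) (simp add: assms)

lemma continuous_on_restrict:
  assumes "continuous_on S f"
  shows "continuous_on {y. (0, y) \<in> S} (\<lambda>y. f (0, y))"
  by (rule continuous_on_compose2[OF assms]) (auto intro!: continuous_intros)

lemma C1_on_restrict:
  fixes f :: "real \<times> 'e \<Rightarrow> real"
  assumes "C1_on S f"
  shows "C1_on {y. (0, y) \<in> S} (\<lambda>y. f (0, y))"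
proof -
  have d: "f differentiable_on S" using assms by (simp add: C1_on_def)
  have "(\<lambda>y. f (0, y)) differentiable_on {y. (0, y) \<in> S}"
    unfolding differentiable_on_def using has_derivative_restrict[OF d] by (auto intro: differentiableI)
  moreover have "continuous_on {y. (0, y) \<in> S} (dir_deriv {y. (0, y) \<in> S} v (\<lambda>y. f (0, y)))" for v
  proof (rule continuous_on_eq)
    show "continuous_on {y. (0, y) \<in> S} (\<lambda>y. dir_deriv S (0, v) f (0, y))"
      using assms by (intro continuous_on_restrict) (simp add: C1_on_def)
  qed (simp add: dir_deriv_restrict[OF d])
  ultimately show ?thesis by (simp add: C1_on_def)
qed

lemma C2_on_restrict:
  fixes f :: "real \<times> 'e \<Rightarrow> real"
  assumes f: "C2_on S f"
  shows "C2_on {y. (0, y) \<in> S} (\<lambda>y. f (0, y))"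
proof -
  have "C1_on S f" using C2_onD[OF f] by (simp add: C1_on_def)
  then have "(\<lambda>y. f (0, y)) differentiable_on {y. (0, y) \<in> S}"
    using C1_on_restrict by (simp add: C1_on_def)
  moreover have "C1_on {y. (0, y) \<in> S} (dir_deriv {y. (0, y) \<in> S} v (\<lambda>y. f (0, y)))" for v
    using f by (intro C1_on_cong[OF C1_on_restrict[of "dir_deriv S (0, v) f"]])
      (simp_all add: dir_deriv_restrict[OF C2_onD(1)[OF f]] C2_on_def)
  ultimately show ?thesis by (simp add: C2_on_def)
qed

lemma dir_deriv2_restrict:
  fixes f :: "real \<times> 'e \<Rightarrow> real"
  assumes f: "C2_on S f" and y: "(0, y) \<in> S"
  shows "dir_deriv {y. (0, y) \<in> S} u (dir_deriv {y. (0, y) \<in> S} v (\<lambda>y. f (0, y))) y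
    = dir_deriv S (0, u) (dir_deriv S (0, v) f) (0, y)"
proof -
  have "dir_deriv {y. (0, y) \<in> S} u (dir_deriv {y. (0, y) \<in> S} v (\<lambda>y. f (0, y))) y
      = dir_deriv {y. (0, y) \<in> S} u (\<lambda>y. dir_deriv S (0, v) f (0, y)) y"
    using y by (intro dir_deriv_cong) (simp_all add: dir_deriv_restrict[OF C2_onD(1)[OF f]])
  then show ?thesis by (simp add: dir_deriv_restrict[OF C2_onD(2)[OF f] y])
qed

lemma C1_curve_on_restrict:
  assumes c: "C1_curve_on S I c c'"
  shows "C1_curve_on {y. (0, y) \<in> S} I (\<lambda>t y. c t (0, y)) (\<lambda>t y. c' t (0, y))"
  unfolding C1_curve_on_def
proof (intro conjI ballI allI impI)
  have C2: "C2_on S (c t)" "C2_on S (c' t)" if "t \<in> I" for t using c that by (simp_all add: C1_curve_on_def)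
  show "C2_on {y. (0, y) \<in> S} (\<lambda>y. c t (0, y))" "C2_on {y. (0, y) \<in> S} (\<lambda>y. c' t (0, y))" if "t \<in> I" for t
    by (intro C2_on_restrict C2 that)+
  fix K t assume K: "compact K \<and> K \<subseteq> {y. (0, y) \<in> S} \<and> t \<in> I"
  then have t: "t \<in> I" and KS: "\<And>y. y \<in> K \<Longrightarrow> (0, y) \<in> S" by auto
  define K' where "K' = Pair (0::real) ` K"
  have K': "compact K' \<and> K' \<subseteq> S \<and> t \<in> I"
    using K KS by (auto simp: K'_def intro!: compact_continuous_image continuous_intros)
  have comp: "uniform_limit K (\<lambda>s y. q s (0, y)) (\<lambda>y. q' (0, y)) (at t within I)"
    if "uniform_limit K' q q' (at t within I)" for q :: "real \<Rightarrow> real \<times> 'e \<Rightarrow> real" and q'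
    using that unfolding uniform_limit_iff K'_def by simp
  have I: "\<forall>\<^sub>F s in at t within I. s \<in> I" by (auto simp: eventually_at_filter)
  note c4 = c[unfolded C1_curve_on_def, THEN conjunct2, rule_format, OF K']
  show "uniform_limit K (\<lambda>s y. (c s (0, y) - c t (0, y)) / (s - t)) (\<lambda>y. c' t (0, y)) (at t within I)"
    by (rule comp[where q = "\<lambda>s x. (c s x - c t x) / (s - t)"]) (use c4 in blast)
  show "uniform_limit K (\<lambda>t y. c' t (0, y)) (\<lambda>y. c' t (0, y)) (at t within I)"
    by (rule comp) (use c4 in blast)
  show "uniform_limit K (\<lambda>s y. (dir_deriv {y. (0, y) \<in> S} v (\<lambda>y. c s (0, y)) y
      - dir_deriv {y. (0, y) \<in> S} v (\<lambda>y. c t (0, y)) y) / (s - t))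
      (dir_deriv {y. (0, y) \<in> S} v (\<lambda>y. c' t (0, y))) (at t within I)" for v
  proof (rule uniform_limit_cong[THEN iffD1])
    show "uniform_limit K (\<lambda>s y. (dir_deriv S (0, v) (c s) (0, y) - dir_deriv S (0, v) (c t) (0, y)) / (s - t))
        (\<lambda>y. dir_deriv S (0, v) (c' t) (0, y)) (at t within I)"
      by (rule comp[where q = "\<lambda>s x. (dir_deriv S (0, v) (c s) x - dir_deriv S (0, v) (c t) x) / (s - t)"])
          (use c4 in blast)
    show "\<forall>\<^sub>F s in at t within I. \<forall>y\<in>K. (dir_deriv S (0, v) (c s) (0, y)
        - dir_deriv S (0, v) (c t) (0, y)) / (s - t)
        = (dir_deriv {y. (0, y) \<in> S} v (\<lambda>y. c s (0, y)) y - dir_deriv {y. (0, y) \<in> S} v (\<lambda>y. c t (0, y)) y) /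
            (s - t)"
      by (rule eventually_mono[OF I]) (simp add: dir_deriv_restrict[OF C2_onD(1)[OF C2(1)]] KS t)
    show "dir_deriv S (0, v) (c' t) (0, y) = dir_deriv {y. (0, y) \<in> S} v (\<lambda>y. c' t (0, y)) y" if "y \<in> K" for y
      using that by (simp add: dir_deriv_restrict[OF C2_onD(1)[OF C2(2)]] KS t)
  qed
  show "uniform_limit K (\<lambda>s. dir_deriv {y. (0, y) \<in> S} u (dir_deriv {y. (0, y) \<in> S} v (\<lambda>y. c s (0, y))))
      (dir_deriv {y. (0, y) \<in> S} u (dir_deriv {y. (0, y) \<in> S} v (\<lambda>y. c t (0, y)))) (at t within I)" for u v
  proof (rule uniform_limit_cong[THEN iffD1])
    show "uniform_limit K (\<lambda>s y. dir_deriv S (0, u) (dir_deriv S (0, v) (c s)) (0, y))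
        (\<lambda>y. dir_deriv S (0, u) (dir_deriv S (0, v) (c t)) (0, y)) (at t within I)"
      by (rule comp[where q = "\<lambda>s. dir_deriv S (0, u) (dir_deriv S (0, v) (c s))"]) (use c4 in blast)
    show "\<forall>\<^sub>F s in at t within I. \<forall>y\<in>K. dir_deriv S (0, u) (dir_deriv S (0, v) (c s)) (0, y)
        = dir_deriv {y. (0, y) \<in> S} u (dir_deriv {y. (0, y) \<in> S} v (\<lambda>y. c s (0, y))) y"
      by (rule eventually_mono[OF I]) (simp add: dir_deriv2_restrict[OF C2(1)] KS)
    show "dir_deriv S (0, u) (dir_deriv S (0, v) (c t)) (0, y)
        = dir_deriv {y. (0, y) \<in> S} u (dir_deriv {y. (0, y) \<in> S} v (\<lambda>y. c t (0, y))) y" if "y \<in> K" for y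
      using that by (simp add: dir_deriv2_restrict[OF C2(1)[OF t]] KS)
  qed
qed

text \<open>Testing the jet of the restriction amounts to testing the full jet against a vector
  without normal component. Nondegeneracy of the field's jet is thereby inherited by its restriction
  to the boundary.\<close>

lemma val_grad_restrict:
  fixes f :: "real \<times> 'e \<Rightarrow> real"
  assumes f: "f differentiable_on S" and y: "(0, y) \<in> S"
  shows "val_grad {y. (0, y) \<in> S} (\<lambda>y. f (0, y)) y \<bullet> \<eta> = val_grad S f (0, y) \<bullet> (fst \<eta>, 0, snd \<eta>)"
proof -
  have "(\<lambda>y. f (0, y)) differentiable_on {y. (0, y) \<in> S}"
    unfolding differentiable_on_def using has_derivative_restrict[OF f] by (auto intro: differentiableI)
  from val_grad_inner[OF this, of y \<eta>] show ?thesis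
    using val_grad_inner[OF f y, of "(fst \<eta>, 0, snd \<eta>)"] y by (simp add: dir_deriv_restrict[OF f])
qed

end

section \<open>Charts, and curves of functions read in a chart\<close>

lemma is_chartD:
  assumes "is_chart k"
  shows "open (fst k)" "openin (top_of_set half_space) (chart_image k)"
    "p \<in> fst k \<Longrightarrow> snd k p \<in> chart_image k" "p \<in> fst k \<Longrightarrow> chart_inv k (snd k p) = p"
    "x \<in> chart_image k \<Longrightarrow> chart_inv k x \<in> fst k" "x \<in> chart_image k \<Longrightarrow> snd k (chart_inv k x) = x"
    "continuous_on (fst k) (snd k)" "continuous_on (chart_image k) (chart_inv k)"
  using assms unfolding is_chart_def homeomorphism_def by auto

text \<open>Differential operators commute with difference quotients, which are linear combinations
  of two functions of the curve. The last three limits express that differentiability in time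
  implies continuity, uniformly on compact sets.\<close>

lemma has_curve_deriv_C2_tendsto:
  assumes atlas: "C2_atlas A" and \<gamma>: "has_curve_deriv A I \<gamma> \<gamma>'"
    and k: "k \<in> A" and K: "compact K" "K \<subseteq> chart_image k" and t: "t \<in> I"
  defines "S \<equiv> chart_image k" and "q \<equiv> \<lambda>s. \<gamma> s \<circ> chart_inv k" and "q' \<equiv> \<gamma>' t \<circ> chart_inv k"
  shows "uniform_limit K (\<lambda>s x. (q s x - q t x) / (s - t)) q' (at t within I)"
    and "uniform_limit K (\<lambda>s x. (dir_deriv S v (q s) x - dir_deriv S v (q t) x) / (s
        - t)) (dir_deriv S v q') (at t within I)"
    and "uniform_limit K (\<lambda>s x. (dir_deriv S u (dir_deriv S v (q s)) x
        - dir_deriv S u (dir_deriv S v (q t)) x) / (s - t))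
      (dir_deriv S u (dir_deriv S v q')) (at t within I)"
    and "uniform_limit K q (q t) (at t within I)"
    and "uniform_limit K (\<lambda>s. dir_deriv S v (q s)) (dir_deriv S v (q t)) (at t within I)"
    and "uniform_limit K (\<lambda>s. dir_deriv S u (dir_deriv S v (q s))) (dir_deriv S u (dir_deriv S v (q t)))
        (at t within I)"
proof -
  have chart: "is_chart k" using atlas k by (simp add: C2_atlas_def)
  note U = unique_derivs_half_space[OF is_chartD(2)[OF chart], folded S_def]
  have C2: "C2_on S (q s)" "C2_on S (\<gamma>' s \<circ> chart_inv k)" if "s \<in> I" for s
    using \<gamma> k that by (auto simp: has_curve_deriv_def C2_fun_def S_def q_def)
  have C2': "C2_on S q'" using C2(2)[OF t] by (simp add: q'_def)
  have I: "\<forall>\<^sub>F s in at t within I. s \<in> I" by (auto simp: eventually_at_filter)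
  have KS: "x \<in> K \<Longrightarrow> x \<in> S" for x using K by (auto simp: S_def)
  have "C2_tendsto A (\<lambda>s p. (\<gamma> s p - \<gamma> t p) / (s - t)) (\<gamma>' t) (at t within I)"
    using \<gamma> t by (simp add: has_curve_deriv_def)
  note T = this[unfolded C2_tendsto_def Let_def, rule_format, OF k conjI[OF K], folded S_def q'_def]
  define Q where "Q s = (\<lambda>p. (\<gamma> s p - \<gamma> t p) / (s - t)) \<circ> chart_inv k" for s
  have Q: "Q s = (\<lambda>x. (1 / (s - t)) * q s x + (- (1 / (s - t))) * q t x)" for s
    by (auto simp: Q_def q_def fun_eq_iff diff_divide_distrib)
  have T0: "uniform_limit K Q q' (at t within I)"
    and T1: "uniform_limit K (\<lambda>s. dir_deriv S v (Q s)) (dir_deriv S v q') (at t within I)"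
    and T2: "uniform_limit K (\<lambda>s. dir_deriv S u (dir_deriv S v (Q s))) (dir_deriv S u (dir_deriv S v q'))
        (at t within I)" for u v
    using T unfolding Q_def by blast+
  show 0: "uniform_limit K (\<lambda>s x. (q s x - q t x) / (s - t)) q' (at t within I)"
  proof -
    have "Q = (\<lambda>s x. (q s x - q t x) / (s - t))" by (simp add: fun_eq_iff Q_def q_def)
    then show ?thesis using T0 by simp
  qed
  have "\<forall>\<^sub>F s in at t within I. \<forall>x\<in>K. dir_deriv S v (Q s) x
      = (dir_deriv S v (q s) x - dir_deriv S v (q t) x) / (s - t)" for v
  proof (rule eventually_mono[OF I], intro ballI)
    fix s x assume s: "s \<in> I" and x: "x \<in> K"
    show "dir_deriv S v (Q s) x = (dir_deriv S v (q s) x - dir_deriv S v (q t) x) / (s - t)"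
      unfolding Q dir_deriv_lincomb[OF U C2_onD(1)[OF C2(1)[OF s]] C2_onD(1)[OF C2(1)[OF t]] KS[OF x]]
      by (simp add: diff_divide_distrib)
  qed
  from uniform_limit_cong[OF this, THEN iffD1, OF _ T1]
  show 1: "uniform_limit K (\<lambda>s x. (dir_deriv S v (q s) x - dir_deriv S v (q t) x) / (s
      - t)) (dir_deriv S v q') (at t within I)" for v
    by simp
  have "\<forall>\<^sub>F s in at t within I. \<forall>x\<in>K. dir_deriv S u (dir_deriv S v (Q s)) x
      = (dir_deriv S u (dir_deriv S v (q s)) x - dir_deriv S u (dir_deriv S v (q t)) x) / (s - t)" for u v
  proof (rule eventually_mono[OF I], intro ballI)
    fix s x assume s: "s \<in> I" and x: "x \<in> K"
    show "dir_deriv S u (dir_deriv S v (Q s)) x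
        = (dir_deriv S u (dir_deriv S v (q s)) x - dir_deriv S u (dir_deriv S v (q t)) x) / (s - t)"
      unfolding Q dir_deriv2_lincomb[OF U C2(1)[OF s] C2(1)[OF t] KS[OF x]]
      by (simp add: diff_divide_distrib)
  qed
  from uniform_limit_cong[OF this, THEN iffD1, OF _ T2]
  show 2: "uniform_limit K (\<lambda>s x. (dir_deriv S u (dir_deriv S v (q s)) x
      - dir_deriv S u (dir_deriv S v (q t)) x) / (s - t))
      (dir_deriv S u (dir_deriv S v q')) (at t within I)" for u v
    by simp
  have KS': "K \<subseteq> S" using K by (simp add: S_def)
  show "uniform_limit K q (q t) (at t within I)"
    by (rule uniform_limit_if_difference_quotient[OF 0 K(1) continuous_on_subset[OF C2_onD(3)[OF C2'] KS']])
  show "uniform_limit K (\<lambda>s. dir_deriv S v (q s)) (dir_deriv S v (q t)) (at t within I)"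
    by (rule uniform_limit_if_difference_quotient[OF 1 K(1) continuous_on_subset[OF C2_onD(4)[OF C2'] KS']])
  show "uniform_limit K (\<lambda>s. dir_deriv S u (dir_deriv S v (q s))) (dir_deriv S u (dir_deriv S v (q t)))
      (at t within I)"
    by (rule uniform_limit_if_difference_quotient[OF 2 K(1) continuous_on_subset[OF C2_onD(5)[OF C2'] KS']])
qed

lemma C1_curve_on_chart:
  assumes atlas: "C2_atlas A" and \<gamma>: "has_C1_curve_deriv A I \<gamma> \<gamma>'" and k: "k \<in> A"
  shows "C1_curve_on (chart_image k) I (\<lambda>t. \<gamma> t \<circ> chart_inv k) (\<lambda>t. \<gamma>' t \<circ> chart_inv k)"
  unfolding C1_curve_on_def
proof (intro conjI ballI allI impI)
  have \<gamma>1: "has_curve_deriv A I \<gamma> \<gamma>'" using \<gamma> by (simp add: has_C1_curve_deriv_def)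
  show "C2_on (chart_image k) (\<gamma> t \<circ> chart_inv k)" "C2_on (chart_image k) (\<gamma>' t \<circ> chart_inv k)" if "t \<in> I" for t
    using \<gamma>1 k that by (auto simp: has_curve_deriv_def C2_fun_def)
  fix K t assume K: "compact K \<and> K \<subseteq> chart_image k \<and> t \<in> I"
  then have K1: "compact K" "K \<subseteq> chart_image k" and t: "t \<in> I" by auto
  note * = has_curve_deriv_C2_tendsto[OF atlas \<gamma>1 k K1 t]
  show "uniform_limit K (\<lambda>s x. ((\<gamma> s \<circ> chart_inv k) x - (\<gamma> t \<circ> chart_inv k) x) / (s - t)) (\<gamma>' t
      \<circ> chart_inv k) (at t within I)"
    by (rule *(1))
  show "uniform_limit K (\<lambda>s x. (dir_deriv (chart_image k) v (\<gamma> s \<circ> chart_inv k) x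
      - dir_deriv (chart_image k) v (\<gamma> t \<circ> chart_inv k) x) / (s - t))
      (dir_deriv (chart_image k) v (\<gamma>' t \<circ> chart_inv k)) (at t within I)" for v
    by (rule *(2))
  show "uniform_limit K (\<lambda>s. dir_deriv (chart_image k) u (dir_deriv (chart_image k) v (\<gamma> s \<circ> chart_inv k)))
      (dir_deriv (chart_image k) u (dir_deriv (chart_image k) v (\<gamma> t \<circ> chart_inv k))) (at t within I)" for u v
    by (rule *(6))
  have "C2_tendsto A \<gamma>' (\<gamma>' t) (at t within I)" using \<gamma> t by (simp add: has_C1_curve_deriv_def)
  then show "uniform_limit K (\<lambda>t. \<gamma>' t \<circ> chart_inv k) (\<gamma>' t \<circ> chart_inv k) (at t within I)"
    unfolding C2_tendsto_def Let_def using k K1 by blast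
qed

text \<open>The first derivative of the curve is itself differentiable, hence continuous in the C^2
  topology.\<close>

lemma has_C1_curve_deriv_if_C2_curve:
  assumes atlas: "C2_atlas A" and c: "C2_curve A I c"
  obtains c' where "has_C1_curve_deriv A I c c'"
proof -
  obtain c' c'' where c': "has_curve_deriv A I c c'" "has_curve_deriv A I c' c''"
    using c by (auto simp: C2_curve_def has_C1_curve_deriv_def)
  have "C2_tendsto A c' (c' t) (at t within I)" if "t \<in> I" for t
    unfolding C2_tendsto_def Let_def
  proof (intro ballI allI impI conjI)
    fix k K assume k: "k \<in> A" and K: "compact K \<and> K \<subseteq> chart_image k"
    note * = has_curve_deriv_C2_tendsto[OF atlas c'(2) k conjunct1[OF K] conjunct2[OF K] that]
    show "uniform_limit K (\<lambda>i. c' i \<circ> chart_inv k) (c' t \<circ> chart_inv k) (at t within I)"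
      by (rule *(4))
    show "uniform_limit K (\<lambda>i. dir_deriv (chart_image k) v (c' i \<circ> chart_inv k))
        (dir_deriv (chart_image k) v (c' t \<circ> chart_inv k)) (at t within I)" for v
      by (rule *(5))
    show "uniform_limit K (\<lambda>i. dir_deriv (chart_image k) u (dir_deriv (chart_image k) v (c' i \<circ> chart_inv k)))
        (dir_deriv (chart_image k) u (dir_deriv (chart_image k) v (c' t \<circ> chart_inv k))) (at t within I)" for u v
      by (rule *(6))
  qed
  then show thesis using that c'(1) by (auto simp: has_C1_curve_deriv_def)
qed

lemma has_C1_curve_deriv_translate:
  assumes atlas: "C2_atlas A" and c: "has_C1_curve_deriv A I c c'" and f: "f \<in> C2_fun A"
  shows "has_C1_curve_deriv A I (\<lambda>t p. c t p + f p) c'"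
proof -
  have "(\<lambda>p. c t p + f p) \<in> C2_fun A" if "t \<in> I" for t
    unfolding C2_fun_def mem_Collect_eq
  proof
    fix k assume k: "k \<in> A"
    then have "unique_derivs (chart_image k)"
      using atlas by (intro unique_derivs_half_space is_chartD(2)) (simp add: C2_atlas_def)
    moreover have "C2_on (chart_image k) (c t \<circ> chart_inv k)" "C2_on (chart_image k) (f \<circ> chart_inv k)"
      using c f k that by (auto simp: has_C1_curve_deriv_def has_curve_deriv_def C2_fun_def)
    ultimately have "C2_on (chart_image k) (\<lambda>x. 1 * (c t \<circ> chart_inv k) x + 1 * (f \<circ> chart_inv k) x)"
      by (rule C2_on_lincomb)
    then show "C2_on (chart_image k) ((\<lambda>p. c t p + f p) \<circ> chart_inv k)" by (simp add: comp_def)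
  qed
  then show ?thesis
    using c by (auto simp: has_C1_curve_deriv_def has_curve_deriv_def)
qed

section \<open>Overlapping charts and the boundary\<close>

lemma overlap_open:
  assumes "is_chart k" "open Q"
  obtains U where "open U" "snd k ` (fst k \<inter> Q) = chart_image k \<inter> U"
proof -
  have "openin (top_of_set (chart_image k)) (chart_image k \<inter> chart_inv k -` Q)"
    by (rule continuous_openin_preimage_gen[OF is_chartD(8)[OF assms(1)] assms(2)])
  then obtain U where U: "open U" "chart_image k \<inter> chart_inv k -` Q = chart_image k \<inter> U"
    by (auto simp: openin_open)
  have "snd k ` (fst k \<inter> Q) = chart_image k \<inter> chart_inv k -` Q"
  proof (intro equalityI subsetI)
    fix x assume "x \<in> snd k ` (fst k \<inter> Q)"
    then show "x \<in> chart_image k \<inter> chart_inv k -` Q"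
      using is_chartD(3,4)[OF assms(1)] by auto
  next
    fix x assume "x \<in> chart_image k \<inter> chart_inv k -` Q"
    then show "x \<in> snd k ` (fst k \<inter> Q)"
      using is_chartD(5,6)[OF assms(1)] by (intro image_eqI[of _ _ "chart_inv k x"]) auto
  qed
  then show thesis using that U by simp
qed

lemma chart_change:
  assumes atlas: "C2_atlas A" and k: "k \<in> A" and d: "d \<in> A"
  obtains U W where "coordinate_change (chart_image k) (chart_image d) U W (snd d \<circ> chart_inv k) (snd k
      \<circ> chart_inv d)"
    "chart_image k \<inter> U = snd k ` (fst k \<inter> fst d)" "chart_image d \<inter> W = snd d ` (fst d \<inter> fst k)"
    "unique_derivs (chart_image k \<inter> U)" "openin (top_of_set half_space) (chart_image k \<inter> U)"
    "openin (top_of_set half_space) (chart_image d \<inter> W)"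
proof -
  have ck: "is_chart k" and cd: "is_chart d" using atlas k d by (simp_all add: C2_atlas_def)
  obtain U where U: "open U" "snd k ` (fst k \<inter> fst d) = chart_image k \<inter> U"
    by (rule overlap_open[OF ck is_chartD(1)[OF cd]])
  obtain W where W: "open W" "snd d ` (fst d \<inter> fst k) = chart_image d \<inter> W"
    by (rule overlap_open[OF cd is_chartD(1)[OF ck]])
  have oU: "openin (top_of_set half_space) (chart_image k \<inter> U)"
    using is_chartD(2)[OF ck] U(1) by (meson openin_Int_open)
  have oW: "openin (top_of_set half_space) (chart_image d \<inter> W)"
    using is_chartD(2)[OF cd] W(1) by (meson openin_Int_open)
  have C2: "C2_on (chart_image k \<inter> U) (snd d \<circ> chart_inv k)" "C2_on (chart_image d \<inter> W) (snd k \<circ> chart_inv d)"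
    using atlas k d unfolding U(2)[symmetric] W(2)[symmetric] by (simp_all add: C2_atlas_def)
  have "coordinate_change (chart_image k) (chart_image d) U W (snd d \<circ> chart_inv k) (snd k \<circ> chart_inv d)"
  proof
    show "unique_derivs (chart_image k \<inter> U)" "unique_derivs (chart_image d \<inter> W)"
      by (rule unique_derivs_half_space[OF oU] unique_derivs_half_space[OF oW])+
    show "(snd d \<circ> chart_inv k) x \<in> chart_image d \<inter> W" "(snd k \<circ> chart_inv d) ((snd d \<circ> chart_inv k) x) = x"
      if "x \<in> chart_image k \<inter> U" for x
      using that is_chartD(4)[OF ck] is_chartD(4)[OF cd] unfolding U(2)[symmetric] W(2)[symmetric] by auto
    show "(snd k \<circ> chart_inv d) x \<in> chart_image k \<inter> U" "(snd d \<circ> chart_inv k) ((snd k \<circ> chart_inv d) x) = x"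
      if "x \<in> chart_image d \<inter> W" for x
      using that is_chartD(4)[OF ck] is_chartD(4)[OF cd] unfolding U(2)[symmetric] W(2)[symmetric] by auto
    show "snd d \<circ> chart_inv k differentiable_on chart_image k \<inter> U"
        "snd k \<circ> chart_inv d differentiable_on chart_image d \<inter> W"
      using C2 by (simp_all add: C2_on_def)
    show "continuous_on (chart_image k \<inter> U) (dir_deriv (chart_image k \<inter> U) v (snd d \<circ> chart_inv k))" for v
      using C2(1) unfolding C2_on_def C1_on_def by (blast intro: differentiable_imp_continuous_on)
  qed (use U W in auto)
  from that[OF this U(2)[symmetric] W(2)[symmetric] unique_derivs_half_space[OF oU] oU oW] show thesis .
qed

text \<open>An interior point of the half-space mapped to the boundary would be a minimum of the first
  coordinate, against the invertibility of the Jacobian.\<close>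

lemma coordinate_change_fst_pos:
  fixes S T :: "(real \<times> 'e::euclidean_space) set"
  assumes "coordinate_change S T U W \<tau> \<sigma>"
    and half: "S \<inter> U = half_space \<inter> Q" "open Q" and T: "T \<inter> W \<subseteq> half_space"
    and x: "x \<in> S \<inter> U" "fst x > 0"
  shows "fst (\<tau> x) > 0"
proof (rule ccontr)
  interpret coordinate_change S T U W \<tau> \<sigma> by fact
  assume "\<not> fst (\<tau> x) > 0"
  then have 0: "fst (\<tau> x) = 0" using T \<tau>(1)[OF x(1)] by (force simp: half_space_def)
  define N where "N = {x. fst x > 0} \<inter> Q"
  have N: "open N" unfolding N_def by (intro open_Int half(2) open_Collect_less continuous_intros)
  have xN: "x \<in> N" using x half(1) by (auto simp: N_def)
  have sub: "N \<subseteq> S \<inter> U" unfolding half(1) N_def half_space_def by auto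
  have "(\<tau> has_derivative jac x) (at x within N)"
    by (rule has_derivative_subset[OF has_derivative_jac[OF x(1)] sub])
  then have "(\<tau> has_derivative jac x) (at x)"
    by (simp only: at_within_open[OF xN N])
  then have "((\<lambda>y. fst (\<tau> y)) has_derivative (\<lambda>v. fst (jac x v))) (at x)"
    by (rule has_derivative_fst)
  moreover have "\<forall>\<^sub>F y in at x. fst (\<tau> x) \<le> fst (\<tau> y)"
  proof (rule eventually_at_topological[THEN iffD2], intro exI[of _ N] conjI ballI impI)
    fix y assume "y \<in> N"
    then have "\<tau> y \<in> half_space" using \<tau>(1)[of y] sub T by blast
    then show "fst (\<tau> x) \<le> fst (\<tau> y)" by (simp add: 0 half_space_def)
  qed (use N xN in auto)
  ultimately have "(\<lambda>v. fst (jac x v)) = (\<lambda>v. 0)" by (rule has_derivative_local_min)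
  moreover obtain v where "(1, 0) = jac x v" using surj_jac[OF x(1)] by (rule surjE)
  ultimately show False by (metis fst_conv zero_neq_one)
qed

lemma chart_at:
  assumes "C2_atlas A"
  shows "chart_at A p \<in> A" "p \<in> fst (chart_at A p)"
proof -
  have "p \<in> (\<Union>k\<in>A. fst k)" using assms by (simp add: C2_atlas_def)
  then have "\<exists>k. k \<in> A \<and> p \<in> fst k" by blast
  from someI_ex[OF this] show "chart_at A p \<in> A" "p \<in> fst (chart_at A p)"
    by (simp_all add: chart_at_def)
qed

lemma fst_chart_pos:
  assumes atlas: "C2_atlas A" and k: "k \<in> A" "p \<in> fst k" and d: "d \<in> A" "p \<in> fst d"
    and pos: "fst (snd k p) > 0"
  shows "fst (snd d p) > 0"
proof -
  obtain U W where *: "coordinate_change (chart_image k) (chart_image d) U W (snd d \<circ> chart_inv k) (snd k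
      \<circ> chart_inv d)"
    "chart_image k \<inter> U = snd k ` (fst k \<inter> fst d)" "openin (top_of_set half_space) (chart_image k \<inter> U)"
    "openin (top_of_set half_space) (chart_image d \<inter> W)"
    by (rule chart_change[OF atlas k(1) d(1)])
  obtain Q where Q: "open Q" "chart_image k \<inter> U = half_space \<inter> Q" using *(3) by (auto simp: openin_open)
  have "chart_image d \<inter> W \<subseteq> half_space" using *(4) by (auto simp: openin_open)
  moreover have "snd k p \<in> chart_image k \<inter> U" using *(2) k d by auto
  ultimately have "fst ((snd d \<circ> chart_inv k) (snd k p)) > 0"
    using coordinate_change_fst_pos[OF *(1) Q(2,1)] pos by blast
  moreover have "chart_inv k (snd k p) = p"
    using atlas k by (intro is_chartD(4)) (simp_all add: C2_atlas_def)
  ultimately show ?thesis by simp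
qed

lemma fst_chart_nonneg:
  assumes "C2_atlas A" "k \<in> A" "p \<in> fst k"
  shows "fst (snd k p) \<ge> 0"
proof -
  have k: "is_chart k" using assms by (simp add: C2_atlas_def)
  have "chart_image k \<subseteq> half_space" using is_chartD(2)[OF k] by (auto simp: openin_open)
  then show ?thesis using is_chartD(3)[OF k assms(3)] by (auto simp: half_space_def)
qed

lemma fst_chart_eq_0:
  assumes "C2_atlas A" "k \<in> A" "p \<in> fst k" "d \<in> A" "p \<in> fst d"
  shows "fst (snd k p) = 0 \<longleftrightarrow> fst (snd d p) = 0"
  using fst_chart_pos[OF assms] fst_chart_pos[OF assms(1,4,5,2,3)]
    fst_chart_nonneg[OF assms(1-3)] fst_chart_nonneg[OF assms(1,4,5)]
  unfolding order.order_iff_strict by auto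

text \<open>The sign of the first coordinate is preserved by changes of charts, so membership in the
  boundary may be read in any chart and not only in the preferred one.\<close>

lemma boundary_iff:
  assumes "C2_atlas A" "k \<in> A" "p \<in> fst k"
  shows "p \<in> boundary A \<longleftrightarrow> fst (snd k p) = 0"
  using fst_chart_eq_0[OF assms chart_at[OF assms(1)]] by (simp add: boundary_def)

text \<open>A change of charts maps boundary points to boundary points, so on the hyperplane its
  first component is 0 and its second component is the change of boundary coordinates.\<close>

lemma bd_chart_change:
  fixes A :: "('a::topological_space, 'e::euclidean_space) chart set"
  assumes atlas: "C2_atlas A" and k: "k \<in> A" and d: "d \<in> A"
  obtains U W \<tau> \<sigma> where "coordinate_change (bd_chart_image k) (bd_chart_image d) U W \<tau> \<sigma>"
    "\<forall>y \<in> bd_chart_image k \<inter> U. bd_chart_inv d (\<tau> y) = bd_chart_inv k y"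
    "\<forall>p \<in> fst k \<inter> fst d. fst (snd k p) = 0 \<longrightarrow>
      snd (snd k p) \<in> bd_chart_image k \<inter> U \<and> \<tau> (snd (snd k p)) = snd (snd d p)"
proof -
  have ck: "is_chart k" and cd: "is_chart d" using atlas k d by (simp_all add: C2_atlas_def)
  obtain U W where cc: "coordinate_change (chart_image k) (chart_image d) U W (snd d \<circ> chart_inv k) (snd k
      \<circ> chart_inv d)"
    and UW: "chart_image k \<inter> U = snd k ` (fst k \<inter> fst d)" "chart_image d \<inter> W = snd d ` (fst d \<inter> fst k)"
      "openin (top_of_set half_space) (chart_image k \<inter> U)" "openin (top_of_set half_space) (chart_image d \<inter> W)"
    by (rule chart_change[OF atlas k d])
  interpret c: coordinate_change "chart_image k" "chart_image d" U W "snd d \<circ> chart_inv k"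
      "snd k \<circ> chart_inv d" by (rule cc)
  define U' where "U' = {y. (0, y) \<in> U}"
  define W' where "W' = {y. (0, y) \<in> W}"
  define \<tau> where "\<tau> y = snd ((snd d \<circ> chart_inv k) (0, y))" for y
  define \<sigma> where "\<sigma> y = snd ((snd k \<circ> chart_inv d) (0, y))" for y
  have sets: "bd_chart_image k \<inter> U' = {y. (0, y) \<in> chart_image k \<inter> U}"
    "bd_chart_image d \<inter> W' = {y. (0, y) \<in> chart_image d \<inter> W}"
    by (auto simp: bd_chart_image_def U'_def W'_def)
  have \<tau>0: "(snd d \<circ> chart_inv k) (0, y) = (0, \<tau> y)" if y: "(0, y) \<in> chart_image k \<inter> U" for y
  proof -
    obtain p where p: "p \<in> fst k" "p \<in> fst d" "(0, y) = snd k p" using y UW(1) by auto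
    then have "fst (snd d p) = 0" using fst_chart_eq_0[OF atlas k p(1) d p(2)] by (metis fst_conv)
    moreover have "chart_inv k (0, y) = p" using p is_chartD(4)[OF ck] by simp
    ultimately show ?thesis by (simp add: \<tau>_def prod_eq_iff)
  qed
  have \<sigma>0: "(snd k \<circ> chart_inv d) (0, y) = (0, \<sigma> y)" if y: "(0, y) \<in> chart_image d \<inter> W" for y
  proof -
    obtain p where p: "p \<in> fst k" "p \<in> fst d" "(0, y) = snd d p" using y UW(2) by auto
    then have "fst (snd k p) = 0" using fst_chart_eq_0[OF atlas k p(1) d p(2)] by (metis fst_conv)
    moreover have "chart_inv d (0, y) = p" using p is_chartD(4)[OF cd] by simp
    ultimately show ?thesis by (simp add: \<sigma>_def prod_eq_iff)
  qed
  have op: "open U'" "open W'"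
  proof -
    have "U' = Pair 0 -` U" "W' = Pair 0 -` W" by (simp_all add: U'_def W'_def vimage_def)
    moreover have "continuous_on UNIV (Pair (0::real) :: 'e \<Rightarrow> _)" by (intro continuous_intros)
    ultimately show "open U'" "open W'"
      using open_vimage[OF c.opn(1)] open_vimage[OF c.opn(2)] by simp_all
  qed
  note r\<tau> = has_derivative_snd[OF has_derivative_restrict[OF UW(3) c.diff(1)]]
  note r\<sigma> = has_derivative_snd[OF has_derivative_restrict[OF UW(4) c.diff(2)]]
  have cc': "coordinate_change (bd_chart_image k) (bd_chart_image d) U' W' \<tau> \<sigma>"
  proof
    show uk: "unique_derivs (bd_chart_image k \<inter> U')"
      unfolding sets by (rule unique_derivs_restrict[OF UW(3)])
    show "unique_derivs (bd_chart_image d \<inter> W')"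
      unfolding sets by (rule unique_derivs_restrict[OF UW(4)])
    show "open U'" "open W'" by (rule op)+
    show "\<tau> y \<in> bd_chart_image d \<inter> W'" "\<sigma> (\<tau> y) = y" if y: "y \<in> bd_chart_image k \<inter> U'" for y
    proof -
      have y': "(0, y) \<in> chart_image k \<inter> U" using y sets by blast
      have *: "(0, \<tau> y) \<in> chart_image d \<inter> W" using c.\<tau>(1)[OF y'] \<tau>0[OF y'] by simp
      then show "\<tau> y \<in> bd_chart_image d \<inter> W'" using sets by blast
      show "\<sigma> (\<tau> y) = y" using c.\<tau>(2)[OF y'] \<tau>0[OF y'] \<sigma>0[OF *] by simp
    qed
    show "\<sigma> y \<in> bd_chart_image k \<inter> U'" "\<tau> (\<sigma> y) = y" if y: "y \<in> bd_chart_image d \<inter> W'" for y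
    proof -
      have y': "(0, y) \<in> chart_image d \<inter> W" using y sets by blast
      have *: "(0, \<sigma> y) \<in> chart_image k \<inter> U" using c.\<sigma>(1)[OF y'] \<sigma>0[OF y'] by simp
      then show "\<sigma> y \<in> bd_chart_image k \<inter> U'" using sets by blast
      show "\<tau> (\<sigma> y) = y" using c.\<sigma>(2)[OF y'] \<sigma>0[OF y'] \<tau>0[OF *] by simp
    qed
    show "\<tau> differentiable_on bd_chart_image k \<inter> U'"
      unfolding differentiable_on_def sets \<tau>_def[abs_def] using r\<tau> by (auto intro: differentiableI)
    show "\<sigma> differentiable_on bd_chart_image d \<inter> W'"
      unfolding differentiable_on_def sets \<sigma>_def[abs_def] using r\<sigma> by (auto intro: differentiableI)
    show "continuous_on (bd_chart_image k \<inter> U') (dir_deriv (bd_chart_image k \<inter> U') v \<tau>)" for v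
    proof (rule continuous_on_eq)
      show "continuous_on (bd_chart_image k \<inter> U')
          (\<lambda>y. snd (dir_deriv (chart_image k \<inter> U) (0, v) (snd d \<circ> chart_inv k) (0, y)))"
        unfolding sets by (intro continuous_on_snd continuous_on_restrict[OF UW(3)] c.C1)
      show "snd (dir_deriv (chart_image k \<inter> U) (0, v) (snd d \<circ> chart_inv k) (0, y))
          = dir_deriv (bd_chart_image k \<inter> U') v \<tau> y"
        if "y \<in> bd_chart_image k \<inter> U'" for y
        using dir_deriv_eq[OF unique_derivs_restrict[OF UW(3)] _ r\<tau>, of y v] that
            unfolding sets \<tau>_def[abs_def] by simp
    qed
  qed
  have inv: "bd_chart_inv d (\<tau> y) = bd_chart_inv k y" if y: "y \<in> bd_chart_image k \<inter> U'" for y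
  proof -
    have y': "(0, y) \<in> chart_image k \<inter> U" using y sets by blast
    then obtain p where p: "p \<in> fst k" "p \<in> fst d" "(0, y) = snd k p" using UW(1) by auto
    then have "chart_inv k (0, y) = p" using is_chartD(4)[OF ck] by simp
    then show ?thesis
      using \<tau>0[OF y'] p is_chartD(4)[OF cd p(2)] by (simp add: bd_chart_inv_def)
  qed
  have "snd (snd k p) \<in> bd_chart_image k \<inter> U' \<and> \<tau> (snd (snd k p)) = snd (snd d p)"
    if p: "p \<in> fst k" "p \<in> fst d" "fst (snd k p) = 0" for p
  proof -
    have eq: "(0, snd (snd k p)) = snd k p" using p(3) by (simp add: prod_eq_iff)
    have "snd k p \<in> chart_image k \<inter> U" using UW(1) p by blast
    then show ?thesis
      unfolding sets \<tau>_def using is_chartD(4)[OF ck p(1)] by (simp add: eq)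
  qed
  with inv show thesis by (intro that[OF cc'] ballI impI) auto
qed

section \<open>Critical points in arbitrary charts\<close>

lemma val_grad_eq_0_iff:
  fixes f :: "'b::euclidean_space \<Rightarrow> real"
  assumes "f differentiable_on S" "x \<in> S"
  shows "val_grad S f x = 0 \<longleftrightarrow> f x = 0 \<and> (\<forall>v. dir_deriv S v f x = 0)"
proof -
  have "grad S f x = 0 \<longleftrightarrow> (\<forall>v. dir_deriv S v f x = 0)"
    unfolding grad_inner[OF assms, symmetric] by (metis inner_eq_zero_iff inner_zero_left)
  then show ?thesis by (simp add: val_grad_def prod_eq_iff)
qed

lemma C2_funD:
  assumes "f \<in> C2_fun A" "k \<in> A"
  shows "C2_on (chart_image k) (f \<circ> chart_inv k)"
  using assms by (simp add: C2_fun_def)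

lemma bd_chart_inv_comp: "f \<circ> bd_chart_inv k = (\<lambda>y. (f \<circ> chart_inv k) (0, y))"
  by (simp add: fun_eq_iff bd_chart_inv_def)

lemma C2_fun_boundary:
  assumes atlas: "C2_atlas A" and f: "f \<in> C2_fun A" and k: "k \<in> A"
  shows "C2_on (bd_chart_image k) (f \<circ> bd_chart_inv k)"
proof -
  have ck: "is_chart k" using atlas k by (simp add: C2_atlas_def)
  show ?thesis
    unfolding bd_chart_inv_comp bd_chart_image_def
    by (rule C2_on_restrict[OF is_chartD(2)[OF ck] C2_funD[OF f k]])
qed

lemma unique_derivs_chart:
  assumes "C2_atlas A" "k \<in> A"
  shows "openin (top_of_set half_space) (chart_image k)" "unique_derivs (chart_image k)"
    "open (bd_chart_image k)" "unique_derivs (bd_chart_image k)"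
proof -
  show S: "openin (top_of_set half_space) (chart_image k)"
    using assms by (intro is_chartD(2)) (simp add: C2_atlas_def)
  show "unique_derivs (chart_image k)" by (rule unique_derivs_half_space[OF S])
  show T: "open (bd_chart_image k)" unfolding bd_chart_image_def by (rule openin_half_space_Pair[OF S])
  show "unique_derivs (bd_chart_image k)" by (rule unique_derivs_open[OF T])
qed

text \<open>Differential and Hessian are defined through the preferred chart at \<open>p\<close>,
  which varies with \<open>p\<close>, while the probabilistic statements concern fixed charts
  \<open>k\<close>. The change of charts connects the two.\<close>

lemma critical_in_chart:
  assumes atlas: "C2_atlas A" and f: "f \<in> C2_fun A" and k: "k \<in> A" "p \<in> fst k"
  shows "differential A f p = (\<lambda>v. 0) \<longleftrightarrow> (\<forall>v. dir_deriv (chart_image k) v (f \<circ> chart_inv k) (snd k p) = 0)"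
    and "differential A f p = (\<lambda>v. 0) \<Longrightarrow> (\<And>u. hess (chart_image k) (f \<circ> chart_inv k) (snd k p) u = 0 \<Longrightarrow> u = 0)
      \<Longrightarrow> nondegenerate (hessian A f p)"
proof -
  let ?c = "chart_at A p"
  note c = chart_at[OF atlas, of p]
  have cc: "is_chart ?c" and ck: "is_chart k" using atlas c k by (simp_all add: C2_atlas_def)
  obtain U W where *: "coordinate_change (chart_image ?c) (chart_image k) U W (snd k \<circ> chart_inv ?c) (snd ?c
      \<circ> chart_inv k)"
    and U: "chart_image ?c \<inter> U = snd ?c ` (fst ?c \<inter> fst k)"
    by (rule chart_change[OF atlas c(1) k(1)])
  interpret coordinate_change "chart_image ?c" "chart_image k" U W "snd k \<circ> chart_inv ?c"
      "snd ?c \<circ> chart_inv k" by (rule *)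
  have x: "snd ?c p \<in> chart_image ?c \<inter> U" using U c k by auto
  have \<tau>x: "(snd k \<circ> chart_inv ?c) (snd ?c p) = snd k p" using is_chartD(4)[OF cc c(2)] by simp
  have fh: "(f \<circ> chart_inv ?c) y = (f \<circ> chart_inv k) ((snd k \<circ> chart_inv ?c) y)" if "y \<in> chart_image ?c \<inter> U" for y
    using that is_chartD(4)[OF cc] is_chartD(4)[OF ck] unfolding U by auto
  note h = C2_funD[OF f k(1)]
  show crit: "differential A f p = (\<lambda>v. 0) \<longleftrightarrow> (\<forall>v. dir_deriv (chart_image k) v (f \<circ> chart_inv k) (snd k p) = 0)"
    using critical_change[where f = "f \<circ> chart_inv ?c" and h = "f \<circ> chart_inv k", OF C2_onD(1)[OF h] fh x]
        unfolding \<tau>x by (simp add: differential_def fun_eq_iff Let_def)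
  show "nondegenerate (hessian A f p)" if "differential A f p = (\<lambda>v. 0)"
    "\<And>u. hess (chart_image k) (f \<circ> chart_inv k) (snd k p) u = 0 \<Longrightarrow> u = 0"
    using nondegenerate_change[where f = "f \<circ> chart_inv ?c"
        and h = "f \<circ> chart_inv k", OF unique_derivs_chart(2)[OF atlas k(1)] h fh x] crit that
    unfolding \<tau>x by (simp add: hessian_def[abs_def] Let_def)
qed

lemma bd_critical_in_chart:
  assumes atlas: "C2_atlas A" and f: "f \<in> C2_fun A" and k: "k \<in> A" "p \<in> fst k" and p: "p \<in> boundary A"
  shows "bd_differential A f p = (\<lambda>v. 0)
      \<longleftrightarrow> (\<forall>v. dir_deriv (bd_chart_image k) v (f \<circ> bd_chart_inv k) (snd (snd k p)) = 0)"
    and "bd_differential A f p = (\<lambda>v. 0)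
        \<Longrightarrow> (\<And>u. hess (bd_chart_image k) (f \<circ> bd_chart_inv k) (snd (snd k p)) u = 0 \<Longrightarrow> u = 0)
      \<Longrightarrow> nondegenerate (bd_hessian A f p)"
proof -
  let ?c = "chart_at A p"
  note c = chart_at[OF atlas, of p]
  obtain U W \<tau> \<sigma> where *: "coordinate_change (bd_chart_image ?c) (bd_chart_image k) U W \<tau> \<sigma>"
    and inv: "\<forall>y \<in> bd_chart_image ?c \<inter> U. bd_chart_inv k (\<tau> y) = bd_chart_inv ?c y"
    and x\<tau>: "\<forall>q \<in> fst ?c \<inter> fst k. fst (snd ?c q) = 0 \<longrightarrow>
      snd (snd ?c q) \<in> bd_chart_image ?c \<inter> U \<and> \<tau> (snd (snd ?c q)) = snd (snd k q)"
    by (rule bd_chart_change[OF atlas c(1) k(1)])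
  interpret coordinate_change "bd_chart_image ?c" "bd_chart_image k" U W \<tau> \<sigma> by (rule *)
  have "fst (snd ?c p) = 0" using p boundary_iff[OF atlas c] by simp
  then have x: "snd (snd ?c p) \<in> bd_chart_image ?c \<inter> U" and \<tau>x: "\<tau> (snd (snd ?c p)) = snd (snd k p)"
    using x\<tau> c(2) k(2) by blast+
  have fh: "(f \<circ> bd_chart_inv ?c) y = (f \<circ> bd_chart_inv k) (\<tau> y)" if "y \<in> bd_chart_image ?c \<inter> U" for y
    using inv that by simp
  note h = C2_fun_boundary[OF atlas f k(1)]
  show crit: "bd_differential A f p = (\<lambda>v. 0)
      \<longleftrightarrow> (\<forall>v. dir_deriv (bd_chart_image k) v (f \<circ> bd_chart_inv k) (snd (snd k p)) = 0)"
    using critical_change[where f = "f \<circ> bd_chart_inv ?c"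
        and h = "f \<circ> bd_chart_inv k", OF C2_onD(1)[OF h] fh x] unfolding \<tau>x
        by (simp add: bd_differential_def fun_eq_iff Let_def)
  show "nondegenerate (bd_hessian A f p)" if "bd_differential A f p = (\<lambda>v. 0)"
    "\<And>u. hess (bd_chart_image k) (f \<circ> bd_chart_inv k) (snd (snd k p)) u = 0 \<Longrightarrow> u = 0"
    using nondegenerate_change[where f = "f \<circ> bd_chart_inv ?c"
        and h = "f \<circ> bd_chart_inv k", OF unique_derivs_chart(4)[OF atlas k(1)] h fh x] crit that
    unfolding \<tau>x by (simp add: bd_hessian_def[abs_def] Let_def)
qed

text \<open>Finitely many pieces allow a finite intersection of almost sure events, and a pigeonhole
  argument for sequences of points of the manifold. Compactness of each piece, inside its chart,
  supplies convergent subsequences.\<close>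

lemma finite_chart_pieces:
  fixes A :: "('a::t2_space, 'e::euclidean_space) chart set"
  assumes comp: "compact (UNIV :: 'a set)" and atlas: "C2_atlas A"
  obtains R where "finite R" "\<And>k K. (k, K) \<in> R \<Longrightarrow> k \<in> A \<and> compact K \<and> K \<subseteq> chart_image k"
    "\<And>p. \<exists>k K. (k, K) \<in> R \<and> p \<in> fst k \<and> snd k p \<in> K"
proof -
  have "\<exists>r>0. compact (chart_image (chart_at A p) \<inter> cball (snd (chart_at A p) p) r)" for p
  proof (rule locally_compact_half_space)
    have "is_chart (chart_at A p)" using atlas chart_at[OF atlas] by (simp add: C2_atlas_def)
    then show "openin (top_of_set half_space) (chart_image (chart_at A p))"
        "snd (chart_at A p) p \<in> chart_image (chart_at A p)"
      using is_chartD(2,3) chart_at[OF atlas] by blast+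
  qed
  then obtain r where r: "\<And>p. r p > 0"
      "\<And>p. compact (chart_image (chart_at A p) \<inter> cball (snd (chart_at A p) p) (r p))"
    by metis
  define N where "N p = snd (chart_at A p) -` ball (snd (chart_at A p) p) (r p) \<inter> fst (chart_at A p)" for p
  have "open (N p)" for p
  proof -
    have "is_chart (chart_at A p)" using atlas chart_at[OF atlas] by (simp add: C2_atlas_def)
    from is_chartD(1,7)[OF this] show ?thesis
      unfolding N_def by (simp add: continuous_on_open_vimage)
  qed
  moreover have "UNIV \<subseteq> (\<Union>p\<in>UNIV. N p)" using chart_at[OF atlas] r(1) by (auto simp: N_def)
  ultimately obtain C where C: "C \<subseteq> UNIV" "finite C" "UNIV \<subseteq> (\<Union>p\<in>C. N p)"
    by (rule compactE_image[OF comp])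
  define R where "R = (\<lambda>p. (chart_at A p, chart_image (chart_at A p) \<inter> cball (snd (chart_at A p) p) (r p))) ` C"
  show thesis
  proof (rule that[of R])
    show "finite R" using C(2) by (simp add: R_def)
    show "k \<in> A \<and> compact K \<and> K \<subseteq> chart_image k" if "(k, K) \<in> R" for k K
      using that r(2) chart_at(1)[OF atlas] by (auto simp: R_def)
    fix p
    obtain q where q: "q \<in> C" "p \<in> N q" using C(3) by blast
    have "is_chart (chart_at A q)" using atlas chart_at[OF atlas] by (simp add: C2_atlas_def)
    from is_chartD(3)[OF this, of p] q(2) have "p \<in> fst (chart_at A q)"
      "snd (chart_at A q) p \<in> chart_image (chart_at A q) \<inter> cball (snd (chart_at A q) q) (r q)"
      by (auto simp: N_def)
    then show "\<exists>k K. (k, K) \<in> R \<and> p \<in> fst k \<and> snd k p \<in> K"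
      using q(1) unfolding R_def by blast
  qed
qed

section \<open>Transversality\<close>

text \<open>With the velocity \<open>g'\<close> equal to zero this says that there are no critical
  zeros at all; the end times are treated in this form.\<close>

definition nondegenerate_zeros :: "'b::euclidean_space set \<Rightarrow> real set \<Rightarrow> (real \<Rightarrow> 'b \<Rightarrow> real) \<Rightarrow>
    (real \<Rightarrow> 'b \<Rightarrow> real) \<Rightarrow> bool" where
  "nondegenerate_zeros S I g g' \<longleftrightarrow> (\<forall>x\<in>S. \<forall>t\<in>I. val_grad S (g t) x = 0 \<longrightarrow>
     g' t x \<noteq> 0 \<and> (\<forall>u. hess S (g t) x u = 0 \<longrightarrow> u = 0))"

text \<open>If \<open>\<gamma>\<close> stays in the discriminant, critical zeros of \<open>\<gamma> (1/(n+1))\<close> accumulate at a critical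
  zero of \<open>\<gamma> 0\<close>, and by \<open>critical_zero_velocity\<close> the velocity vanishes there.\<close>

lemma not_in_discriminant_tangent:
  fixes A :: "('a::t2_space, 'e::euclidean_space) chart set"
  assumes atlas: "C2_atlas A" and R: "finite R" "\<And>k K. (k, K) \<in> R \<Longrightarrow> k \<in> A \<and> compact K \<and> K \<subseteq> chart_image k"
      "\<And>p. \<exists>k K. (k, K) \<in> R \<and> p \<in> fst k \<and> snd k p \<in> K"
    and int: "\<And>k. k \<in> fst ` R \<Longrightarrow> nondegenerate_zeros (chart_image k) {t} (\<lambda>t. g t \<circ> chart_inv k) (\<lambda>t. g' t
        \<circ> chart_inv k)"
    and bd: "\<And>k. k \<in> fst ` R \<Longrightarrow> nondegenerate_zeros (bd_chart_image k) {t} (\<lambda>t. g t \<circ> bd_chart_inv k) (\<lambda>t. g' t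
        \<circ> bd_chart_inv k)"
  shows "g' t \<notin> discriminant_tangent A (g t)"
proof
  assume "g' t \<in> discriminant_tangent A (g t)"
  then obtain \<gamma> \<gamma>' where \<gamma>: "has_C1_curve_deriv A UNIV \<gamma> \<gamma>'" "\<gamma> 0 = g t" "range \<gamma> \<subseteq> discriminant A"
      and \<gamma>'0: "g' t = \<gamma>' 0"
    by (auto simp: discriminant_tangent_def)
  define s where "s n = inverse (real (Suc n))" for n
  have s: "s \<longlonglongrightarrow> 0" "s n \<noteq> 0" for n
    unfolding s_def[abs_def] by (rule LIMSEQ_inverse_real_of_nat) simp
  have C2: "\<gamma> u \<in> C2_fun A" for u using \<gamma>(3) by (auto simp: discriminant_def)
  \<comment> \<open>The flag \<open>b\<close> records which of the two kinds of critical point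
    occurs, so that it can be made constant along a subsequence together with the chart.\<close>
  define Ok where "Ok n p b \<longleftrightarrow> \<gamma> (s n) p = 0 \<and> b = (p \<in> boundary A)
    \<and> (if b then bd_differential A (\<gamma> (s n)) p = (\<lambda>v. 0) else differential A (\<gamma> (s n)) p = (\<lambda>v. 0))" for n p b
  have "\<exists>p b. Ok n p b" for n
  proof -
    have "\<gamma> (s n) \<notin> regular_set A" using \<gamma>(3) by (auto simp: discriminant_def)
    then have "\<not> regular_value A (\<gamma> (s n)) 0" using C2 by (simp add: regular_set_def)
    then show ?thesis unfolding regular_value_def Ok_def by auto
  qed
  then have "\<exists>a. \<exists>p. Ok n p (snd a) \<and> fst a \<in> R \<and> p \<in> fst (fst (fst a)) \<and> snd (fst (fst a)) p \<in> snd (fst a)" for n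
    using R(3) by (metis fst_conv snd_conv)
  then obtain a p where ap: "\<And>n. Ok n (p n) (snd (a n))" "\<And>n. fst (a n) \<in> R"
    "\<And>n. p n \<in> fst (fst (fst (a n)))" "\<And>n. snd (fst (fst (a n))) (p n) \<in> snd (fst (a n))"
    by metis
  have "finite (range a)"
  proof (rule finite_subset)
    show "range a \<subseteq> R \<times> UNIV" by (rule image_subsetI) (simp add: mem_Times_iff ap(2))
    show "finite (R \<times> (UNIV :: bool set))" using R(1) by simp
  qed
  \<comment> \<open>Pigeonhole on the finitely many combinations of chart piece and kind.\<close>
  then obtain n0 where "infinite {n \<in> UNIV. a n = a n0}"
    using pigeonhole_infinite[of UNIV a] by auto
  then obtain m :: "nat \<Rightarrow> nat" where m: "strict_mono m" "\<And>n. m n \<in> {n \<in> UNIV. a n = a n0}"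
    using infinite_enumerate by blast
  obtain k K b where kKb: "a n0 = ((k, K), b)" by (metis surj_pair)
  have kR: "(k, K) \<in> R" using ap(2)[of n0] kKb by simp
  from R(2)[OF kR] have k: "k \<in> A" and K: "compact K" "K \<subseteq> chart_image k" by blast+
  have kf: "k \<in> fst ` R" using kR by (metis fst_conv imageI)
  have ck: "is_chart k" using atlas k by (simp add: C2_atlas_def)
  have pm: "Ok (m n) (p (m n)) b" "p (m n) \<in> fst k" "snd k (p (m n)) \<in> K" for n
    using ap(1,3,4)[of "m n"] m(2)[of n] kKb by simp_all
  note curve = C1_curve_on_chart[OF atlas \<gamma>(1) k]
  obtain x l where l: "x \<in> K" "strict_mono l" "((\<lambda>n. snd k (p (m n))) \<circ> l) \<longlonglongrightarrow> x"
    using K(1)[unfolded compact_def, rule_format, of "\<lambda>n. snd k (p (m n))"] pm(3) by blast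
  define X where "X n = snd k (p (m (l n)))" for n
  define \<sigma> where "\<sigma> n = s (m (l n))" for n
  have "strict_mono (m \<circ> l)" by (rule strict_mono_o[OF m(1) l(2)])
  then have \<sigma>: "\<sigma> \<longlonglongrightarrow> 0" "\<sigma> n \<noteq> 0" for n
    using LIMSEQ_subseq_LIMSEQ[OF s(1), of "m \<circ> l"] s(2) by (simp_all add: \<sigma>_def[abs_def] comp_def)
  have X: "X \<longlonglongrightarrow> x" "X n \<in> K" for n using l(3) pm(3) by (simp_all add: X_def[abs_def] comp_def)
  have val: "(\<gamma> (\<sigma> n) \<circ> chart_inv k) (X n) = 0" for n
    using pm(1,2)[of "l n"] is_chartD(4)[OF ck] by (simp add: X_def \<sigma>_def Ok_def)
  show False
  proof (cases b)
    case False
    have crit: "val_grad (chart_image k) (\<gamma> (\<sigma> n) \<circ> chart_inv k) (X n) = 0" for n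
    proof -
      have "differential A (\<gamma> (\<sigma> n)) (p (m (l n))) = (\<lambda>v. 0)"
        using pm(1)[of "l n"] False by (simp add: Ok_def \<sigma>_def)
      then show ?thesis
        using critical_in_chart(1)[OF atlas C2 k pm(2)] val X(2)[of n] K(2)
        by (subst val_grad_eq_0_iff[OF C2_onD(1)[OF C2_funD[OF C2 k]]]) (auto simp: X_def)
    qed
    note z = critical_zero_velocity[where \<gamma> = "\<lambda>t. \<gamma> t \<circ> chart_inv k" and \<gamma>' = "\<lambda>t. \<gamma>' t \<circ> chart_inv k",
        OF unique_derivs_chart(2)[OF atlas k] curve K \<sigma> X l(1) crit]
    have "x \<in> chart_image k" using l(1) K(2) by blast
    with int[OF kf] z(1) have nd: "(g' t \<circ> chart_inv k) x \<noteq> 0"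
        "hess (chart_image k) (\<gamma> 0 \<circ> chart_inv k) x u = 0 \<Longrightarrow> u = 0" for u
      unfolding nondegenerate_zeros_def \<gamma>(2) by blast+
    show False using z(2)[OF nd(2)] nd(1) \<gamma>'0 by simp
  next
    case True
    have bdp: "p (m (l n)) \<in> boundary A" for n using pm(1)[of "l n"] True by (simp add: Ok_def)
    have X0: "X n = (0, snd (X n))" for n
      using boundary_iff[OF atlas k pm(2)] bdp by (simp add: X_def prod_eq_iff)
    \<comment> \<open>The limit stays on the boundary hyperplane, so the whole sequence can be read
      in the boundary chart.\<close>
    have "(\<lambda>n. fst (X n)) \<longlonglongrightarrow> fst x" by (rule tendsto_fst[OF X(1)])
    moreover have "fst (X n) = 0" for n using X0[of n] by (metis fst_conv)
    ultimately have "fst x = 0" by (simp add: LIMSEQ_const_iff)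
    define K0 where "K0 = snd ` (K \<inter> {x. fst x = 0})"
    have "closed {x :: real \<times> 'e. fst x = 0}" by (intro closed_Collect_eq continuous_intros)
    then have K0: "compact K0"
      unfolding K0_def by (intro compact_continuous_image compact_Int_closed K(1) continuous_intros)
    have K0S: "K0 \<subseteq> bd_chart_image k"
    proof
      fix y assume "y \<in> K0"
      then have "(0, y) \<in> K" unfolding K0_def
          by (metis (mono_tags, lifting) IntE imageE mem_Collect_eq prod.collapse)
      then show "y \<in> bd_chart_image k" using K(2) by (auto simp: bd_chart_image_def)
    qed
    have XK: "snd (X n) \<in> K0" for n using X(2)[of n] X0[of n] unfolding K0_def
        by (metis (mono_tags, lifting) IntI fst_conv imageI mem_Collect_eq)
    have xK: "snd x \<in> K0" using l(1) \<open>fst x = 0\<close> unfolding K0_def by blast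
    have curve': "C1_curve_on (bd_chart_image k) UNIV (\<lambda>t. \<gamma> t \<circ> bd_chart_inv k) (\<lambda>t. \<gamma>' t \<circ> bd_chart_inv k)"
      unfolding bd_chart_image_def bd_chart_inv_comp
      by (rule C1_curve_on_restrict[OF is_chartD(2)[OF ck] curve])
    have crit: "val_grad (bd_chart_image k) (\<gamma> (\<sigma> n) \<circ> bd_chart_inv k) (snd (X n)) = 0" for n
    proof -
      have "bd_differential A (\<gamma> (\<sigma> n)) (p (m (l n))) = (\<lambda>v. 0)"
        using pm(1)[of "l n"] True by (simp add: Ok_def \<sigma>_def)
      then have "\<forall>v. dir_deriv (bd_chart_image k) v (\<gamma> (\<sigma> n) \<circ> bd_chart_inv k) (snd (X n)) = 0"
        using bd_critical_in_chart(1)[OF atlas C2 k pm(2) bdp] by (simp add: X_def)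
      moreover have "(\<gamma> (\<sigma> n) \<circ> bd_chart_inv k) (snd (X n)) = 0"
        using val[of n] X0[of n] by (simp add: bd_chart_inv_def)
      moreover have "snd (X n) \<in> bd_chart_image k" using XK K0S by blast
      ultimately show ?thesis
        using val_grad_eq_0_iff[OF C2_onD(1)[OF C2_fun_boundary[OF atlas C2 k]]] by blast
    qed
    note z = critical_zero_velocity[where \<gamma> = "\<lambda>t. \<gamma> t \<circ> bd_chart_inv k" and \<gamma>' = "\<lambda>t. \<gamma>' t \<circ> bd_chart_inv k",
        OF unique_derivs_chart(4)[OF atlas k] curve' K0 K0S \<sigma> tendsto_snd[OF X(1)] XK xK crit]
    have "snd x \<in> bd_chart_image k" using xK K0S by blast
    with bd[OF kf] z(1) have nd: "(g' t \<circ> bd_chart_inv k) (snd x) \<noteq> 0"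
        "hess (bd_chart_image k) (\<gamma> 0 \<circ> bd_chart_inv k) (snd x) u = 0 \<Longrightarrow> u = 0" for u
      unfolding nondegenerate_zeros_def \<gamma>(2) by blast+
    show False using z(2)[OF nd(2)] nd(1) \<gamma>'0 by simp
  qed
qed

text \<open>\<open>int\<close> and \<open>bd\<close> give the two Hessian clauses of the Morse
  condition and the velocities used against the tangent space; \<open>normal\<close> gives the
  clause on the full differential at boundary points; \<open>ends\<close> keeps the end points of
  the curve out of the discriminant.\<close>

lemma transverse_if_nondegenerate:
  fixes A :: "('a::t2_space, 'e::euclidean_space) chart set"
  assumes atlas: "C2_atlas A" and R: "finite R" "\<And>k K. (k, K) \<in> R \<Longrightarrow> k \<in> A \<and> compact K \<and> K \<subseteq> chart_image k"
      "\<And>p. \<exists>k K. (k, K) \<in> R \<and> p \<in> fst k \<and> snd k p \<in> K"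
    and g: "has_C1_curve_deriv A {0..1} g g'"
    and int: "\<And>k. k \<in> fst ` R \<Longrightarrow> nondegenerate_zeros (chart_image k) {0..1} (\<lambda>t. g t \<circ> chart_inv k) (\<lambda>t. g' t
        \<circ> chart_inv k)"
    and bd: "\<And>k. k \<in> fst ` R \<Longrightarrow> nondegenerate_zeros (bd_chart_image k) {0..1} (\<lambda>t. g t
        \<circ> bd_chart_inv k) (\<lambda>t. g' t \<circ> bd_chart_inv k)"
    and normal: "\<And>k t x. k \<in> fst ` R \<Longrightarrow> t \<in> {0..1} \<Longrightarrow> x \<in> chart_image k \<Longrightarrow> fst x = 0
        \<Longrightarrow> val_grad (chart_image k) (g t \<circ> chart_inv k) x \<noteq> 0"
    and ends: "\<And>k t x. k \<in> fst ` R \<Longrightarrow> t \<in> {0, 1} \<Longrightarrow> x \<in> chart_image k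
        \<Longrightarrow> val_grad (chart_image k) (g t \<circ> chart_inv k) x \<noteq> 0"
      "\<And>k t y. k \<in> fst ` R \<Longrightarrow> t \<in> {0, 1} \<Longrightarrow> y \<in> bd_chart_image k
          \<Longrightarrow> val_grad (bd_chart_image k) (g t \<circ> bd_chart_inv k) y \<noteq> 0"
  shows "transverse_to_discriminant A {0..1} g"
proof -
  have C2: "g t \<in> C2_fun A" if "t \<in> {0..1}" for t
    using g that by (auto simp: has_C1_curve_deriv_def has_curve_deriv_def)
  have chart: "\<exists>k. k \<in> fst ` R \<and> k \<in> A \<and> p \<in> fst k \<and> is_chart k" for p
  proof -
    obtain k K where "(k, K) \<in> R" "p \<in> fst k" using R(3) by blast
    then show ?thesis using R(2)[of k K] atlas by (intro exI[of _ k]) (auto simp: C2_atlas_def intro: rev_image_eqI)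
  qed
  have crit: "val_grad (chart_image k) (g t \<circ> chart_inv k) (snd k p) = 0"
    if t: "t \<in> {0..1}" and k: "k \<in> A" "p \<in> fst k" and z: "g t p = 0" "differential A (g t) p = (\<lambda>v. 0)" for t k p
  proof -
    have ck: "is_chart k" using atlas k by (simp add: C2_atlas_def)
    show ?thesis
      using critical_in_chart(1)[OF atlas C2[OF t] k] z is_chartD(3,4)[OF ck k(2)]
      by (subst val_grad_eq_0_iff[OF C2_onD(1)[OF C2_funD[OF C2[OF t] k(1)]]]) auto
  qed
  have bd_crit: "val_grad (bd_chart_image k) (g t \<circ> bd_chart_inv k) (snd (snd k p))
      = 0 \<and> snd (snd k p) \<in> bd_chart_image k"
    if t: "t \<in> {0..1}" and k: "k \<in> A" "p \<in> fst k" and p: "p \<in> boundary A"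
        and z: "g t p = 0" "bd_differential A (g t) p = (\<lambda>v. 0)" for t k p
  proof -
    have ck: "is_chart k" using atlas k by (simp add: C2_atlas_def)
    have eq: "(0, snd (snd k p)) = snd k p" using boundary_iff[OF atlas k] p by (simp add: prod_eq_iff)
    have mem: "snd (snd k p) \<in> bd_chart_image k" using is_chartD(3)[OF ck k(2)] by (simp add: bd_chart_image_def eq)
    moreover have "(g t \<circ> bd_chart_inv k) (snd (snd k p)) = 0"
      using z(1) is_chartD(4)[OF ck k(2)] by (simp add: bd_chart_inv_def eq)
    ultimately show ?thesis
      using bd_critical_in_chart(1)[OF atlas C2[OF t] k p] z(2)
        val_grad_eq_0_iff[OF C2_onD(1)[OF C2_fun_boundary[OF atlas C2[OF t] k(1)]] mem] by simp
  qed
  have main: "g t \<in> morse_set A \<and> g' t \<notin> discriminant_tangent A (g t)" if t: "t \<in> {0..1}"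
      and disc: "g t \<in> discriminant A" for t
  proof
    have 1: "nondegenerate (hessian A (g t) p)" if z: "g t p = 0" "differential A (g t) p = (\<lambda>v. 0)" for p
    proof -
      obtain k where k: "k \<in> fst ` R" "k \<in> A" "p \<in> fst k" "is_chart k" using chart by blast
      have "hess (chart_image k) (g t \<circ> chart_inv k) (snd k p) u = 0 \<Longrightarrow> u = 0" for u
        using int[OF k(1)] crit[OF t k(2,3) z] t is_chartD(3)[OF k(4,3)] unfolding nondegenerate_zeros_def by blast
      then show ?thesis by (rule critical_in_chart(2)[OF atlas C2[OF t] k(2,3) z(2)])
    qed
    have 2: "nondegenerate (bd_hessian A (g t) p)" if p: "p \<in> boundary A"
        and z: "g t p = 0" "bd_differential A (g t) p = (\<lambda>v. 0)" for p
    proof -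
      obtain k where k: "k \<in> fst ` R" "k \<in> A" "p \<in> fst k" "is_chart k" using chart by blast
      have "hess (bd_chart_image k) (g t \<circ> bd_chart_inv k) (snd (snd k p)) u = 0 \<Longrightarrow> u = 0" for u
        using bd[OF k(1)] bd_crit[OF t k(2,3) p z] t unfolding nondegenerate_zeros_def by blast
      then show ?thesis by (rule bd_critical_in_chart(2)[OF atlas C2[OF t] k(2,3) p z(2)])
    qed
    have 3: "differential A (g t) p \<noteq> (\<lambda>v. 0)" if p: "p \<in> boundary A" "g t p = 0" for p
    proof
      assume z: "differential A (g t) p = (\<lambda>v. 0)"
      obtain k where k: "k \<in> fst ` R" "k \<in> A" "p \<in> fst k" "is_chart k" using chart by blast
      have "fst (snd k p) = 0" using boundary_iff[OF atlas k(2,3)] p by simp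
      then show False using normal[OF k(1) t is_chartD(3)[OF k(4,3)]] crit[OF t k(2,3) p(2) z] by blast
    qed
    have "\<not> regular_value A (g t) 0" using disc C2[OF t] by (simp add: discriminant_def regular_set_def)
    then show "g t \<in> morse_set A"
      using 1 2 3 C2[OF t] unfolding morse_set_def morse_critical_value_def by blast
    show "g' t \<notin> discriminant_tangent A (g t)"
    proof (rule not_in_discriminant_tangent[OF atlas R])
      fix k assume "k \<in> fst ` R"
      from int[OF this] bd[OF this] t
      show "nondegenerate_zeros (chart_image k) {t} (\<lambda>t. g t \<circ> chart_inv k) (\<lambda>t. g' t \<circ> chart_inv k)"
        "nondegenerate_zeros (bd_chart_image k) {t} (\<lambda>t. g t \<circ> bd_chart_inv k) (\<lambda>t. g' t \<circ> bd_chart_inv k)"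
        unfolding nondegenerate_zeros_def by blast+
    qed
  qed
  have end_regular: "g t \<notin> discriminant A" if t: "t \<in> {0, 1}" for t
  proof
    have t': "t \<in> {0..1}" using t by auto
    assume "g t \<in> discriminant A"
    then have "\<not> regular_value A (g t) 0" using C2[OF t'] by (simp add: discriminant_def regular_set_def)
    then obtain p where p: "g t p = 0" "differential A (g t) p
        = (\<lambda>v. 0) \<or> (p \<in> boundary A \<and> bd_differential A (g t) p = (\<lambda>v. 0))"
      unfolding regular_value_def by blast
    obtain k where k: "k \<in> fst ` R" "k \<in> A" "p \<in> fst k" "is_chart k" using chart by blast
    from p(2) show False
    proof
      assume "differential A (g t) p = (\<lambda>v. 0)"
      then show False using ends(1)[OF k(1) t is_chartD(3)[OF k(4,3)]] crit[OF t' k(2,3) p(1)] by blast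
    next
      assume "p \<in> boundary A \<and> bd_differential A (g t) p = (\<lambda>v. 0)"
      then show False using ends(2)[OF k(1) t] bd_crit[OF t' k(2,3) _ p(1)] by blast
    qed
  qed
  have "{0..1} \<inter> frontier {0..1} = {0, 1 :: real}" by (auto simp: frontier_def)
  then have "g ` ({0..1} \<inter> frontier {0..1}) \<inter> discriminant A = {}"
    using end_regular[of 0] end_regular[of 1] by simp
  with g main show ?thesis
    unfolding transverse_to_discriminant_def by (intro exI[of _ g'] conjI ballI impI) blast+
qed

section \<open>From the density hypothesis to almost sure transversality\<close>

text \<open>A nontrivial linear relation would concentrate the law on a line through the origin,
  which is Lebesgue null.\<close>

lemma not_AE_linear_relation:
  assumes "prob_space P" and dens: "admits_density P (\<lambda>\<omega>. (X \<omega> :: real, Y \<omega> :: real))" and ab: "(a, b) \<noteq> (0, 0)"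
  shows "\<not> (AE \<omega> in P. a * X \<omega> + b * Y \<omega> = 0)"
proof
  interpret prob_space P by fact
  assume rel: "AE \<omega> in P. a * X \<omega> + b * Y \<omega> = 0"
  obtain Z \<rho> where Z: "AE \<omega> in P. Z \<omega> = (X \<omega>, Y \<omega>)" and D: "distributed P lborel Z \<rho>"
    using dens by (auto simp: admits_density_def)
  have mZ: "Z \<in> measurable P lborel" using D by (rule distributed_measurable)
  have "AE z in lborel. (a, b) \<bullet> z \<noteq> 0"
  proof (rule AE_lborel_if_negligible)
    have "closed {z. (a, b) \<bullet> z = 0}" by (rule closed_hyperplane)
    then show "{z. \<not> (a, b) \<bullet> z \<noteq> 0} \<in> sets borel" by simp
    have "(a, b) \<noteq> 0" using ab by (auto simp: prod_eq_iff)
    then show "negligible {z. \<not> (a, b) \<bullet> z \<noteq> 0}" using negligible_hyperplane[of "(a, b)" 0] by simp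
  qed
  then have "AE z in density lborel \<rho>. (a, b) \<bullet> z \<noteq> 0"
    using distributed_borel_measurable[OF D] by (subst AE_density) (auto elim: eventually_mono)
  then have "AE z in distr P lborel Z. (a, b) \<bullet> z \<noteq> 0"
    by (simp only: distributed_distr_eq_density[OF D])
  then have "AE \<omega> in P. (a, b) \<bullet> Z \<omega> \<noteq> 0" by (rule AE_distrD[OF mZ])
  with rel Z have "AE \<omega> in P. False" by eventually_elim auto
  then show False by simp
qed

text \<open>A relation between the value and the gradient in chart \<open>k\<close> is a relation
  between the value and one directional derivative in the preferred chart, the direction being
  transported by the invertible Jacobian.\<close>

lemma chart_gradient_nondegenerate:
  fixes A :: "('a::t2_space, 'e::euclidean_space) chart set"
  assumes atlas: "C2_atlas A" and "prob_space P" and C2: "\<And>\<omega>. X' \<omega> \<in> C2_fun A" and eq: "AE \<omega> in P. X' \<omega> = X \<omega>"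
    and dens: "\<And>p v. v \<noteq> 0 \<Longrightarrow> admits_density P (\<lambda>\<omega>. (X \<omega> p, differential A (X \<omega>) p v))"
    and k: "k \<in> A" and x: "x \<in> chart_image k" and \<eta>: "\<eta> \<noteq> 0"
  shows "\<not> (AE \<omega> in P. val_grad (chart_image k) (X' \<omega> \<circ> chart_inv k) x \<bullet> \<eta> = 0)"
proof
  assume AE: "AE \<omega> in P. val_grad (chart_image k) (X' \<omega> \<circ> chart_inv k) x \<bullet> \<eta> = 0"
  define p where "p = chart_inv k x"
  let ?c = "chart_at A p"
  note c = chart_at[OF atlas, of p]
  have cc: "is_chart ?c" and ck: "is_chart k" using atlas c k by (simp_all add: C2_atlas_def)
  have pk: "p \<in> fst k" "snd k p = x" using is_chartD(5,6)[OF ck x] by (simp_all add: p_def)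
  obtain U W where *: "coordinate_change (chart_image k) (chart_image ?c) U W (snd ?c \<circ> chart_inv k) (snd k
      \<circ> chart_inv ?c)"
    and U: "chart_image k \<inter> U = snd k ` (fst k \<inter> fst ?c)"
    by (rule chart_change[OF atlas k c(1)])
  interpret coordinate_change "chart_image k" "chart_image ?c" U W "snd ?c \<circ> chart_inv k"
      "snd k \<circ> chart_inv ?c" by (rule *)
  have xU: "x \<in> chart_image k \<inter> U" using U c pk by auto
  have D: "dir_deriv (chart_image k) v (f \<circ> chart_inv k) x = differential A f p (jac x v)"
      if f: "f \<in> C2_fun A" for f v
  proof -
    have fh: "(f \<circ> chart_inv k) y = (f \<circ> chart_inv ?c) ((snd ?c \<circ> chart_inv k) y)" if "y \<in> chart_image k \<inter> U" for y
      using that is_chartD(4)[OF cc] is_chartD(4)[OF ck] unfolding U by auto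
    have "(snd ?c \<circ> chart_inv k) x = snd ?c p" by (simp add: p_def)
    then show ?thesis
      using dir_deriv_change[where f = "f \<circ> chart_inv k"
          and h = "f \<circ> chart_inv ?c", OF C2_onD(1)[OF C2_funD[OF f c(1)]] fh xU, of v]
      by (simp add: differential_def Let_def)
  qed
  have "AE \<omega> in P. fst \<eta> * X \<omega> p + differential A (X \<omega>) p (jac x (snd \<eta>)) = 0"
    using AE eq
  proof eventually_elim
    case (elim \<omega>)
    have "val_grad (chart_image k) (X' \<omega> \<circ> chart_inv k) x \<bullet> \<eta>
        = fst \<eta> * X' \<omega> p + differential A (X' \<omega>) p (jac x (snd \<eta>))"
      using val_grad_inner[OF C2_onD(1)[OF C2_funD[OF C2 k]] x] D[OF C2] by (simp add: p_def)
    then show ?case using elim by simp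
  qed
  note rel = this
  show False
  proof (cases "snd \<eta> = 0")
    case False
    then have "jac x (snd \<eta>) \<noteq> 0"
      using inj_jac[OF xU] linear_0[OF linear_jac[OF xU]] by (metis injD)
    from not_AE_linear_relation[OF \<open>prob_space P\<close> dens[OF this], of "fst \<eta>" 1] rel show False by simp
  next
    case True
    \<comment> \<open>The relation involves the value alone; the density hypothesis is then used
      with an arbitrary nonzero direction, here \<open>(1, 0)\<close>, and coefficient 0.\<close>
    then have "fst \<eta> \<noteq> 0" using \<eta> by (simp add: prod_eq_iff)
    have "jac x (snd \<eta>) = 0" using True linear_0[OF linear_jac[OF xU]] by simp
    moreover have "differential A f p 0 = 0" if f: "f \<in> C2_fun A" for f
      unfolding differential_def Let_def
      by (rule linear_0[OF linear_dir_deriv[OF C2_onD(1)[OF C2_funD[OF f c(1)]] is_chartD(3)[OF cc c(2)]]])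
    ultimately have z: "differential A (X' \<omega>) p (jac x (snd \<eta>)) = 0" for \<omega> using C2[of \<omega>] by simp
    have "AE \<omega> in P. fst \<eta> * X \<omega> p + 0 * differential A (X \<omega>) p (1, 0) = 0"
      using rel eq
    proof eventually_elim
      case (elim \<omega>)
      then show ?case using z[of \<omega>] by simp
    qed
    moreover have "admits_density P (\<lambda>\<omega>. (X \<omega> p, differential A (X \<omega>) p (1, 0)))"
      by (rule dens) (simp add: prod_eq_iff)
    ultimately show False
      using not_AE_linear_relation[OF \<open>prob_space P\<close>, of "\<lambda>\<omega>. X \<omega> p" "\<lambda>\<omega>. differential A (X \<omega>) p (1, 0)" "fst \<eta>" 0]
        \<open>fst \<eta> \<noteq> 0\<close> by simp
  qed
qed

text \<open>For the end times: freezing the curve at one time gives zero velocity, so nondegeneracy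
  of its critical zeros excludes them.\<close>

lemma C1_curve_on_const:
  assumes "unique_derivs S" "C2_on S f"
  shows "C1_curve_on S I (\<lambda>_. f) (\<lambda>_ _. 0)"
proof -
  have z: "dir_deriv S v (\<lambda>_. 0 :: real) x = 0" if "x \<in> S" for v x
    by (rule dir_deriv_eq[OF assms(1) that]) (rule has_derivative_const)
  have "uniform_limit K (\<lambda>s x. 0) (dir_deriv S v (\<lambda>_. 0 :: real)) (at t within I)" if "K \<subseteq> S" for K v and t :: real
    using uniform_limit_cong'[of K "\<lambda>s x. 0" "\<lambda>s x. 0" "dir_deriv S v (\<lambda>_. 0)" "\<lambda>_. 0" "at t within I"] z that
    by (auto intro: uniform_limit_const)
  then show ?thesis
    using assms C2_on_zero[OF assms(1)] by (auto simp: C1_curve_on_def intro: uniform_limit_const)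
qed

lemma (in gaussian_space) transverse_AE_aux:
  fixes A :: "('a::t2_space, 'e::euclidean_space) chart set" and X' :: "'w \<Rightarrow> 'a \<Rightarrow> real"
  assumes atlas: "C2_atlas A" and C2: "\<And>\<omega>. X' \<omega> \<in> C2_fun A" and V: "\<And>p. (\<lambda>\<omega>. X' \<omega> p) \<in> V"
    and nondeg: "\<forall>x\<in>chart_image k. \<forall>\<eta>. \<eta> \<noteq> 0
        \<longrightarrow> \<not> (AE \<omega> in P. val_grad (chart_image k) (X' \<omega> \<circ> chart_inv k) x \<bullet> \<eta> = 0)"
    and k: "k \<in> A" and g: "C1_curve_on (chart_image k) I (\<lambda>t. c t \<circ> chart_inv k) c'" and I: "compact I"
  shows "AE \<omega> in P. nondegenerate_zeros (chart_image k) I (\<lambda>t. (\<lambda>p. c t p + X' \<omega> p) \<circ> chart_inv k) c'"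
    and "AE \<omega> in P. nondegenerate_zeros (bd_chart_image k) I (\<lambda>t. (\<lambda>p. c t p + X' \<omega> p)
        \<circ> bd_chart_inv k) (\<lambda>t y. c' t (0, y))"
    and "AE \<omega> in P. \<forall>x\<in>chart_image k. fst x = 0
        \<longrightarrow> (\<forall>t\<in>I. val_grad (chart_image k) ((\<lambda>p. c t p + X' \<omega> p) \<circ> chart_inv k) x \<noteq> 0)"
proof -
  note S = unique_derivs_chart[OF atlas k]
  note C2k = C2_funD[OF C2 k]
  have Vk: "(\<lambda>\<omega>. (X' \<omega> \<circ> chart_inv k) x) \<in> V" for x using V by (simp add: comp_def)
  have nd: "expectation (\<lambda>\<omega>. (val_grad (chart_image k) (X' \<omega> \<circ> chart_inv k) x \<bullet> \<eta>)\<^sup>2) \<noteq> 0"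
    if x: "x \<in> chart_image k" and \<eta>: "\<eta> \<noteq> 0" for x \<eta>
  proof
    have "(\<lambda>\<omega>. val_grad (chart_image k) (X' \<omega> \<circ> chart_inv k) x \<bullet> \<eta>) \<in> V"
      unfolding val_grad_inner[OF C2_onD(1)[OF C2k] x]
      by (intro add scale Vk dir_deriv_in_V[OF S(2) C2_onD(1)[OF C2k] Vk] x)
    from integral_nonneg_eq_0_iff_AE[OF integrable_square[OF this]]
    have "expectation (\<lambda>\<omega>. (val_grad (chart_image k) (X' \<omega> \<circ> chart_inv k) x \<bullet> \<eta>)\<^sup>2) = 0
        \<longleftrightarrow> (AE \<omega> in P. val_grad (chart_image k) (X' \<omega> \<circ> chart_inv k) x \<bullet> \<eta> = 0)" by simp
    moreover assume "expectation (\<lambda>\<omega>. (val_grad (chart_image k) (X' \<omega> \<circ> chart_inv k) x \<bullet> \<eta>)\<^sup>2) = 0"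
    ultimately show False using nondeg x \<eta> by blast
  qed
  have nd': "expectation (\<lambda>\<omega>. (val_grad (bd_chart_image k) (\<lambda>y. (X' \<omega> \<circ> chart_inv k) (0, y)) y \<bullet> \<eta>)\<^sup>2) \<noteq> 0"
    if y: "y \<in> bd_chart_image k" and \<eta>: "\<eta> \<noteq> 0" for y \<eta>
  proof -
    have y': "(0, y) \<in> chart_image k" using y by (simp add: bd_chart_image_def)
    have "(fst \<eta>, 0, snd \<eta>) \<noteq> 0" using \<eta> by (auto simp: prod_eq_iff)
    from nd[OF y' this] show ?thesis
      unfolding bd_chart_image_def val_grad_restrict[OF S(1) C2_onD(1)[OF C2k] y'] .
  qed
  have C2b: "C2_on (bd_chart_image k) (\<lambda>y. (X' \<omega> \<circ> chart_inv k) (0, y))" for \<omega>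
    using C2_fun_boundary[OF atlas C2 k] unfolding bd_chart_inv_comp .
  have gb: "C1_curve_on (bd_chart_image k) I (\<lambda>t y. (c t \<circ> chart_inv k) (0, y)) (\<lambda>t y. c' t (0, y))"
    unfolding bd_chart_image_def by (rule C1_curve_on_restrict[OF S(1) g])
  show "AE \<omega> in P. nondegenerate_zeros (chart_image k) I (\<lambda>t. (\<lambda>p. c t p + X' \<omega> p) \<circ> chart_inv k) c'"
    using nondegenerate_AE[OF S(2) C2k Vk g I locally_compact_half_space[OF S(1)] nd]
    by (simp add: nondegenerate_zeros_def comp_def)
  show "AE \<omega> in P. nondegenerate_zeros (bd_chart_image k) I (\<lambda>t. (\<lambda>p. c t p + X' \<omega> p)
      \<circ> bd_chart_inv k) (\<lambda>t y. c' t (0, y))"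
    using nondegenerate_AE[OF S(4) C2b Vk gb I locally_compact_open[OF S(3)] nd']
    by (simp add: nondegenerate_zeros_def comp_def bd_chart_inv_def)
  show "AE \<omega> in P. \<forall>x\<in>chart_image k. fst x = 0
      \<longrightarrow> (\<forall>t\<in>I. val_grad (chart_image k) ((\<lambda>p. c t p + X' \<omega> p) \<circ> chart_inv k) x \<noteq> 0)"
    using no_boundary_zero_AE[OF S(2) C2k Vk g I locally_compact_half_space[OF S(1)] nd]
    by (simp add: comp_def)
qed

theorem theorem5p10:
  fixes A :: "('a::t2_space, 'e::euclidean_space) chart set"
    and m :: nat
    and g :: "'a \<Rightarrow> real \<times> 'e \<Rightarrow> real \<times> 'e \<Rightarrow> real"
    and P :: "'w measure"
    and X :: "'w \<Rightarrow> 'a \<Rightarrow> real"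
    and c :: "real \<Rightarrow> 'a \<Rightarrow> real"
  assumes "compact (UNIV :: 'a set)"
    and "C2_atlas A"
    and "m = DIM(real \<times> 'e)" and "m \<ge> 2"
    and "riemannian_metric A g"
    and "prob_space P"
    and "centered_gaussian_field P X"
    and "AE \<omega> in P. X \<omega> \<in> C2_fun A"
    and "\<And>p v. v \<noteq> 0 \<Longrightarrow> admits_density P (\<lambda>\<omega>. (X \<omega> p, differential A (X \<omega>) p v))"
    and "C2_curve A {0..1} c"
  shows "AE \<omega> in P. transverse_to_discriminant A {0..1} (\<lambda>t p. c t p + X \<omega> p)"
proof -
  note atlas = assms(2) and field = assms(7)
  interpret prob_space P by fact
  interpret G: gaussian_space P "gaussian_hull P X" by (rule gaussian_space_hull[OF field])
  obtain N where N: "{\<omega> \<in> space P. \<not> X \<omega> \<in> C2_fun A} \<subseteq> N" "emeasure P N = 0" "N \<in> sets P"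
    using AE_E[OF assms(8)] by blast
  \<comment> \<open>A modification that is of class C^2 for every outcome, as derivatives are taken
    pathwise in all lemmas on the Gaussian space.\<close>
  define X' where "X' \<omega> = (if \<omega> \<in> space P - N then X \<omega> else (\<lambda>_. 0))" for \<omega>
  have zero: "(\<lambda>_. 0) \<in> C2_fun A"
    using C2_on_zero[OF unique_derivs_chart(2)[OF atlas]] by (simp add: C2_fun_def comp_def)
  have C2: "X' \<omega> \<in> C2_fun A" for \<omega> using N(1) zero by (auto simp: X'_def)
  have "AE \<omega> in P. \<omega> \<notin> N" using N(2,3) by (intro AE_not_in null_setsI)
  then have eq: "AE \<omega> in P. X' \<omega> = X \<omega>"
    by (rule AE_mp) (simp add: X'_def)
  \<comment> \<open>The constant sequence \<open>X \<omega> p\<close> converges almost surely to the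
    modified value, so the closure axiom applies.\<close>
  have V: "(\<lambda>\<omega>. X' \<omega> p) \<in> gaussian_hull P X" for p
  proof (rule G.limit[where U = "\<lambda>_ \<omega>. X \<omega> p"])
    show XV: "(\<lambda>\<omega>. X \<omega> p) \<in> gaussian_hull P X" by (rule field_in_gaussian_hull[OF field])
    have "(\<lambda>\<omega>. if \<omega> \<in> space P - N then X \<omega> p else 0) \<in> borel_measurable P"
      using N(3) G.measurable_V[OF XV] by (intro measurable_If_set) auto
    moreover have "(\<lambda>\<omega>. X' \<omega> p) = (\<lambda>\<omega>. if \<omega> \<in> space P - N then X \<omega> p else 0)"
      by (auto simp: X'_def)
    ultimately show "(\<lambda>\<omega>. X' \<omega> p) \<in> borel_measurable P" by simp
    show "AE \<omega> in P. (\<lambda>n. X \<omega> p) \<longlonglongrightarrow> X' \<omega> p"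
      using eq by eventually_elim simp
  qed
  obtain c' where c': "has_C1_curve_deriv A {0..1} c c'"
    using has_C1_curve_deriv_if_C2_curve[OF atlas assms(10)] by blast
  obtain R where R: "finite R" "\<And>k K. (k, K) \<in> R \<Longrightarrow> k \<in> A \<and> compact K \<and> K \<subseteq> chart_image k"
    "\<And>p. \<exists>k K. (k, K) \<in> R \<and> p \<in> fst k \<and> snd k p \<in> K"
    by (rule finite_chart_pieces[OF assms(1) atlas]) blast
  have kA: "k \<in> A" if "k \<in> fst ` R" for k using R(2) that by fastforce
  have nondeg: "\<not> (AE \<omega> in P. val_grad (chart_image k) (X' \<omega> \<circ> chart_inv k) x \<bullet> \<eta> = 0)"
    if "k \<in> A" "x \<in> chart_image k" "\<eta> \<noteq> 0" for k x \<eta>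
    by (rule chart_gradient_nondegenerate[OF atlas \<open>prob_space P\<close> C2 eq assms(9) that])
  \<comment> \<open>The last conjunct uses zero velocity and a dummy time interval
    \<open>{0}\<close> to say that neither end point of the curve has a critical zero.\<close>
  define Good where "Good k \<omega> \<longleftrightarrow>
      nondegenerate_zeros (chart_image k) {0..1} (\<lambda>t. (\<lambda>p. c t p + X' \<omega> p) \<circ> chart_inv k) (\<lambda>t. c' t \<circ> chart_inv k)
    \<and> nondegenerate_zeros (bd_chart_image k) {0..1} (\<lambda>t. (\<lambda>p. c t p + X' \<omega> p) \<circ> bd_chart_inv k)
        (\<lambda>t. c' t \<circ> bd_chart_inv k)
    \<and> (\<forall>x\<in>chart_image k. fst x = 0 \<longrightarrow>
        (\<forall>t\<in>{0..1}. val_grad (chart_image k) ((\<lambda>p. c t p + X' \<omega> p) \<circ> chart_inv k) x \<noteq> 0))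
    \<and> (\<forall>t\<in>{0, 1}. nondegenerate_zeros (chart_image k) {0} (\<lambda>_. (\<lambda>p. c t p + X' \<omega> p) \<circ> chart_inv k) (\<lambda>_ _. 0)
        \<and> nondegenerate_zeros (bd_chart_image k) {0} (\<lambda>_. (\<lambda>p. c t p + X' \<omega> p) \<circ> bd_chart_inv k)
            (\<lambda>_ _. 0))" for k :: "('a, 'e) chart" and \<omega>
  have good: "AE \<omega> in P. Good k \<omega>" if k: "k \<in> A" for k
  proof -
    have nd: "\<forall>x\<in>chart_image k. \<forall>\<eta>. \<eta> \<noteq> 0 \<longrightarrow> \<not> (AE \<omega> in P. val_grad (chart_image k) (X' \<omega> \<circ> chart_inv k) x \<bullet> \<eta> = 0)"
      using nondeg[OF k] by blast
    note main = G.transverse_AE_aux[OF atlas C2 V nd k C1_curve_on_chart[OF atlas c' k] compact_Icc]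
    have C2c: "C2_on (chart_image k) (c t \<circ> chart_inv k)" if "t \<in> {0, 1}" for t
      using c' k that by (intro C2_funD) (auto simp: has_C1_curve_deriv_def has_curve_deriv_def)
    \<comment> \<open>The same statement for the curve frozen at an end time.\<close>
    note const = G.transverse_AE_aux[where c = "\<lambda>_. c _" and I = "{0}", OF atlas C2 V nd k
        C1_curve_on_const[OF unique_derivs_chart(2)[OF atlas k] C2c] compact_sing]
    have bdc: "(\<lambda>t y. (c' t \<circ> chart_inv k) (0, y)) = (\<lambda>t. c' t \<circ> bd_chart_inv k)"
      by (simp add: fun_eq_iff bd_chart_inv_def)
    have 0: "(0::real) \<in> {0, 1}" and 1: "(1::real) \<in> {0, 1}" by simp_all
    from main(1,3) main(2)[unfolded bdc] const(1)[OF 0] const(2)[OF 0] const(1)[OF 1] const(2)[OF 1]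
    show ?thesis
    proof eventually_elim
      case (elim \<omega>)
      then show ?case by (simp add: Good_def)
    qed
  qed
  have "AE \<omega> in P. \<forall>k\<in>fst ` R. Good k \<omega>"
    using R(1) good kA by (intro AE_ball_countable'[OF _ countable_finite]) auto
  then show ?thesis
    using eq
  proof eventually_elim
    case (elim \<omega>)
    have ends: "val_grad (chart_image k) ((\<lambda>p. c t p + X' \<omega> p) \<circ> chart_inv k) x \<noteq> 0"
      if "k \<in> fst ` R" "t \<in> {0, 1}" "x \<in> chart_image k" for k t x
      using elim(1) that unfolding Good_def nondegenerate_zeros_def by blast
    have bd_ends: "val_grad (bd_chart_image k) ((\<lambda>p. c t p + X' \<omega> p) \<circ> bd_chart_inv k) y \<noteq> 0"
      if "k \<in> fst ` R" "t \<in> {0, 1}" "y \<in> bd_chart_image k" for k t y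
      using elim(1) that unfolding Good_def nondegenerate_zeros_def by blast
    have "transverse_to_discriminant A {0..1} (\<lambda>t p. c t p + X' \<omega> p)"
    proof (rule transverse_if_nondegenerate[OF atlas R(1) R(2) R(3) has_C1_curve_deriv_translate[OF atlas c' C2]])
      fix k assume k: "k \<in> fst ` R"
      then have G: "Good k \<omega>" using elim(1) by blast
      show "nondegenerate_zeros (chart_image k) {0..1} (\<lambda>t. (\<lambda>p. c t p + X' \<omega> p) \<circ> chart_inv k) (\<lambda>t. c' t
          \<circ> chart_inv k)"
        "nondegenerate_zeros (bd_chart_image k) {0..1} (\<lambda>t. (\<lambda>p. c t p + X' \<omega> p) \<circ> bd_chart_inv k) (\<lambda>t. c' t
            \<circ> bd_chart_inv k)"
        using G unfolding Good_def by blast+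
      show "val_grad (chart_image k) ((\<lambda>p. c t p + X' \<omega> p) \<circ> chart_inv k) x \<noteq> 0"
        if "t \<in> {0..1}" "x \<in> chart_image k" "fst x = 0" for t x
        using G that unfolding Good_def by blast
    qed (fact ends bd_ends | assumption)+
    then show ?case using elim(2) by simp
  qed
qed

end
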